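(* Let $a,b>0$, $\alpha\in(0,3)$ and $p>4$. Let $h:\mathbb{Z}^3\to\mathbb{R}$ satisfy: (1) there exists $h_0>0$ with $h(x)\ge h_0$ for all $x\in\mathbb{Z}^3$; (2) there is $x_0\in\mathbb{Z}^3$ such that $h(x)\to\infty$ as $|x-x_0|\to\infty$. Then the equation $$-\Big(a+b\int_{\mathbb{Z}^3}|\nabla u|^2\,d\mu\Big)\Delta u+h(x)u=(R_\alpha\ast|u|^p)|u|^{p-2}u,\quad x\in\mathbb{Z}^3,$$ has a ground state sign-changing solution, i.e. there is $u\in\mathcal{M}$ with $J'(u)=0$ and $J(u)=m=\inf_{v\in\mathcal{M}}J(v)$.
   Context: $\mathbb{Z}^3$ is the integer lattice graph: $x\sim y$ iff $\sum_{i=1}^3|x_i-y_i|=1$; $|x-y|$ denotes graph distance; $\mu$ is counting measure. For $u:\mathbb{Z}^3\to\mathbb{R}$, $\Delta u(x)=\sum_{y\sim x}(u(y)-u(x))$, $|\nabla u|(x)=\big(\tfrac12\sum_{y\sim x}(u(y)-u(x))^2\big)^{1/2}$, $\int\nabla u\nabla v\,d\mu=\sum_x\tfrac12\sum_{y\sim x}(u(y)-u(x))(v(y)-v(x))$. $R_\alpha(x,y)=\frac{K_\alpha}{(2\pi)^3}\int_{\mathbb{T}^3}e^{i(x-y)\cdot k}\mu(k)^{-\alpha/2}dk$ with $K_\alpha=\frac{1}{(2\pi)^3}\int_{\mathbb{T}^3}\mu(k)^{\alpha/2}dk$, $\mu(k)=6-2\sum_j\cos k_j$, $\mathbb{T}^3=[0,2\pi]^3$;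 $(R_\alpha\ast f)(x)=\sum_yR_\alpha(x,y)f(y)$. $H=\{u\in H^1(\mathbb{Z}^3):\sum hu^2<\infty\}$ with $\|u\|^2=\sum_x(a|\nabla u|^2+h u^2)$, where $H^1(\mathbb{Z}^3)$ is the completion of finitely supported functions under $\sum(|\nabla u|^2+u^2)$. $J(u)=\frac12\|u\|^2+\frac b4(\int|\nabla u|^2d\mu)^2-\frac1{2p}\int(R_\alpha\ast|u|^p)|u|^pd\mu$, with $(J'(u),\phi)=\int(a\nabla u\nabla\phi+hu\phi)d\mu+b\int|\nabla u|^2d\mu\int\nabla u\nabla\phi\,d\mu-\int(R_\alpha\ast|u|^p)|u|^{p-2}u\phi\,d\mu$. With $u^+=\max\{u,0\}$, $u^-=\min\{u,0\}$, the sign-changing Nehari manifold is $\mathcal{M}=\{u\in H:u^\pm\neq0,\ (J'(u),u^+)=(J'(u),u^-)=0\}$. *)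

theory Defs
  imports "HOL-Analysis.Analysis"
begin

type_synonym lat = "int \<times> int \<times> int"

definition ldist :: "lat \<Rightarrow> lat \<Rightarrow> int" where
  "ldist x y = \<bar>fst x - fst y\<bar> + \<bar>fst (snd x) - fst (snd y)\<bar> + \<bar>snd (snd x) - snd (snd y)\<bar>"

definition nbrs :: "lat \<Rightarrow> lat set" where
  "nbrs x = {y. ldist x y = 1}"

definition lap :: "(lat \<Rightarrow> real) \<Rightarrow> lat \<Rightarrow> real" where
  "lap u x = (\<Sum>y\<in>nbrs x. u y - u x)"

definition grad_sq :: "(lat \<Rightarrow> real) \<Rightarrow> lat \<Rightarrow> real" where
  "grad_sq u x = (1/2) * (\<Sum>y\<in>nbrs x. (u y - u x)^2)"

definition grad_prod :: "(lat \<Rightarrow> real) \<Rightarrow> (lat \<Rightarrow> real) \<Rightarrow> lat \<Rightarrow> real" where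
  "grad_prod u v x = (1/2) * (\<Sum>y\<in>nbrs x. (u y - u x) * (v y - v x))"

definition Dir :: "(lat \<Rightarrow> real) \<Rightarrow> real" where
  "Dir u = (\<Sum>\<^sub>\<infinity>x. grad_sq u x)"

definition Dir_form :: "(lat \<Rightarrow> real) \<Rightarrow> (lat \<Rightarrow> real) \<Rightarrow> real" where
  "Dir_form u v = (\<Sum>\<^sub>\<infinity>x. grad_prod u v x)"

definition musym :: "real \<times> real \<times> real \<Rightarrow> real" where
  "musym k = 6 - 2 * (cos (fst k) + cos (fst (snd k)) + cos (snd (snd k)))"

definition torus :: "(real \<times> real \<times> real) set" where
  "torus = {0..2*pi} \<times> {0..2*pi} \<times> {0..2*pi}"

definition Kconst :: "real \<Rightarrow> real" where
  "Kconst \<alpha> = (1 / (2*pi)^3) * (LINT k:torus|lborel. musym k powr (\<alpha>/2))"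

definition phase :: "lat \<Rightarrow> real \<times> real \<times> real \<Rightarrow> real" where
  "phase z k = real_of_int (fst z) * fst k + real_of_int (fst (snd z)) * fst (snd k)
               + real_of_int (snd (snd z)) * snd (snd k)"

text \<open>The (complex) defining integral of R_alpha; it is real-valued by symmetry of musym,
  and R_alpha is its real part.\<close>
definition Rc :: "real \<Rightarrow> lat \<Rightarrow> lat \<Rightarrow> complex" where
  "Rc \<alpha> x y = complex_of_real (Kconst \<alpha> / (2*pi)^3) *
     (LINT k:torus|lborel. exp (\<i> * complex_of_real (phase (x - y) k))
                            * complex_of_real (musym k powr (-\<alpha>/2)))"

definition Ralpha :: "real \<Rightarrow> lat \<Rightarrow> lat \<Rightarrow> real" where
  "Ralpha \<alpha> x y = Re (Rc \<alpha> x y)"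

definition conv :: "real \<Rightarrow> (lat \<Rightarrow> real) \<Rightarrow> lat \<Rightarrow> real" where
  "conv \<alpha> f x = (\<Sum>\<^sub>\<infinity>y. Ralpha \<alpha> x y * f y)"

text \<open>H^1(Z^3): completion of finitely supported functions under sum(|grad u|^2+u^2),
  realised as the functions that are limits in this norm of finitely supported ones.\<close>
definition h1norm_sq :: "(lat \<Rightarrow> real) \<Rightarrow> real" where
  "h1norm_sq u = (\<Sum>\<^sub>\<infinity>x. grad_sq u x + (u x)^2)"

definition H1 :: "(lat \<Rightarrow> real) set" where
  "H1 = {u. (\<lambda>x. grad_sq u x + (u x)^2) summable_on UNIV \<and>
            (\<exists>\<phi>::nat \<Rightarrow> lat \<Rightarrow> real. (\<forall>n. finite {x. \<phi> n x \<noteq> 0}) \<and>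
               (\<forall>n. (\<lambda>x. grad_sq (\<lambda>z. \<phi> n z - u z) x + (\<phi> n x - u x)^2) summable_on UNIV) \<and>
               (\<lambda>n. h1norm_sq (\<lambda>z. \<phi> n z - u z)) \<longlonglongrightarrow> 0)}"

definition Hsp :: "(lat \<Rightarrow> real) \<Rightarrow> (lat \<Rightarrow> real) set" where
  "Hsp h = {u \<in> H1. (\<lambda>x. h x * (u x)^2) summable_on UNIV}"

definition Hnorm_sq :: "real \<Rightarrow> (lat \<Rightarrow> real) \<Rightarrow> (lat \<Rightarrow> real) \<Rightarrow> real" where
  "Hnorm_sq a h u = (\<Sum>\<^sub>\<infinity>x. a * grad_sq u x + h x * (u x)^2)"

definition Jfun :: "real \<Rightarrow> real \<Rightarrow> real \<Rightarrow> real \<Rightarrow> (lat \<Rightarrow> real) \<Rightarrow> (lat \<Rightarrow> real) \<Rightarrow> real" where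
  "Jfun a b \<alpha> p h u = (1/2) * Hnorm_sq a h u + (b/4) * (Dir u)^2
     - (1/(2*p)) * (\<Sum>\<^sub>\<infinity>x. conv \<alpha> (\<lambda>y. \<bar>u y\<bar> powr p) x * \<bar>u x\<bar> powr p)"

definition dJ :: "real \<Rightarrow> real \<Rightarrow> real \<Rightarrow> real \<Rightarrow> (lat \<Rightarrow> real) \<Rightarrow> (lat \<Rightarrow> real) \<Rightarrow> (lat \<Rightarrow> real) \<Rightarrow> real" where
  "dJ a b \<alpha> p h u \<phi> = (\<Sum>\<^sub>\<infinity>x. a * grad_prod u \<phi> x + h x * u x * \<phi> x)
     + b * Dir u * Dir_form u \<phi>
     - (\<Sum>\<^sub>\<infinity>x. conv \<alpha> (\<lambda>y. \<bar>u y\<bar> powr p) x * \<bar>u x\<bar> powr (p - 2) * u x * \<phi> x)"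

definition upos :: "(lat \<Rightarrow> real) \<Rightarrow> lat \<Rightarrow> real" where
  "upos u = (\<lambda>x. max (u x) 0)"

definition uneg :: "(lat \<Rightarrow> real) \<Rightarrow> lat \<Rightarrow> real" where
  "uneg u = (\<lambda>x. min (u x) 0)"

definition Mset :: "real \<Rightarrow> real \<Rightarrow> real \<Rightarrow> real \<Rightarrow> (lat \<Rightarrow> real) \<Rightarrow> (lat \<Rightarrow> real) set" where
  "Mset a b \<alpha> p h = {u \<in> Hsp h. upos u \<noteq> (\<lambda>_. 0) \<and> uneg u \<noteq> (\<lambda>_. 0) \<and>
      dJ a b \<alpha> p h u (upos u) = 0 \<and> dJ a b \<alpha> p h u (uneg u) = 0}"

end

(*
  Since the kernel R is bounded and |u|^p is summable for u in l^2, all terms of J are finite and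
  continuous on l^2. The symbol of R is bounded below by 12^(-alpha/2), so R is positive definite;
  no pointwise positivity of R is needed. On a fiber {s u^+ + t u^-} the functional is therefore strictly
  concave in the variables (s^p, t^p): the local terms have degree at most 4 < p, and the nonlocal
  term is a positive definite quadratic form. Hence every fiber meets the Nehari set in exactly one point,
  its strict global maximum, and the infimum m is a minimax value. Coercivity of h makes the embedding
  into l^2 compact, which gives a minimiser w. Criticality needs no deformation or degree argument:
  projecting w + eps phi back to the Nehari set gives a point s (w + eps phi)^+ + t (w + eps phi)^-
  with (s, t) -> (1, 1), whose energy is J(s w^+ + t w^-) + eps <J'(w), phi> + o(eps), and the first
  summand is at most J(w).
*)
theory Submission
  imports Defs
begin

section \<open>Square-summable functions\<close>

text \<open>The constraints defining \<open>M\<close> involve \<open>upos\<close> and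
  \<open>uneg\<close>, which are not differentiable maps, so \<open>M\<close> offers no tangent
  spaces for a Lagrange multiplier argument. Hence the variation works with difference quotients
  whose base points and directions both move with n. The lattice has bounded degree, so the gradient
  is bounded on l2 and H is simply the weighted space of all u with \<open>sqrt h * u\<close> in l2.
  Every term of J except the potential term is continuous for plain l2 convergence; along a
  minimising sequence the potential term is only lower semicontinuous, and the l2 limit u need not
  lie in \<open>M\<close>. It is projected to \<open>M\<close> with some parameters (s, t). Each
  member of the sequence maximises J on its own fiber, so its fiber value at these fixed (s, t) is
  at most its energy; passing to the limit bounds the energy of the projected point by m. Two
  constants of the kernel enter: a uniform bound, from integrability of the symbol at the corners of
  the torus (this is \<open>\<alpha> < 3\<close>), and the coercivity constant, where 12 is the
  maximum of \<open>musym\<close>.\<close>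

definition l2 :: "('a \<Rightarrow> real) \<Rightarrow> bool" where
  "l2 u \<longleftrightarrow> (\<lambda>x. (u x)^2) summable_on UNIV"

definition ip :: "('a \<Rightarrow> real) \<Rightarrow> ('a \<Rightarrow> real) \<Rightarrow> real" where
  "ip u v = (\<Sum>\<^sub>\<infinity>x. u x * v x)"

lemma summable_on_real_dominated:
  fixes f g :: "'a \<Rightarrow> real"
  assumes "g summable_on A" "\<And>x. x \<in> A \<Longrightarrow> \<bar>f x\<bar> \<le> g x"
  shows "f summable_on A"
proof -
  have "(\<lambda>x. norm (f x)) summable_on A"
    by (rule summable_on_comparison_test[OF assms(1)]) (use assms(2) in auto)
  then show ?thesis by (rule summable_on_iff_abs_summable_on_real[THEN iffD2])
qed

lemma abs_infsum_le:
  fixes f g :: "'a \<Rightarrow> real"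
  assumes "g summable_on A" "\<And>x. x \<in> A \<Longrightarrow> \<bar>f x\<bar> \<le> g x"
  shows "\<bar>infsum f A\<bar> \<le> infsum g A"
proof -
  have a: "(\<lambda>x. norm (f x)) summable_on A"
    by (rule summable_on_comparison_test[OF assms(1)]) (use assms(2) in auto)
  have "norm (infsum f A) \<le> (\<Sum>\<^sub>\<infinity>x\<in>A. norm (f x))" by (rule norm_infsum_bound[OF a])
  also have "\<dots> \<le> infsum g A" by (rule infsum_mono[OF a assms(1)]) (use assms(2) in auto)
  finally show ?thesis by simp
qed

lemma tendsto_0_le_seq:
  fixes f g :: "nat \<Rightarrow> real"
  assumes "\<And>n. 0 \<le> f n" "\<And>n. f n \<le> g n" "g \<longlonglongrightarrow> 0" shows "f \<longlonglongrightarrow> 0"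
  by (rule tendsto_sandwich[OF _ _ tendsto_const assms(3)]) (auto intro!: always_eventually assms)

lemma infsum_minus_real:
  fixes f g :: "'a \<Rightarrow> real"
  assumes "f summable_on A" "g summable_on A"
  shows "infsum (\<lambda>x. f x - g x) A = infsum f A - infsum g A"
  using infsum_add[OF assms(1) summable_on_uminus[THEN iffD2, OF assms(2)]]
  by (simp add: infsum_uminus)

lemma summable_on_minus_real:
  fixes f g :: "'a \<Rightarrow> real"
  assumes "f summable_on A" "g summable_on A"
  shows "(\<lambda>x. f x - g x) summable_on A"
  using summable_on_add[OF assms(1) summable_on_uminus[THEN iffD2, OF assms(2)]] by simp

lemma l2_mult_summable:
  assumes "l2 u" "l2 v" shows "(\<lambda>x. u x * v x) summable_on UNIV"
proof (rule summable_on_real_dominated)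
  show "(\<lambda>x. (u x)^2 + (v x)^2) summable_on UNIV"
    using assms unfolding l2_def by (rule summable_on_add)
  fix x
  have "2 * (\<bar>u x\<bar> * \<bar>v x\<bar>) \<le> (u x)^2 + (v x)^2"
    using sum_squares_bound[of "\<bar>u x\<bar>" "\<bar>v x\<bar>"] by simp
  moreover have "0 \<le> \<bar>u x\<bar> * \<bar>v x\<bar>" by simp
  ultimately show "\<bar>u x * v x\<bar> \<le> (u x)^2 + (v x)^2" unfolding abs_mult by linarith
qed

lemma l2_dominated:
  assumes "l2 v" "\<And>x. \<bar>u x\<bar> \<le> \<bar>v x\<bar>" shows "l2 u"
  unfolding l2_def
  by (rule summable_on_real_dominated[OF assms(1)[unfolded l2_def]])
     (use assms(2) abs_le_square_iff in auto)

lemma l2_scale: assumes "l2 u" shows "l2 (\<lambda>x. c * u x)"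
  using assms unfolding l2_def by (auto simp: power_mult_distrib intro: summable_on_cmult_right)

lemma l2_add: assumes "l2 u" "l2 v" shows "l2 (\<lambda>x. u x + v x)"
proof -
  have "(\<lambda>x. ((u x)^2 + (v x)^2) + 2 * (u x * v x)) summable_on UNIV"
    by (intro summable_on_add summable_on_cmult_right l2_mult_summable assms)
       (use assms in \<open>auto simp: l2_def\<close>)
  then show ?thesis unfolding l2_def power2_sum by (simp add: mult.assoc)
qed

lemma l2_diff: assumes "l2 u" "l2 v" shows "l2 (\<lambda>x. u x - v x)"
  using l2_add[OF assms(1) l2_scale[OF assms(2), of "-1"]] by simp

lemma l2_comp_bij: assumes "l2 u" "bij \<pi>" shows "l2 (\<lambda>x. u (\<pi> x))"
  using summable_on_reindex_bij_betw[OF assms(2), of "\<lambda>x. (u x)^2"] assms(1) unfolding l2_def by simp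

lemma l2_zero [simp]: "l2 (\<lambda>_. 0)" by (simp add: l2_def)

lemma ip_commute: "ip u v = ip v u" by (simp add: ip_def mult.commute)

lemma ip_add_left: assumes "l2 u" "l2 v" "l2 w"
  shows "ip (\<lambda>x. u x + v x) w = ip u w + ip v w"
  unfolding ip_def distrib_right
  by (intro infsum_add l2_mult_summable assms)

lemma ip_diff_left: assumes "l2 u" "l2 v" "l2 w"
  shows "ip (\<lambda>x. u x - v x) w = ip u w - ip v w"
  unfolding ip_def left_diff_distrib
  by (intro infsum_minus_real l2_mult_summable assms)

lemma ip_scale_left: "ip (\<lambda>x. c * u x) w = c * ip u w"
  unfolding ip_def by (simp add: mult.assoc infsum_cmult_right')

lemma ip_add_right: assumes "l2 u" "l2 v" "l2 w"
  shows "ip w (\<lambda>x. u x + v x) = ip w u + ip w v"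
  using ip_add_left[OF assms] by (simp add: ip_commute)

lemma ip_diff_right: assumes "l2 u" "l2 v" "l2 w"
  shows "ip w (\<lambda>x. u x - v x) = ip w u - ip w v"
  using ip_diff_left[OF assms] by (simp add: ip_commute)

lemma ip_scale_right: "ip w (\<lambda>x. c * u x) = c * ip w u"
  using ip_scale_left[of c u w] by (simp add: ip_commute)

lemma ip_self_nonneg: "0 \<le> ip u u" unfolding ip_def by (rule infsum_nonneg) simp

lemma ip_self_mono:
  assumes "l2 v" "\<And>x. \<bar>u x\<bar> \<le> \<bar>v x\<bar>" shows "ip u u \<le> ip v v"
  unfolding ip_def
proof (rule infsum_mono)
  show "(\<lambda>x. u x * u x) summable_on UNIV" by (intro l2_mult_summable l2_dominated[OF assms])
  show "(\<lambda>x. v x * v x) summable_on UNIV" by (intro l2_mult_summable assms)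
  show "u x * u x \<le> v x * v x" for x
    using assms(2)[of x] abs_le_square_iff[of "u x" "v x"] by (simp add: power2_eq_square)
qed

lemma ip_self_eq_0:
  assumes "l2 u" "ip u u = 0" shows "u = (\<lambda>_. 0)"
proof
  fix x
  have "u x * u x = 0"
    using nonneg_infsum_le_0D[of "\<lambda>x. u x * u x" UNIV x] l2_mult_summable[OF assms(1,1)] assms(2)
    by (simp add: ip_def)
  then show "u x = 0" by simp
qed

lemma square_le_ip_self:
  assumes "l2 u" shows "(u x)^2 \<le> ip u u"
proof -
  have "sum (\<lambda>x. u x * u x) {x} \<le> ip u u"
    unfolding ip_def by (rule finite_sum_le_infsum[OF l2_mult_summable[OF assms assms]]) auto
  then show ?thesis by (simp add: power2_eq_square)
qed

lemma ip_Cauchy_Schwarz: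
  assumes "l2 u" "l2 v" shows "\<bar>ip u v\<bar> \<le> sqrt (ip u u) * sqrt (ip v v)"
proof -
  define A B C where "A = ip u u" and "B = ip u v" and "C = ip v v"
  have q: "0 \<le> A - 2 * t * B + t^2 * C" for t
  proof -
    have "0 \<le> ip (\<lambda>x. u x - t * v x) (\<lambda>x. u x - t * v x)" by (rule ip_self_nonneg)
    also have "\<dots> = A - 2 * t * B + t^2 * C"
      by (simp add: ip_diff_left ip_diff_right ip_scale_left ip_scale_right l2_diff l2_scale assms
           A_def B_def C_def ip_commute[of v u] power2_eq_square algebra_simps)
    finally show ?thesis .
  qed
  have "C \<ge> 0" "A \<ge> 0" by (auto simp: A_def C_def ip_self_nonneg)
  have "B^2 \<le> A * C"
  proof (cases "C = 0")
    case True
    then have "v = (\<lambda>_. 0)" using assms(2) ip_self_eq_0 by (simp add: C_def)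
    then show ?thesis by (simp add: B_def C_def ip_def)
  next
    case False
    with \<open>C \<ge> 0\<close> have "C > 0" by simp
    then have "0 \<le> C * (A - 2 * (B/C) * B + (B/C)^2 * C)" using q[of "B/C"] by (intro mult_nonneg_nonneg) auto
    also have "\<dots> = A * C - B^2" using \<open>C > 0\<close> by (simp add: field_simps power2_eq_square)
    finally show ?thesis by simp
  qed
  then have "sqrt (B^2) \<le> sqrt (A * C)" by (rule real_sqrt_le_mono)
  then show ?thesis by (simp add: A_def B_def C_def real_sqrt_mult)
qed

text \<open>\<open>infsum\<close> returns 0 on a family that is not summable, so the limit alone
  would carry no information; the membership conjuncts turn it into genuine norm
  convergence.\<close>

definition l2_conv :: "(nat \<Rightarrow> 'a \<Rightarrow> real) \<Rightarrow> ('a \<Rightarrow> real) \<Rightarrow> bool" where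
  "l2_conv U u \<longleftrightarrow> (\<forall>n. l2 (U n)) \<and> l2 u \<and> (\<lambda>n. ip (\<lambda>x. U n x - u x) (\<lambda>x. U n x - u x)) \<longlonglongrightarrow> 0"

lemma l2_convD: assumes "l2_conv U u" shows "l2 (U n)" "l2 u"
  "(\<lambda>n. ip (\<lambda>x. U n x - u x) (\<lambda>x. U n x - u x)) \<longlonglongrightarrow> 0"
  using assms unfolding l2_conv_def by auto

lemma l2_conv_const: "l2 u \<Longrightarrow> l2_conv (\<lambda>_. u) u" by (simp add: l2_conv_def ip_def)

lemma l2_conv_dominated:
  assumes "\<And>n. l2 (U n)" "l2 u" "\<And>n. l2 (W n)" "(\<lambda>n. ip (W n) (W n)) \<longlonglongrightarrow> 0"
    and "\<And>n x. \<bar>U n x - u x\<bar> \<le> \<bar>W n x\<bar>"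
  shows "l2_conv U u"
  unfolding l2_conv_def
proof (intro conjI allI assms(1,2))
  show "(\<lambda>n. ip (\<lambda>x. U n x - u x) (\<lambda>x. U n x - u x)) \<longlonglongrightarrow> 0"
    by (rule tendsto_sandwich[OF _ _ tendsto_const assms(4)])
       (auto intro!: always_eventually ip_self_nonneg ip_self_mono assms)
qed

lemma ip_tendsto:
  assumes U: "l2_conv U u" and V: "l2_conv V v"
  shows "(\<lambda>n. ip (U n) (V n)) \<longlonglongrightarrow> ip u v"
proof -
  note l = l2_convD(1,2)[OF U] l2_convD(1,2)[OF V]
  define U' V' where "U' = (\<lambda>n x. U n x - u x)" and "V' = (\<lambda>n x. V n x - v x)"
  have l': "l2 (U' n)" "l2 (V' n)" for n using l by (auto simp: U'_def V'_def intro: l2_diff)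
  have t: "(\<lambda>n. sqrt (ip (U' n) (U' n))) \<longlonglongrightarrow> 0" "(\<lambda>n. sqrt (ip (V' n) (V' n))) \<longlonglongrightarrow> 0"
    using tendsto_real_sqrt[OF l2_convD(3)[OF U]] tendsto_real_sqrt[OF l2_convD(3)[OF V]]
    by (auto simp: U'_def V'_def)
  have e: "ip (U n) (V n) - ip u v = ip (U' n) (V' n) + ip (U' n) v + ip u (V' n)" for n
    by (simp add: U'_def V'_def ip_diff_left ip_diff_right l2_diff l)
  have b: "norm (ip (U n) (V n) - ip u v) \<le> sqrt (ip (U' n) (U' n)) * sqrt (ip (V' n) (V' n))
     + sqrt (ip (U' n) (U' n)) * sqrt (ip v v) + sqrt (ip u u) * sqrt (ip (V' n) (V' n))" for n
    unfolding e real_norm_def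
    using ip_Cauchy_Schwarz[OF l'(1) l'(2), of n n] ip_Cauchy_Schwarz[OF l'(1) l(4), of n]
      ip_Cauchy_Schwarz[OF l(2) l'(2), of n] by linarith
  have "(\<lambda>n. sqrt (ip (U' n) (U' n)) * sqrt (ip (V' n) (V' n))
     + sqrt (ip (U' n) (U' n)) * sqrt (ip v v) + sqrt (ip u u) * sqrt (ip (V' n) (V' n))) \<longlonglongrightarrow>
      0 * 0 + 0 * sqrt (ip v v) + sqrt (ip u u) * 0"
    by (intro tendsto_intros t)
  then have "(\<lambda>n. ip (U n) (V n) - ip u v) \<longlonglongrightarrow> 0"
    using b by (auto intro: Lim_null_comparison[OF always_eventually, rotated])
  then show ?thesis by (simp add: LIM_zero_cancel)
qed

lemma l2_conv_add:
  assumes U: "l2_conv U u" and V: "l2_conv V v" shows "l2_conv (\<lambda>n x. U n x + V n x) (\<lambda>x. u x + v x)"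
proof -
  note l = l2_convD(1,2)[OF U] l2_convD(1,2)[OF V]
  define U' V' where "U' = (\<lambda>n x. U n x - u x)" and "V' = (\<lambda>n x. V n x - v x)"
  have l': "l2 (U' n)" "l2 (V' n)" for n using l by (auto simp: U'_def V'_def intro: l2_diff)
  have c: "l2_conv U' (\<lambda>_. 0)" "l2_conv V' (\<lambda>_. 0)"
    using l' U V by (auto simp: l2_conv_def U'_def V'_def)
  have "(\<lambda>n. ip (\<lambda>x. U' n x + V' n x) (\<lambda>x. U' n x + V' n x)) \<longlonglongrightarrow> 0"
  proof -
    have "(\<lambda>n. ip (U' n) (U' n) + ip (V' n) (V' n) + 2 * ip (U' n) (V' n)) \<longlonglongrightarrow> 0 + 0 + 2 * 0"
      using ip_tendsto[OF c(1) c(1)] ip_tendsto[OF c(2) c(2)] ip_tendsto[OF c(1) c(2)]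
      by (intro tendsto_intros) (auto simp: ip_def)
    then show ?thesis
      by (simp add: ip_add_left ip_add_right l2_add l' ip_commute[of "V' _" "U' _"] algebra_simps)
  qed
  then show ?thesis
    unfolding l2_conv_def using l by (auto intro: l2_add simp: U'_def V'_def algebra_simps)
qed

lemma l2_conv_scale:
  assumes U: "l2_conv U u" and c: "c \<longlonglongrightarrow> c0" shows "l2_conv (\<lambda>n x. c n * U n x) (\<lambda>x. c0 * u x)"
proof -
  note l = l2_convD(1,2)[OF U]
  have "(\<lambda>n. c n^2 * ip (U n) (U n) - 2 * (c n * c0 * ip (U n) u) + c0^2 * ip u u) \<longlonglongrightarrow>
     c0^2 * ip u u - 2 * (c0 * c0 * ip u u) + c0^2 * ip u u"
    by (intro tendsto_intros ip_tendsto U c l2_conv_const l)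
  then have "(\<lambda>n. ip (\<lambda>x. c n * U n x - c0 * u x) (\<lambda>x. c n * U n x - c0 * u x)) \<longlonglongrightarrow> 0"
    by (simp add: ip_diff_left ip_diff_right l2_diff l2_scale l ip_scale_left ip_scale_right ip_commute[of u "U _"]
        power2_eq_square algebra_simps)
  then show ?thesis unfolding l2_conv_def using l by (auto intro: l2_scale)
qed

lemma l2_conv_diff:
  assumes U: "l2_conv U u" and V: "l2_conv V v" shows "l2_conv (\<lambda>n x. U n x - V n x) (\<lambda>x. u x - v x)"
  using l2_conv_add[OF U l2_conv_scale[OF V tendsto_const[of "-1"]]] by simp

lemma ip_comp_bij: assumes "bij \<pi>" shows "ip (\<lambda>x. u (\<pi> x)) (\<lambda>x. v (\<pi> x)) = ip u v"
  unfolding ip_def using infsum_reindex_bij_betw[OF assms, of "\<lambda>x. u x * v x"] by simp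

lemma l2_conv_comp_bij:
  assumes U: "l2_conv U u" and "bij \<pi>" shows "l2_conv (\<lambda>n x. U n (\<pi> x)) (\<lambda>x. u (\<pi> x))"
  using U ip_comp_bij[OF assms(2), of "\<lambda>x. U _ x - u x" "\<lambda>x. U _ x - u x"] l2_comp_bij[OF _ assms(2)]
  unfolding l2_conv_def by simp

lemma l2_conv_pointwise:
  assumes U: "l2_conv U u" shows "(\<lambda>n. U n x) \<longlonglongrightarrow> u x"
proof -
  have "(\<lambda>n. (U n x - u x)^2) \<longlonglongrightarrow> 0"
    by (rule tendsto_sandwich[OF _ _ tendsto_const l2_convD(3)[OF U]])
       (auto intro!: always_eventually square_le_ip_self l2_diff l2_convD[OF U])
  then have "(\<lambda>n. U n x - u x) \<longlonglongrightarrow> 0" by simp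
  then show ?thesis by (simp add: LIM_zero_cancel)
qed

lemma l2_conv_subseq: assumes "l2_conv U u" "strict_mono r" shows "l2_conv (U \<circ> r) u"
  using assms LIMSEQ_subseq_LIMSEQ[OF l2_convD(3)[OF assms(1)] assms(2)] unfolding l2_conv_def
  by (auto simp: o_def)

lemma l2_conv_bounded:
  assumes "l2_conv U u" obtains K where "\<And>n. ip (U n) (U n) \<le> K"
proof -
  have "Bseq (\<lambda>n. ip (U n) (U n))"
    using ip_tendsto[OF assms assms] convergentI convergent_imp_Bseq by blast
  then obtain K where "\<forall>n. norm (ip (U n) (U n)) \<le> K" by (auto simp: Bseq_def)
  then show ?thesis by (intro that[of K]) (metis abs_le_D1 real_norm_def)
qed

text \<open>The sequences are bounded in sup norm, so a Lipschitz bound on a large ball is enough.\<close>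
lemma l2_conv_lipschitz:
  assumes U: "l2_conv U u" and lip: "\<And>M. M \<ge> 0 \<Longrightarrow> \<exists>L. \<forall>r r'. \<bar>r\<bar> \<le> M \<longrightarrow> \<bar>r'\<bar> \<le> M \<longrightarrow> \<bar>g r - g r'\<bar> \<le> L * \<bar>r - r'\<bar>"
    and g0: "g 0 = (0::real)"
  shows "l2_conv (\<lambda>n x. g (U n x)) (\<lambda>x. g (u x))"
proof -
  obtain K where K: "\<And>n. ip (U n) (U n) \<le> K" using l2_conv_bounded[OF U] by blast
  \<comment> \<open>For counting measure the sup norm is at most the l2 norm, so this one
    \<open>M\<close> bounds all values of \<open>u\<close> and of every \<open>U n\<close>.\<close>
  define M where "M = sqrt K + sqrt (ip u u)"
  have K0: "K \<ge> 0" using K[of 0] ip_self_nonneg[of "U 0"] by linarith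
  have bU: "\<bar>U n x\<bar> \<le> M" for n x
  proof -
    have "(U n x)^2 \<le> K" using square_le_ip_self[OF l2_convD(1)[OF U], of n x] K[of n] by linarith
    then have "\<bar>U n x\<bar> \<le> sqrt K" using real_le_rsqrt by fastforce
    then show ?thesis unfolding M_def using ip_self_nonneg[of u] real_sqrt_ge_zero[of "ip u u"] by linarith
  qed
  have bu: "\<bar>u x\<bar> \<le> M" for x
  proof -
    have "\<bar>u x\<bar> \<le> sqrt (ip u u)" using square_le_ip_self[OF l2_convD(2)[OF U], of x] real_le_rsqrt by fastforce
    then show ?thesis unfolding M_def using K0 real_sqrt_ge_zero[of K] by linarith
  qed
  have "M \<ge> 0" using bu[of undefined] by linarith
  then obtain L where L: "\<And>r r'. \<bar>r\<bar> \<le> M \<Longrightarrow> \<bar>r'\<bar> \<le> M \<Longrightarrow> \<bar>g r - g r'\<bar> \<le> L * \<bar>r - r'\<bar>" using lip by blast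
  have L': "\<bar>g r - g r'\<bar> \<le> \<bar>L * (r - r')\<bar>" if "\<bar>r\<bar> \<le> M" "\<bar>r'\<bar> \<le> M" for r r'
    using L[OF that] mult_right_mono[OF abs_ge_self[of L], of "\<bar>r - r'\<bar>"] by (simp add: abs_mult)
  have L0: "\<bar>g r\<bar> \<le> \<bar>L * r\<bar>" if "\<bar>r\<bar> \<le> M" for r using L'[OF that, of 0] \<open>M \<ge> 0\<close> g0 by simp
  show ?thesis
  proof (rule l2_conv_dominated)
    show "l2 (\<lambda>x. g (U n x))" for n by (rule l2_dominated[OF l2_scale[OF l2_convD(1)[OF U]]]) (rule L0[OF bU])
    show "l2 (\<lambda>x. g (u x))" by (rule l2_dominated[OF l2_scale[OF l2_convD(2)[OF U]]]) (rule L0[OF bu])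
    show "l2 (\<lambda>x. L * (U n x - u x))" for n by (intro l2_scale l2_diff l2_convD[OF U])
    show "(\<lambda>n. ip (\<lambda>x. L * (U n x - u x)) (\<lambda>x. L * (U n x - u x))) \<longlonglongrightarrow> 0"
      using tendsto_mult[OF tendsto_const[of "L * L"] l2_convD(3)[OF U]]
      by (simp add: ip_scale_left ip_scale_right mult.assoc)
    show "\<bar>g (U n x) - g (u x)\<bar> \<le> \<bar>L * (U n x - u x)\<bar>" for n x by (rule L'[OF bU bu])
  qed
qed

text \<open>A kernel that is merely bounded defines a continuous bilinear form on l1, so this is the
  convergence that powers such as \<open>\<bar>u x\<bar> powr p\<close> must have for the nonlocal
  term to pass to the limit.\<close>

definition l1_conv :: "(nat \<Rightarrow> 'a \<Rightarrow> real) \<Rightarrow> ('a \<Rightarrow> real) \<Rightarrow> bool" where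
  "l1_conv F f \<longleftrightarrow> (\<forall>n. F n summable_on UNIV) \<and> f summable_on UNIV \<and> (\<lambda>n. \<Sum>\<^sub>\<infinity>x. \<bar>F n x - f x\<bar>) \<longlonglongrightarrow> 0"

lemma abs_summable_real: "(\<lambda>x. \<bar>f x\<bar>) summable_on A" if "f summable_on A" for f :: "'a \<Rightarrow> real"
  using summable_on_iff_abs_summable_on_real[THEN iffD1, OF that] by simp

lemma infsum_abs_mult_le:
  assumes "l2 u" "l2 v" shows "(\<Sum>\<^sub>\<infinity>x. \<bar>u x * v x\<bar>) \<le> sqrt (ip u u) * sqrt (ip v v)"
proof -
  have l: "l2 (\<lambda>x. \<bar>u x\<bar>)" "l2 (\<lambda>x. \<bar>v x\<bar>)" using assms by (auto simp: l2_def)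
  have "(\<Sum>\<^sub>\<infinity>x. \<bar>u x * v x\<bar>) = ip (\<lambda>x. \<bar>u x\<bar>) (\<lambda>x. \<bar>v x\<bar>)" by (simp add: ip_def abs_mult)
  also have "\<dots> \<le> sqrt (ip (\<lambda>x. \<bar>u x\<bar>) (\<lambda>x. \<bar>u x\<bar>)) * sqrt (ip (\<lambda>x. \<bar>v x\<bar>) (\<lambda>x. \<bar>v x\<bar>))"
    using ip_Cauchy_Schwarz[OF l] by linarith
  also have "\<dots> = sqrt (ip u u) * sqrt (ip v v)" by (simp add: ip_def)
  finally show ?thesis .
qed

text \<open>Cauchy-Schwarz applied to \<open>U * V - u * v = (U - u) * V + u * (V - v)\<close>. It
  is the bridge from l2 to l1: both |u|^p and the integrand of the derivative of the nonlocal term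
  are products of two l2 functions.\<close>

lemma l2_conv_mult:
  assumes U: "l2_conv U u" and V: "l2_conv V v"
  shows "l1_conv (\<lambda>n x. U n x * V n x) (\<lambda>x. u x * v x)"
proof -
  note l = l2_convD(1,2)[OF U] l2_convD(1,2)[OF V]
  define U' V' where "U' = (\<lambda>n x. U n x - u x)" and "V' = (\<lambda>n x. V n x - v x)"
  have l': "l2 (U' n)" "l2 (V' n)" for n using l by (auto simp: U'_def V'_def intro: l2_diff)
  have t: "(\<lambda>n. sqrt (ip (U' n) (U' n))) \<longlonglongrightarrow> 0" "(\<lambda>n. sqrt (ip (V' n) (V' n))) \<longlonglongrightarrow> 0"
    using tendsto_real_sqrt[OF l2_convD(3)[OF U]] tendsto_real_sqrt[OF l2_convD(3)[OF V]]
    by (auto simp: U'_def V'_def)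
  have b: "(\<Sum>\<^sub>\<infinity>x. \<bar>U n x * V n x - u x * v x\<bar>) \<le>
       sqrt (ip (U' n) (U' n)) * sqrt (ip (V n) (V n)) + sqrt (ip u u) * sqrt (ip (V' n) (V' n))" for n
  proof -
    have s: "(\<lambda>x. \<bar>U' n x * V n x\<bar>) summable_on UNIV" "(\<lambda>x. \<bar>u x * V' n x\<bar>) summable_on UNIV"
      by (intro abs_summable_real l2_mult_summable l l')+
    have "(\<Sum>\<^sub>\<infinity>x. \<bar>U n x * V n x - u x * v x\<bar>) \<le> (\<Sum>\<^sub>\<infinity>x. \<bar>U' n x * V n x\<bar> + \<bar>u x * V' n x\<bar>)"
    proof (rule infsum_mono)
      show "(\<lambda>x. \<bar>U n x * V n x - u x * v x\<bar>) summable_on UNIV"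
        by (intro abs_summable_real summable_on_minus_real l2_mult_summable l)
      show "(\<lambda>x. \<bar>U' n x * V n x\<bar> + \<bar>u x * V' n x\<bar>) summable_on UNIV" by (intro summable_on_add s)
      show "\<bar>U n x * V n x - u x * v x\<bar> \<le> \<bar>U' n x * V n x\<bar> + \<bar>u x * V' n x\<bar>" for x
      proof -
        have "U n x * V n x - u x * v x = U' n x * V n x + u x * V' n x"
          by (simp add: U'_def V'_def algebra_simps)
        then show ?thesis using abs_triangle_ineq by metis
      qed
    qed
    also have "\<dots> = (\<Sum>\<^sub>\<infinity>x. \<bar>U' n x * V n x\<bar>) + (\<Sum>\<^sub>\<infinity>x. \<bar>u x * V' n x\<bar>)" by (intro infsum_add s)
    also have "\<dots> \<le> sqrt (ip (U' n) (U' n)) * sqrt (ip (V n) (V n)) + sqrt (ip u u) * sqrt (ip (V' n) (V' n))"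
      by (intro add_mono infsum_abs_mult_le l l')
    finally show ?thesis .
  qed
  have "(\<lambda>n. sqrt (ip (U' n) (U' n)) * sqrt (ip (V n) (V n)) + sqrt (ip u u) * sqrt (ip (V' n) (V' n)))
      \<longlonglongrightarrow> 0 * sqrt (ip v v) + sqrt (ip u u) * 0"
    by (intro tendsto_intros t ip_tendsto V)
  then have "(\<lambda>n. \<Sum>\<^sub>\<infinity>x. \<bar>U n x * V n x - u x * v x\<bar>) \<longlonglongrightarrow> 0"
    by (intro tendsto_0_le_seq[OF _ b]) (auto intro: infsum_nonneg)
  then show ?thesis unfolding l1_conv_def using l by (auto intro: l2_mult_summable)
qed

section \<open>The kernel\<close>

lemma integrable_lborel_mult:
  fixes f :: "'a::euclidean_space \<Rightarrow> 'c::{real_normed_field, banach, second_countable_topology}" and g :: "'b::euclidean_space \<Rightarrow> 'c"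
  assumes "integrable lborel f" "integrable lborel g"
  shows "integrable lborel (\<lambda>z. f (fst z) * g (snd z))"
    and "(\<integral>z. f (fst z) * g (snd z) \<partial>lborel) = integral\<^sup>L lborel f * integral\<^sup>L lborel g"
proof -
  have [measurable]: "f \<in> borel_measurable lborel" "g \<in> borel_measurable lborel" using assms by auto
  have i: "integrable (lborel \<Otimes>\<^sub>M lborel) (\<lambda>z. f (fst z) * g (snd z))"
  proof (rule lborel_pair.Fubini_integrable)
    show "integrable lborel (\<lambda>x. \<integral>y. norm (f (fst (x, y)) * g (snd (x, y))) \<partial>lborel)"
      using assms by (simp add: norm_mult integrable_norm)
  qed (use assms in auto)
  then show "integrable lborel (\<lambda>z. f (fst z) * g (snd z))" by (simp add: lborel_prod)
  have "(\<integral>z. f (fst z) * g (snd z) \<partial>lborel) = (\<integral>x. \<integral>y. f x * g y \<partial>lborel \<partial>lborel)"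
    using lborel_pair.integral_fst'[OF i] by (simp add: lborel_prod)
  then show "(\<integral>z. f (fst z) * g (snd z) \<partial>lborel) = integral\<^sup>L lborel f * integral\<^sup>L lborel g"
    by simp
qed

text \<open>Up to \<open>pi / 3\<close> the cosine is at least 1/2, so \<open>sin x - x / 2\<close>
  increases from 0; beyond that, \<open>sin x\<close> is at least \<open>sqrt 3 / 2\<close>, which
  exceeds \<open>pi / 4\<close>.\<close>

lemma sin_ge_half: "x / 2 \<le> sin x" if "0 \<le> x" "x \<le> pi / 2" for x :: real
proof (cases "x \<le> pi / 3")
  case True
  have "(sin 0 - 0 / 2) \<le> (sin x - x / 2)"
  proof (rule DERIV_nonneg_imp_nondecreasing[OF that(1)])
    fix z assume "0 \<le> z" "z \<le> x"
    then have "cos z \<ge> cos (pi / 3)" using True by (intro cos_monotone_0_pi_le) auto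
    then have "0 \<le> cos z - 1 / 2" by (simp add: cos_60)
    moreover have "((\<lambda>x. sin x - x / 2) has_real_derivative (cos z - 1 / 2)) (at z)"
      by (auto intro!: derivative_eq_intros)
    ultimately show "\<exists>y. ((\<lambda>x. sin x - x / 2) has_real_derivative y) (at z) \<and> 0 \<le> y" by blast
  qed
  then show ?thesis by simp
next
  case False
  then have "sin x \<ge> sin (pi / 3)" using that by (intro sin_monotone_2pi_le) auto
  moreover have "sqrt 3 \<ge> 17/10" by (rule real_le_rsqrt) (simp add: power2_eq_square)
  moreover have "pi < 3.2" using pi_approx by simp
  ultimately show ?thesis using that by (simp add: sin_60)
qed

text \<open>There are two singular endpoints. By \<open>sin_ge_half\<close>,
  \<open>sin (k / 2)\<close> is at least a quarter of the distance from \<open>k\<close> to the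
  nearer endpoint, so a power function and its reflection under \<open>k\<close> to
  \<open>2*pi - k\<close> dominate, with factor \<open>4 powr \<beta>\<close>.\<close>

lemma integrable_sin_half_powr:
  fixes \<beta> :: real assumes "0 \<le> \<beta>" "\<beta> < 1"
  shows "integrable lborel (\<lambda>k. indicator {0<..<2*pi} k * sin (k / 2) powr - \<beta>)"
proof -
  define P where "P k = indicator {0..2*pi} k * (k powr - \<beta>)" for k :: real
  have iP: "integrable lborel P"
  proof -
    have "(\<lambda>k. k powr - \<beta>) integrable_on {0..2*pi}"
      using has_integral_powr_from_0[of "-\<beta>" "2*pi"] assms by (auto simp: integrable_on_def)
    then have "(\<lambda>k. k powr - \<beta>) absolutely_integrable_on {0..2*pi}"
      by (rule nonnegative_absolutely_integrable_1) auto
    then have "integrable lebesgue P" unfolding set_integrable_def P_def by simp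
    then show ?thesis by (subst (asm) integrable_completion) (auto simp: P_def[abs_def])
  qed
  have iQ: "integrable lborel (\<lambda>k. P (2*pi + (-1) * k))" by (rule lborel_integrable_real_affine[OF iP]) simp
  have "integrable lborel (\<lambda>k. 4 powr \<beta> * (P k + P (2*pi + (-1) * k)))"
    by (intro integrable_mult_right Bochner_Integration.integrable_add iP iQ)
  then show ?thesis
  proof (rule Bochner_Integration.integrable_bound)
    show "AE k in lborel. norm (indicator {0<..<2*pi} k * sin (k / 2) powr - \<beta>) \<le> norm (4 powr \<beta> * (P k + P (2*pi + (-1) * k)))"
    proof (rule AE_I2)
      fix k :: real
      have nn: "0 \<le> P x" for x by (simp add: P_def)
      have b: "sin (k / 2) powr - \<beta> \<le> 4 powr \<beta> * (P k + P (2*pi - k))" if k: "0 < k" "k < 2*pi"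
      proof -
        have m: "s powr - \<beta> \<le> 4 powr \<beta> * r powr - \<beta>" if "r > 0" "r / 4 \<le> s" for r s :: real
        proof -
          have "s powr - \<beta> \<le> (r/4) powr - \<beta>" using that assms by (intro powr_mono2') auto
          also have "\<dots> = 4 powr \<beta> * r powr - \<beta>" using that by (simp add: powr_divide powr_minus divide_simps)
          finally show ?thesis .
        qed
        show ?thesis
        proof (cases "k \<le> pi")
          case True
          have "sin (k / 2) powr - \<beta> \<le> 4 powr \<beta> * k powr - \<beta>" using m[OF k(1)] sin_ge_half[of "k/2"] True k by simp
          also have "\<dots> = 4 powr \<beta> * P k" using k by (simp add: P_def)
          also have "\<dots> \<le> 4 powr \<beta> * (P k + P (2*pi - k))" using nn by (intro mult_left_mono) auto
          finally show ?thesis .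
        next
          case False
          have "sin (k / 2) = sin ((2*pi - k) / 2)" by (simp add: diff_divide_distrib sin_diff)
          then have "sin (k / 2) powr - \<beta> \<le> 4 powr \<beta> * (2*pi - k) powr - \<beta>"
            using m[of "2*pi - k" "sin (k/2)"] sin_ge_half[of "(2*pi - k)/2"] False k by simp
          also have "\<dots> = 4 powr \<beta> * P (2*pi - k)" using k by (simp add: P_def)
          also have "\<dots> \<le> 4 powr \<beta> * (P k + P (2*pi - k))" using nn by (intro mult_left_mono) auto
          finally show ?thesis .
        qed
      qed
      show "norm (indicator {0<..<2*pi} k * sin (k / 2) powr - \<beta>) \<le> norm (4 powr \<beta> * (P k + P (2*pi + (-1) * k)))"
        using b nn by (auto simp: indicator_def)
    qed
  qed auto
qed

lemma torus_cbox: "torus = cbox (0, 0, 0) (2*pi, 2*pi, 2*pi)"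
  by (simp add: torus_def cbox_Pair_eq)

lemma torus_box: "box (0, 0, 0) (2*pi, 2*pi, 2*pi) = {0<..<2*pi} \<times> {0<..<2*pi} \<times> {0<..<2*pi::real}"
  by (auto simp: box_def Basis_prod_def)

lemma torus_measurable [measurable]: "torus \<in> sets borel" by (simp add: torus_cbox)

lemma integrable_indicator_torus: "integrable lborel (\<lambda>k. indicator torus k :: real)"
  using emeasure_bounded_finite[of torus] by (intro integrable_real_indicator) (auto simp: torus_cbox)

text \<open>\<open>musym\<close> vanishes at the corners of \<open>torus\<close>, and since
  \<open>0 powr r = 0\<close> a negative power of it takes the value 0 there instead of being large.
  Estimates of that power are therefore made in the interior only, up to a null set.\<close>

lemma AE_torus_interior:
  "AE k in lborel. k \<in> torus \<longrightarrow> k \<in> {0<..<2*pi} \<times> {0<..<2*pi} \<times> {0<..<2*pi}"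
proof -
  let ?N = "cbox (0, 0, 0) (2*pi, 2*pi, 2*pi) - box (0, 0, 0) (2*pi, 2*pi, 2*pi) :: (real \<times> real \<times> real) set"
  have "?N \<in> null_sets lebesgue" using negligible_frontier_interval negligible_iff_null_sets by blast
  then have "?N \<in> null_sets lborel" by (subst (asm) null_sets_completion_iff) auto
  then have "AE k in lborel. k \<notin> ?N" by (rule AE_not_in)
  then show ?thesis by (simp add: torus_box flip: torus_cbox)
qed

lemma cos_eq_sin_half: "cos x = 1 - 2 * (sin (x / 2))^2" for x :: real
  using cos_double_sin[of "x / 2"] by simp

lemma musym_sin: "musym (k1, k2, k3) = 4 * ((sin (k1/2))^2 + (sin (k2/2))^2 + (sin (k3/2))^2)"
  unfolding musym_def fst_conv snd_conv cos_eq_sin_half[of k1] cos_eq_sin_half[of k2] cos_eq_sin_half[of k3]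
  by simp

lemma musym_bounds: "0 \<le> musym k" "musym k \<le> 12"
proof -
  obtain k1 k2 k3 where k: "k = (k1, k2, k3)" by (cases k) auto
  have "-1 \<le> cos k1" "-1 \<le> cos k2" "-1 \<le> cos k3" "cos k1 \<le> 1" "cos k2 \<le> 1" "cos k3 \<le> 1" by auto
  note b = this
  show "0 \<le> musym k" unfolding musym_def k fst_conv snd_conv using b by argo
  show "musym k \<le> 12" unfolding musym_def k fst_conv snd_conv using b by argo
qed

lemma musym_pos: "musym k > 0" if "k \<in> {0<..<2*pi} \<times> {0<..<2*pi} \<times> {0<..<2*pi}"
proof -
  obtain k1 k2 k3 where k: "k = (k1, k2, k3)" by (cases k) auto
  have "sin (k1/2) > 0" using that by (intro sin_gt_zero) (auto simp: k)
  then show ?thesis unfolding k musym_sin by (intro mult_pos_pos add_pos_nonneg) auto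
qed

lemma musym_measurable [measurable]: "musym \<in> borel_measurable borel"
  unfolding musym_def by (intro borel_measurable_continuous_onI continuous_intros)

lemma phase_measurable [measurable]: "phase z \<in> borel_measurable borel"
  unfolding phase_def by (intro borel_measurable_continuous_onI continuous_intros)

text \<open>With m the largest of the three numbers, the left side is at most
  \<open>m powr (-\<alpha>)\<close>, which is the \<open>(-\<alpha>/3)\<close>-th power of m^3, and
  m^3 is at least the product. This splits a three-dimensional singularity of order
  \<open>\<alpha>\<close> into three one-dimensional ones of order \<open>\<alpha>/3\<close>, so
  that Fubini replaces polar coordinates.\<close>

lemma powr_prod3_le:
  fixes x y z \<alpha> :: real
  assumes "x > 0" "y > 0" "z > 0" "0 \<le> \<alpha>"
  shows "(4 * (x^2 + y^2 + z^2)) powr (-\<alpha>/2) \<le> x powr (-\<alpha>/3) * y powr (-\<alpha>/3) * z powr (-\<alpha>/3)"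
proof -
  define m where "m = max x (max y z)"
  have m: "x \<le> m" "y \<le> m" "z \<le> m" "m > 0" using assms by (auto simp: m_def)
  have m2: "m^2 \<le> 4 * (x^2 + y^2 + z^2)"
    unfolding m_def max_def by (auto simp: power2_eq_square)
  have "x * y * z \<le> m * m * m" using m assms by (intro mult_mono) auto
  then have "(m * m * m) powr (-\<alpha>/3) \<le> (x * y * z) powr (-\<alpha>/3)" using assms by (intro powr_mono2') auto
  moreover have "(m * m * m) powr (-\<alpha>/3) = (m^2) powr (-\<alpha>/2)"
    using m by (simp add: powr_mult power2_eq_square flip: powr_add)
  moreover have "(4 * (x^2 + y^2 + z^2)) powr (-\<alpha>/2) \<le> (m^2) powr (-\<alpha>/2)"
    using m m2 assms by (intro powr_mono2') auto
  ultimately have "(4 * (x^2 + y^2 + z^2)) powr (-\<alpha>/2) \<le> (x * y * z) powr (-\<alpha>/3)" by linarith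
  then show ?thesis using assms by (simp add: powr_mult)
qed

text \<open>The condition \<open>\<alpha> < 3\<close> is exactly \<open>\<alpha>/3 < 1\<close>, the
  integrability of each one-dimensional factor from \<open>powr_prod3_le\<close>.\<close>

lemma musym_powr_integrable:
  assumes "0 < \<alpha>" "\<alpha> < 3"
  shows "set_integrable lborel torus (\<lambda>k. musym k powr (-\<alpha>/2))"
proof -
  define g where "g k = indicator {0<..<2*pi} k * sin (k / 2) powr - (\<alpha>/3)" for k :: real
  have ig: "integrable lborel g" unfolding g_def by (rule integrable_sin_half_powr) (use assms in auto)
  have ig2: "integrable lborel (\<lambda>z::real\<times>real. g (fst z) * g (snd z))" by (rule integrable_lborel_mult[OF ig ig])
  have ig3: "integrable lborel (\<lambda>k::real\<times>real\<times>real. g (fst k) * (g (fst (snd k)) * g (snd (snd k))))"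
    using integrable_lborel_mult(1)[OF ig ig2] by simp
  show ?thesis unfolding set_integrable_def
  proof (rule Bochner_Integration.integrable_bound[OF ig3])
    have *: "norm (indicator torus k *\<^sub>R musym k powr (-\<alpha>/2)) \<le> norm (g (fst k) * (g (fst (snd k)) * g (snd (snd k))))"
      if "k \<in> torus \<longrightarrow> k \<in> {0<..<2*pi} \<times> {0<..<2*pi} \<times> {0<..<2*pi}" for k
    proof (cases "k \<in> torus")
      case True
      obtain k1 k2 k3 where k: "k = (k1, k2, k3)" by (cases k) auto
      have s: "sin (k1/2) > 0" "sin (k2/2) > 0" "sin (k3/2) > 0"
        using that True by (auto simp: k intro!: sin_gt_zero)
      show ?thesis using powr_prod3_le[OF s, of \<alpha>] assms that True
        by (simp add: k musym_sin g_def mult.assoc)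
    qed auto
    show "AE k in lborel. norm (indicator torus k *\<^sub>R musym k powr (-\<alpha>/2)) \<le> norm (g (fst k) * (g (fst (snd k)) * g (snd (snd k))))"
      using AE_torus_interior by (rule AE_mp) (use * in auto)
  qed simp
qed

text \<open>A vanishing integral would force \<open>musym\<close> to vanish almost everywhere on an
  open box of positive measure, where it is strictly positive. The sign of this prefactor is what
  lets \<open>Ralpha\<close> inherit positivity from its symbol.\<close>

lemma Kconst_pos:
  assumes "0 < \<alpha>" shows "Kconst \<alpha> > 0"
proof -
  have i: "integrable lborel (\<lambda>k. indicator torus k *\<^sub>R musym k powr (\<alpha>/2))"
  proof (rule Bochner_Integration.integrable_bound[of _ "\<lambda>k. indicator torus k *\<^sub>R 12 powr (\<alpha>/2) :: real"])
    show "integrable lborel (\<lambda>k. indicator torus k *\<^sub>R 12 powr (\<alpha>/2) :: real)"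
      by (rule integrable_scaleR_left) (simp add: integrable_indicator_torus)
    show "AE k in lborel. norm (indicator torus k *\<^sub>R musym k powr (\<alpha>/2)) \<le> norm (indicator torus k *\<^sub>R 12 powr (\<alpha>/2) :: real)"
      using musym_bounds assms by (auto intro!: AE_I2 powr_mono2 simp: indicator_def)
  qed simp
  have nn: "AE k in lborel. 0 \<le> indicator torus k *\<^sub>R musym k powr (\<alpha>/2)" by (auto simp: indicator_def)
  have "(LINT k:torus|lborel. musym k powr (\<alpha>/2)) \<noteq> 0"
  proof
    assume "(LINT k:torus|lborel. musym k powr (\<alpha>/2)) = 0"
    then have z: "AE k in lborel. indicator torus k *\<^sub>R musym k powr (\<alpha>/2) = 0"
      using integral_nonneg_eq_0_iff_AE[OF i nn] by (simp add: set_lebesgue_integral_def)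
    have "AE k in lborel. k \<notin> box (0, 0, 0) (2*pi, 2*pi, 2*pi)"
      using z
    proof (rule AE_mp, intro AE_I2 impI notI)
      fix k assume "indicator torus k *\<^sub>R musym k powr (\<alpha>/2) = 0" "k \<in> box (0, 0, 0) (2*pi, 2*pi, 2*pi)"
      then show False using musym_pos[of k] by (auto simp: torus_box torus_def indicator_def)
    qed
    then have "emeasure lborel (box (0, 0, 0) (2*pi, 2*pi, 2*pi::real)) = 0"
      by (subst (asm) AE_iff_measurable[OF _ refl]) auto
    then show False by (simp add: emeasure_lborel_box_eq Basis_prod_def)
  qed
  moreover have "(LINT k:torus|lborel. musym k powr (\<alpha>/2)) \<ge> 0"
    unfolding set_lebesgue_integral_def by (rule integral_nonneg_AE[OF nn])
  ultimately show ?thesis unfolding Kconst_def by simp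
qed

section \<open>Orthogonality of characters and quadratic forms of Fourier kernels\<close>

lemma integral_exp_int:
  fixes n :: int
  shows "integrable lborel (\<lambda>k. indicator {0..2*pi} k *\<^sub>R exp (\<i> * complex_of_real (n * k)))"
    and "(\<integral>k. indicator {0..2*pi} k *\<^sub>R exp (\<i> * complex_of_real (n * k)) \<partial>lborel) = (if n = 0 then complex_of_real (2*pi) else 0)"
proof -
  have c: "continuous_on {0..2*pi} (\<lambda>k. exp (\<i> * complex_of_real (n * k)))" by (intro continuous_intros)
  show "integrable lborel (\<lambda>k. indicator {0..2*pi} k *\<^sub>R exp (\<i> * complex_of_real (n * k)))"
    using borel_integrable_atLeastAtMost'[OF c] by (simp add: set_integrable_def)
  show "(\<integral>k. indicator {0..2*pi} k *\<^sub>R exp (\<i> * complex_of_real (n * k)) \<partial>lborel) = (if n = 0 then complex_of_real (2*pi) else 0)"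
  proof (cases "n = 0")
    case True
    then show ?thesis by (simp add: scaleR_conv_of_real)
  next
    case False
    have "(\<integral>k. indicator {0..2*pi} k *\<^sub>R exp (\<i> * complex_of_real (n * k)) \<partial>lborel)
       = exp (\<i> * complex_of_real (real_of_int n * (2*pi))) / (\<i> * n) - exp (\<i> * complex_of_real (real_of_int n * 0)) / (\<i> * n)"
    proof (rule integral_FTC_atLeastAtMost[OF _ _ c])
      fix x :: real
      have "((\<lambda>z. exp (\<i> * (n * z)) / (\<i> * n)) has_field_derivative exp (\<i> * (n * complex_of_real x))) (at (complex_of_real x))"
        using False by (auto intro!: derivative_eq_intros simp: mult_ac)
      then have "((\<lambda>x. exp (\<i> * (n * complex_of_real x)) / (\<i> * n)) has_vector_derivative exp (\<i> * (n * complex_of_real x))) (at x)"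
        by (rule has_vector_derivative_real_field)
      then show "((\<lambda>x. exp (\<i> * complex_of_real (n * x)) / (\<i> * n)) has_vector_derivative exp (\<i> * complex_of_real (n * x))) (at x within {0..2*pi})"
        by (auto intro: has_vector_derivative_at_within)
    qed auto
    also have "exp (\<i> * complex_of_real (n * (2*pi))) = 1"
      using exp_integer_2pi[of "of_int n"] by (simp add: mult_ac)
    finally show ?thesis using False by simp
  qed
qed

lemma integral_exp_phase:
  "set_integrable lborel torus (\<lambda>k. exp (\<i> * complex_of_real (phase z k)))"
  "(LINT k:torus|lborel. exp (\<i> * complex_of_real (phase z k))) = (if z = 0 then complex_of_real ((2*pi)^3) else 0)"
proof -
  define e where "e n k = indicator {0..2*pi} k *\<^sub>R exp (\<i> * complex_of_real (of_int n * k))" for n :: int and k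
  obtain z1 z2 z3 where z: "z = (z1, z2, z3)" by (cases z) auto
  have eq: "(\<lambda>k. indicator torus k *\<^sub>R exp (\<i> * complex_of_real (phase z k))) = (\<lambda>k. e z1 (fst k) * (e z2 (fst (snd k)) * e z3 (snd (snd k))))"
    by (auto simp: fun_eq_iff e_def phase_def z torus_def indicator_def ring_distribs add.assoc simp flip: exp_add)
  have i: "integrable lborel (e n)" for n unfolding e_def by (rule integral_exp_int)
  have v: "integral\<^sup>L lborel (e n) = (if n = 0 then complex_of_real (2*pi) else 0)" for n unfolding e_def by (rule integral_exp_int)
  have i2: "integrable lborel (\<lambda>z::real\<times>real. e z2 (fst z) * e z3 (snd z))" by (rule integrable_lborel_mult[OF i i])
  have v2: "(\<integral>z. e z2 (fst z) * e z3 (snd z) \<partial>lborel) = integral\<^sup>L lborel (e z2) * integral\<^sup>L lborel (e z3)"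
    by (rule integrable_lborel_mult[OF i i])
  show "set_integrable lborel torus (\<lambda>k. exp (\<i> * complex_of_real (phase z k)))"
    unfolding set_integrable_def eq using integrable_lborel_mult(1)[OF i i2] by simp
  have "(LINT k:torus|lborel. exp (\<i> * complex_of_real (phase z k))) = integral\<^sup>L lborel (e z1) * (integral\<^sup>L lborel (e z2) * integral\<^sup>L lborel (e z3))"
    unfolding set_lebesgue_integral_def eq using integrable_lborel_mult(2)[OF i i2] v2 by simp
  then show "(LINT k:torus|lborel. exp (\<i> * complex_of_real (phase z k))) = (if z = 0 then complex_of_real ((2*pi)^3) else 0)"
    by (auto simp: v z power3_eq_cube zero_prod_def)
qed

text \<open>The unnormalised real Fourier kernel with symbol \<open>w\<close>. Two symbols are used:
  the constant 1, which gives a multiple of the identity, and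
  \<open>musym k powr (-\<alpha>/2)\<close>, which gives \<open>Ralpha\<close> up to a positive
  factor.\<close>

definition lat_kernel :: "(real \<times> real \<times> real \<Rightarrow> real) \<Rightarrow> lat \<Rightarrow> lat \<Rightarrow> real" where
  "lat_kernel w x y = (LINT k:torus|lborel. cos (phase (x - y) k) * w k)"

lemma set_integrable_cos_phase:
  assumes "set_integrable lborel torus w" shows "set_integrable lborel torus (\<lambda>k. cos (phase z k) * w k)"
proof -
  have m: "(\<lambda>k. indicator torus k *\<^sub>R w k) \<in> borel_measurable lborel" using assms by (auto simp: set_integrable_def)
  have "(\<lambda>k. cos (phase z k) * (indicator torus k *\<^sub>R w k)) \<in> borel_measurable lborel"
    by (intro borel_measurable_times m) simp
  then have m': "(\<lambda>k. indicator torus k *\<^sub>R (cos (phase z k) * w k)) \<in> borel_measurable lborel"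
    by (simp add: mult_ac)
  show ?thesis unfolding set_integrable_def
    by (rule Bochner_Integration.integrable_bound[OF assms[unfolded set_integrable_def] m'])
       (auto simp: abs_mult indicator_def intro!: AE_I2 mult_left_le_one_le)
qed

lemma lat_kernel_commute: "lat_kernel w x y = lat_kernel w y x"
proof -
  have "phase (x - y) k = - phase (y - x) k" for k by (simp add: phase_def algebra_simps)
  then have "cos (phase (x - y) k) = cos (phase (y - x) k)" for k by simp
  then show ?thesis by (simp add: lat_kernel_def)
qed

lemma lat_kernel_bound:
  assumes "set_integrable lborel torus w" "\<And>k. 0 \<le> w k"
  shows "\<bar>lat_kernel w x y\<bar> \<le> (LINT k:torus|lborel. w k)"
proof -
  show ?thesis
    unfolding lat_kernel_def set_lebesgue_integral_def
    by (rule integral_abs_bound_integral)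
       (use assms(2) assms(1)[unfolded set_integrable_def] set_integrable_cos_phase[OF assms(1), unfolded set_integrable_def]
        in \<open>auto simp: abs_mult indicator_def intro!: mult_left_le_one_le\<close>)
qed

lemma Re_cnj_phase_sum:
  "(\<Sum>x\<in>F. \<Sum>y\<in>F. f x * f y * cos (phase (x - y) k)) = (cmod (\<Sum>x\<in>F. f x * exp (\<i> * complex_of_real (phase x k))))^2"
proof -
  define S where "S = (\<Sum>x\<in>F. f x * exp (\<i> * complex_of_real (phase x k)))"
  have e: "exp (\<i> * complex_of_real r) * cnj (exp (\<i> * complex_of_real s)) = exp (\<i> * complex_of_real (r - s))" for r s
    by (simp add: exp_cnj exp_diff ring_distribs exp_minus divide_inverse)
  have p: "phase (x - y) k = phase x k - phase y k" for x y by (simp add: phase_def algebra_simps)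
  have t: "(f x * exp (\<i> * complex_of_real (phase x k))) * cnj (f y * exp (\<i> * complex_of_real (phase y k)))
     = of_real (f x * f y) * exp (\<i> * complex_of_real (phase (x - y) k))" for x y
  proof -
    have "(f x * exp (\<i> * complex_of_real (phase x k))) * cnj (f y * exp (\<i> * complex_of_real (phase y k)))
       = of_real (f x * f y) * (exp (\<i> * complex_of_real (phase x k)) * cnj (exp (\<i> * complex_of_real (phase y k))))"
      by (simp del: exp_cnj)
    then show ?thesis unfolding e p .
  qed
  have "S * cnj S = (\<Sum>x\<in>F. \<Sum>y\<in>F. of_real (f x * f y) * exp (\<i> * complex_of_real (phase (x - y) k)))"
    unfolding S_def cnj_sum sum_product t ..
  then have "Re (S * cnj S) = (\<Sum>x\<in>F. \<Sum>y\<in>F. f x * f y * cos (phase (x - y) k))"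
    by (simp add: exp_eq_polar cis.sel)
  moreover have "Re (S * cnj S) = (cmod S)^2" by (metis complex_norm_square Re_complex_of_real)
  ultimately show ?thesis by (simp add: S_def)
qed

text \<open>By \<open>Re_cnj_phase_sum\<close>, the form is the integral of the squared modulus of a
  trigonometric polynomial against \<open>w\<close>. Consequently a pointwise inequality between two
  symbols becomes an inequality between the quadratic forms.\<close>

lemma lat_kernel_quadratic_form:
  fixes f :: "lat \<Rightarrow> real"
  assumes "set_integrable lborel torus w" "finite F"
  defines "q \<equiv> \<lambda>k. (cmod (\<Sum>x\<in>F. f x * exp (\<i> * complex_of_real (phase x k))))^2 * w k"
  shows "set_integrable lborel torus q" "(\<Sum>x\<in>F. \<Sum>y\<in>F. f x * f y * lat_kernel w x y) = (LINT k:torus|lborel. q k)"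
proof -
  have q: "indicator torus k *\<^sub>R q k = (\<Sum>x\<in>F. \<Sum>y\<in>F. f x * f y * (indicator torus k *\<^sub>R (cos (phase (x - y) k) * w k)))" for k
    unfolding q_def Re_cnj_phase_sum[symmetric] sum_distrib_right scaleR_sum_right by (simp add: mult_ac)
  note i = set_integrable_cos_phase[OF assms(1), unfolded set_integrable_def]
  show "set_integrable lborel torus q"
    unfolding set_integrable_def q by (intro Bochner_Integration.integrable_sum integrable_mult_right i)
  have "(LINT k:torus|lborel. q k) = (\<Sum>x\<in>F. \<Sum>y\<in>F. f x * f y * (\<integral>k. indicator torus k *\<^sub>R (cos (phase (x - y) k) * w k) \<partial>lborel))"
    unfolding set_lebesgue_integral_def q
    by (subst Bochner_Integration.integral_sum, intro Bochner_Integration.integrable_sum integrable_mult_right i, intro sum.cong refl,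
        subst Bochner_Integration.integral_sum, intro integrable_mult_right i, intro sum.cong refl integral_mult_right_zero)
  then show "(\<Sum>x\<in>F. \<Sum>y\<in>F. f x * f y * lat_kernel w x y) = (LINT k:torus|lborel. q k)"
    by (simp add: lat_kernel_def set_lebesgue_integral_def)
qed

lemma lat_kernel_one: "lat_kernel (\<lambda>_. 1) x y = (if x = y then (2*pi)^3 else 0)"
proof -
  have "lat_kernel (\<lambda>_. 1) x y = (LINT k:torus|lborel. Re (exp (\<i> * complex_of_real (phase (x - y) k))))"
    by (simp add: lat_kernel_def exp_eq_polar cis.sel)
  also have "\<dots> = Re (LINT k:torus|lborel. exp (\<i> * complex_of_real (phase (x - y) k)))"
    using integral_Re[OF integral_exp_phase(1)[unfolded set_integrable_def, of "x - y"]]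
    by (simp add: set_lebesgue_integral_def)
  finally show ?thesis unfolding integral_exp_phase(2) by simp
qed

lemma Re_complex_of_real_mult: "Re (complex_of_real r * z) = r * Re z" by simp

lemma Ralpha_eq_lat_kernel:
  assumes "0 < \<alpha>" "\<alpha> < 3"
  shows "Ralpha \<alpha> x y = Kconst \<alpha> / (2*pi)^3 * lat_kernel (\<lambda>k. musym k powr (-\<alpha>/2)) x y"
proof -
  have w: "set_integrable lborel torus (\<lambda>k. musym k powr (-\<alpha>/2))" by (rule musym_powr_integrable[OF assms])
  define g where "g k = indicator torus k *\<^sub>R (exp (\<i> * complex_of_real (phase (x - y) k)) * complex_of_real (musym k powr (-\<alpha>/2)))" for k
  have ig: "integrable lborel g"
    by (rule Bochner_Integration.integrable_bound[OF w[unfolded set_integrable_def]]) (auto simp: g_def[abs_def] norm_mult)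
  have "Re (integral\<^sup>L lborel g) = (\<integral>k. Re (g k) \<partial>lborel)" using integral_Re[OF ig] by simp
  also have "\<dots> = lat_kernel (\<lambda>k. musym k powr (-\<alpha>/2)) x y"
    by (simp add: lat_kernel_def set_lebesgue_integral_def g_def exp_eq_polar cis.sel)
  finally have "Re (integral\<^sup>L lborel g) = lat_kernel (\<lambda>k. musym k powr (-\<alpha>/2)) x y" .
  moreover have "Rc \<alpha> x y = complex_of_real (Kconst \<alpha> / (2*pi)^3) * integral\<^sup>L lborel g"
    unfolding Rc_def set_lebesgue_integral_def g_def ..
  ultimately show ?thesis unfolding Ralpha_def by (simp only: Re_complex_of_real_mult)
qed

lemma Ralpha_commute: "0 < \<alpha> \<Longrightarrow> \<alpha> < 3 \<Longrightarrow> Ralpha \<alpha> x y = Ralpha \<alpha> y x"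
  by (simp add: Ralpha_eq_lat_kernel lat_kernel_commute[of _ x y])

lemma Ralpha_bounded:
  assumes "0 < \<alpha>" "\<alpha> < 3" obtains C where "C > 0" "\<And>x y. \<bar>Ralpha \<alpha> x y\<bar> \<le> C"
proof -
  define I where "I = (LINT k:torus|lborel. musym k powr (-\<alpha>/2))"
  have b: "\<bar>Ralpha \<alpha> x y\<bar> \<le> Kconst \<alpha> / (2*pi)^3 * I" for x y
    unfolding Ralpha_eq_lat_kernel[OF assms] I_def using Kconst_pos[OF assms(1)] lat_kernel_bound[OF musym_powr_integrable[OF assms]]
    by (simp add: abs_mult mult_left_mono divide_right_mono)
  then have "\<bar>Ralpha \<alpha> x y\<bar> \<le> \<bar>Kconst \<alpha> / (2*pi)^3 * I\<bar> + 1" for x y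
    using b[of x y] abs_ge_self[of "Kconst \<alpha> / (2*pi)^3 * I"] by linarith
  then show ?thesis by (rule that[rotated]) (intro add_nonneg_pos abs_ge_zero zero_less_one)
qed

text \<open>The symbol is bounded below by \<open>12 powr (-\<alpha>/2)\<close>, so the kernel dominates a multiple of the identity.\<close>
lemma Ralpha_coercive:
  assumes "0 < \<alpha>" "\<alpha> < 3"
  obtains c where "c > 0"
    "\<And>F f. finite F \<Longrightarrow> c * (\<Sum>x\<in>F. (f x)^2) \<le> (\<Sum>x\<in>F. \<Sum>y\<in>F. f x * f y * Ralpha \<alpha> x y)"
proof -
  define c0 where "c0 = 12 powr (-\<alpha>/2)"
  define c where "c = Kconst \<alpha> / (2*pi)^3"
  have c: "c > 0" "c0 > 0" using Kconst_pos[OF assms(1)] by (auto simp: c_def c0_def)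
  have one: "set_integrable lborel torus (\<lambda>_. 1 :: real)" by (simp add: integrable_indicator_torus set_integrable_def)
  have "c * (c0 * (2*pi)^3) * (\<Sum>x\<in>F. (f x)^2) \<le> (\<Sum>x\<in>F. \<Sum>y\<in>F. f x * f y * Ralpha \<alpha> x y)" if F: "finite F" for F f
  proof -
    note q = lat_kernel_quadratic_form[OF musym_powr_integrable[OF assms] F, of f]
    note q1 = lat_kernel_quadratic_form[OF one F, of f]
    define S where "S k = (cmod (\<Sum>x\<in>F. f x * exp (\<i> * complex_of_real (phase x k))))^2" for k
    have d: "(\<Sum>y\<in>F. f x * f y * lat_kernel (\<lambda>_. 1) x y) = (2*pi)^3 * (f x)^2" if "x \<in> F" for x
    proof -
      have "(\<Sum>y\<in>F. f x * f y * lat_kernel (\<lambda>_. 1) x y) = (\<Sum>y\<in>F. if x = y then f x * f y * (2*pi)^3 else 0)"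
        by (intro sum.cong refl) (simp add: lat_kernel_one)
      also have "\<dots> = (2*pi)^3 * (f x)^2" using that F by (simp add: power2_eq_square)
      finally show ?thesis .
    qed
    have "(\<Sum>x\<in>F. \<Sum>y\<in>F. f x * f y * lat_kernel (\<lambda>_. 1) x y) = (\<Sum>x\<in>F. (2*pi)^3 * (f x)^2)"
      by (rule sum.cong[OF refl d])
    \<comment> \<open>Parseval: the sum of squares is itself the form of a Fourier kernel, with
      symbol 1, so both sides are integrals of the same \<open>S k\<close> against two
      symbols.\<close>
    then have "c0 * (2*pi)^3 * (\<Sum>x\<in>F. (f x)^2) = c0 * (\<Sum>x\<in>F. \<Sum>y\<in>F. f x * f y * lat_kernel (\<lambda>_. 1) x y)"
      by (simp only: sum_distrib_left mult.assoc)
    also have "\<dots> = (\<integral>k. c0 * (indicator torus k *\<^sub>R (S k * 1)) \<partial>lborel)" unfolding q1 S_def by (simp add: set_lebesgue_integral_def)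
    also have "\<dots> \<le> (\<integral>k. indicator torus k *\<^sub>R (S k * musym k powr (-\<alpha>/2)) \<partial>lborel)"
    proof (rule integral_mono_AE)
      show "integrable lborel (\<lambda>k. c0 * (indicator torus k *\<^sub>R (S k * 1)))"
        using q1(1) unfolding set_integrable_def S_def by (intro integrable_mult_right)
      show "integrable lborel (\<lambda>k. indicator torus k *\<^sub>R (S k * musym k powr (-\<alpha>/2)))"
        using q(1) unfolding set_integrable_def S_def .
      have *: "c0 * (indicator torus k *\<^sub>R (S k * 1)) \<le> indicator torus k *\<^sub>R (S k * musym k powr (-\<alpha>/2))"
        if "k \<in> torus \<longrightarrow> k \<in> {0<..<2*pi} \<times> {0<..<2*pi} \<times> {0<..<2*pi}" for k
      proof (cases "k \<in> torus")
        case True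
        have "c0 \<le> musym k powr (-\<alpha>/2)" unfolding c0_def
          using musym_pos[of k] musym_bounds[of k] that True assms by (intro powr_mono2') auto
        then show ?thesis using True mult_left_mono[of c0 _ "S k"] by (simp add: S_def mult.commute)
      qed auto
      show "AE k in lborel. c0 * (indicator torus k *\<^sub>R (S k * 1)) \<le> indicator torus k *\<^sub>R (S k * musym k powr (-\<alpha>/2))"
        using AE_torus_interior by (rule AE_mp) (use * in auto)
    qed
    also have "\<dots> = (\<Sum>x\<in>F. \<Sum>y\<in>F. f x * f y * lat_kernel (\<lambda>k. musym k powr (-\<alpha>/2)) x y)"
      unfolding q(2) S_def by (simp add: set_lebesgue_integral_def)
    finally have "c * (c0 * (2*pi)^3 * (\<Sum>x\<in>F. (f x)^2)) \<le> c * (\<Sum>x\<in>F. \<Sum>y\<in>F. f x * f y * lat_kernel (\<lambda>k. musym k powr (-\<alpha>/2)) x y)"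
      using c by (intro mult_left_mono) auto
    also have "\<dots> = (\<Sum>x\<in>F. \<Sum>y\<in>F. f x * f y * Ralpha \<alpha> x y)"
      unfolding Ralpha_eq_lat_kernel[OF assms] c_def[symmetric] by (simp add: sum_distrib_left mult_ac)
    finally show ?thesis by (simp add: mult.assoc)
  qed
  then show ?thesis using that[of "c * (c0 * (2*pi)^3)"] c by simp
qed

section \<open>Bounded kernels and the Dirichlet form\<close>

text \<open>The sum is iterated, not taken over pairs, so that it agrees literally with the nonlocal
  sums in \<open>Jfun\<close> and \<open>dJ\<close>, whose inner sum is \<open>conv\<close>.\<close>

definition kform :: "('a \<Rightarrow> 'a \<Rightarrow> real) \<Rightarrow> ('a \<Rightarrow> real) \<Rightarrow> ('a \<Rightarrow> real) \<Rightarrow> real" where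
  "kform K f g = (\<Sum>\<^sub>\<infinity>x. (\<Sum>\<^sub>\<infinity>y. K x y * f y) * g x)"

locale bounded_kernel =
  fixes K :: "'a \<Rightarrow> 'a \<Rightarrow> real" and C :: real
  assumes bound: "\<bar>K x y\<bar> \<le> C" and sym: "K x y = K y x"
begin

lemma C_nonneg: "0 \<le> C" using bound[of undefined undefined] by linarith

lemma row_bound: "\<bar>K x y * f y\<bar> \<le> C * \<bar>f y\<bar>"
  by (simp add: abs_mult bound mult_right_mono)

lemma abs_row_le:
  assumes "f summable_on UNIV" shows "\<bar>\<Sum>\<^sub>\<infinity>y. K x y * f y\<bar> \<le> C * (\<Sum>\<^sub>\<infinity>y. \<bar>f y\<bar>)"
proof -
  have "\<bar>\<Sum>\<^sub>\<infinity>y. K x y * f y\<bar> \<le> (\<Sum>\<^sub>\<infinity>y. C * \<bar>f y\<bar>)"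
    by (rule abs_infsum_le[OF summable_on_cmult_right[OF abs_summable_real[OF assms]]]) (rule row_bound)
  then show ?thesis by (simp add: infsum_cmult_right')
qed

lemma kform_term_bound:
  assumes "f summable_on UNIV"
  shows "\<bar>(\<Sum>\<^sub>\<infinity>y. K x y * f y) * g x\<bar> \<le> C * (\<Sum>\<^sub>\<infinity>y. \<bar>f y\<bar>) * \<bar>g x\<bar>"
  using abs_row_le[OF assms] by (simp add: abs_mult mult_right_mono)

lemma kform_summable:
  assumes "f summable_on UNIV" "g summable_on UNIV"
  shows "(\<lambda>x. (\<Sum>\<^sub>\<infinity>y. K x y * f y) * g x) summable_on UNIV"
  by (rule summable_on_real_dominated[OF summable_on_cmult_right[OF abs_summable_real[OF assms(2)]]])
     (rule kform_term_bound[OF assms(1)])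

lemma abs_kform_le:
  assumes "f summable_on UNIV" "g summable_on UNIV"
  shows "\<bar>kform K f g\<bar> \<le> C * (\<Sum>\<^sub>\<infinity>x. \<bar>f x\<bar>) * (\<Sum>\<^sub>\<infinity>x. \<bar>g x\<bar>)"
proof -
  have "\<bar>kform K f g\<bar> \<le> (\<Sum>\<^sub>\<infinity>x. C * (\<Sum>\<^sub>\<infinity>y. \<bar>f y\<bar>) * \<bar>g x\<bar>)"
    unfolding kform_def
    by (rule abs_infsum_le[OF summable_on_cmult_right[OF abs_summable_real[OF assms(2)]]]) (rule kform_term_bound[OF assms(1)])
  then show ?thesis by (simp add: infsum_cmult_right')
qed

lemma kform_add_right:
  assumes "f summable_on UNIV" "g summable_on UNIV" "k summable_on UNIV"
  shows "kform K f (\<lambda>x. g x + k x) = kform K f g + kform K f k"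
  unfolding kform_def distrib_left by (intro infsum_add kform_summable assms)

lemma kform_scale_right: "kform K f (\<lambda>x. c * g x) = c * kform K f g"
  unfolding kform_def by (simp add: mult.left_commute[of _ c] infsum_cmult_right')

text \<open>The product \<open>C * \<bar>f y\<bar> * \<bar>g x\<bar>\<close> is a summable majorant
  over pairs, so the two sums may be exchanged; symmetry of \<open>K\<close> does the rest.\<close>

lemma kform_commute:
  assumes "f summable_on UNIV" "g summable_on UNIV"
  shows "kform K f g = kform K g f"
proof -
  have "(\<lambda>(x, y). \<bar>g x\<bar> * (C * \<bar>f y\<bar>)) summable_on UNIV \<times> UNIV"
    by (rule summable_on_SigmaI[where g = "\<lambda>x. \<bar>g x\<bar> * (C * (\<Sum>\<^sub>\<infinity>y. \<bar>f y\<bar>))"])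
       (auto intro!: has_sum_cmult_right has_sum_infsum abs_summable_real assms summable_on_cmult_left C_nonneg mult_nonneg_nonneg)
  then have "(\<lambda>(x, y). K x y * f y * g x) summable_on UNIV \<times> UNIV"
  proof (rule summable_on_real_dominated)
    fix z :: "'a \<times> 'a" 
    obtain x y where z: "z = (x, y)" by (cases z)
    have "\<bar>K x y\<bar> * (\<bar>f y\<bar> * \<bar>g x\<bar>) \<le> C * (\<bar>f y\<bar> * \<bar>g x\<bar>)" by (intro mult_right_mono bound) auto
    then show "\<bar>case z of (x, y) \<Rightarrow> K x y * f y * g x\<bar> \<le> (case z of (x, y) \<Rightarrow> \<bar>g x\<bar> * (C * \<bar>f y\<bar>))"
      by (simp add: z abs_mult mult_ac)
  qed
  then have "(\<Sum>\<^sub>\<infinity>x. \<Sum>\<^sub>\<infinity>y. K x y * f y * g x) = (\<Sum>\<^sub>\<infinity>y. \<Sum>\<^sub>\<infinity>x. K x y * f y * g x)"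
    by (rule infsum_swap_banach)
  moreover have "(\<Sum>\<^sub>\<infinity>y. K x y * f y * g x) = (\<Sum>\<^sub>\<infinity>y. K x y * f y) * g x" for x
    by (rule infsum_cmult_left')
  moreover have "(\<Sum>\<^sub>\<infinity>x. K x y * f y * g x) = (\<Sum>\<^sub>\<infinity>x. K y x * g x) * f y" for y
    using infsum_cmult_left'[of "\<lambda>x. K y x * g x" "f y" UNIV] by (simp add: sym[of _ y] mult_ac)
  ultimately show ?thesis unfolding kform_def by simp
qed

lemma kform_add_left:
  assumes "f summable_on UNIV" "g summable_on UNIV" "k summable_on UNIV"
  shows "kform K (\<lambda>x. g x + k x) f = kform K g f + kform K k f"
  using kform_add_right[OF assms] assms by (simp add: kform_commute summable_on_add)

lemma kform_scale_left: "f summable_on UNIV \<Longrightarrow> g summable_on UNIV \<Longrightarrow> kform K (\<lambda>x. c * g x) f = c * kform K g f"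
  using kform_scale_right[of f c g] by (simp add: kform_commute summable_on_cmult_right)

lemma kform_diff_right:
  assumes "f summable_on UNIV" "g summable_on UNIV" "k summable_on UNIV"
  shows "kform K f (\<lambda>x. g x - k x) = kform K f g - kform K f k"
  using kform_add_right[OF assms(1,2) summable_on_cmult_right[OF assms(3), of "-1"]] kform_scale_right[of f "-1" k] by simp

lemma kform_diff_left:
  assumes "f summable_on UNIV" "g summable_on UNIV" "k summable_on UNIV"
  shows "kform K (\<lambda>x. g x - k x) f = kform K g f - kform K k f"
  using kform_diff_right[OF assms] assms by (simp add: kform_commute summable_on_minus_real)

lemma kform_tendsto:
  assumes F: "l1_conv F f" and G: "l1_conv G g"
  shows "(\<lambda>n. kform K (F n) (G n)) \<longlonglongrightarrow> kform K f g"
proof -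
  have s: "F n summable_on UNIV" "f summable_on UNIV" "G n summable_on UNIV" "g summable_on UNIV" for n
    using F G by (auto simp: l1_conv_def)
  define NF NG where "NF n = (\<Sum>\<^sub>\<infinity>x. \<bar>F n x - f x\<bar>)" and "NG n = (\<Sum>\<^sub>\<infinity>x. \<bar>G n x - g x\<bar>)" for n
  have t: "NF \<longlonglongrightarrow> 0" "NG \<longlonglongrightarrow> 0" using F G by (auto simp: l1_conv_def NF_def[abs_def] NG_def[abs_def])
  note sd = summable_on_minus_real[OF s(1,2)] summable_on_minus_real[OF s(3,4)]
  have e: "kform K (F n) (G n) - kform K f g = kform K (\<lambda>x. F n x - f x) (\<lambda>x. G n x - g x)
     + kform K (\<lambda>x. F n x - f x) g + kform K f (\<lambda>x. G n x - g x)" for n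
    using kform_diff_left[OF sd(2) s(1,2), of n n] kform_diff_left[OF s(4) s(1,2), of n] kform_diff_right[OF s(2) s(3,4), of n]
      kform_diff_right[OF s(1) s(3,4), of n n] by simp
  have b: "\<bar>kform K (F n) (G n) - kform K f g\<bar> \<le> C * NF n * NG n + C * NF n * (\<Sum>\<^sub>\<infinity>x. \<bar>g x\<bar>) + C * (\<Sum>\<^sub>\<infinity>x. \<bar>f x\<bar>) * NG n" for n
    unfolding e using abs_kform_le[OF sd(1) sd(2), of n n] abs_kform_le[OF sd(1) s(4), of n] abs_kform_le[OF s(2) sd(2), of n]
    unfolding NF_def NG_def by linarith
  have "(\<lambda>n. C * NF n * NG n + C * NF n * (\<Sum>\<^sub>\<infinity>x. \<bar>g x\<bar>) + C * (\<Sum>\<^sub>\<infinity>x. \<bar>f x\<bar>) * NG n) \<longlonglongrightarrow>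
      C * 0 * 0 + C * 0 * (\<Sum>\<^sub>\<infinity>x. \<bar>g x\<bar>) + C * (\<Sum>\<^sub>\<infinity>x. \<bar>f x\<bar>) * 0"
    by (intro tendsto_intros t)
  then have "(\<lambda>n. \<bar>kform K (F n) (G n) - kform K f g\<bar>) \<longlonglongrightarrow> 0"
    by (intro tendsto_0_le_seq[OF _ b]) auto
  then show ?thesis by (simp add: LIM_zero_cancel tendsto_rabs_zero_iff)
qed

text \<open>Truncate \<open>f\<close> to a finite set \<open>F\<close>, where the hypothesis
  applies. Since the kernel is bounded, truncation changes the form by at most
  \<open>2 * C * N\<close> times the l1 tail of \<open>f\<close> outside \<open>F\<close>, which
  vanishes as \<open>F\<close> grows.\<close>

lemma kform_coercive:
  assumes co: "\<And>F f. finite F \<Longrightarrow> c * (\<Sum>x\<in>F. (f x)^2) \<le> (\<Sum>x\<in>F. \<Sum>y\<in>F. f x * f y * K x y)"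
    and f: "f summable_on UNIV" "l2 f"
  shows "c * ip f f \<le> kform K f f"
proof -
  define fF where "fF F x = (if x \<in> F then f x else 0)" for F x
  have fin: "(\<Sum>\<^sub>\<infinity>x. if x \<in> F then k x else 0) = sum k F" "(\<lambda>x. if x \<in> F then k x else 0) summable_on UNIV"
    if "finite F" for F and k :: "'a \<Rightarrow> real"
  proof -
    have "((\<lambda>x. if x \<in> F then k x else 0) has_sum sum k F) UNIV"
      by (rule has_sum_finite_neutralI[OF that]) (auto intro: sum.cong)
    then show "(\<Sum>\<^sub>\<infinity>x. if x \<in> F then k x else 0) = sum k F" "(\<lambda>x. if x \<in> F then k x else 0) summable_on UNIV"
      by (auto simp: infsumI has_sum_imp_summable)
  qed
  define N where "N = (\<Sum>\<^sub>\<infinity>x. \<bar>f x\<bar>)"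
  have key: "c * (\<Sum>x\<in>F. f x * f x) \<le> kform K f f + 2 * C * N * (N - (\<Sum>x\<in>F. \<bar>f x\<bar>))" if F: "finite F" for F
  proof -
    have s: "fF F summable_on UNIV" unfolding fF_def by (rule fin(2)[OF F])
    have sd: "(\<lambda>x. f x - fF F x) summable_on UNIV" by (intro summable_on_minus_real f s)
    have "(\<Sum>\<^sub>\<infinity>x. \<bar>f x - fF F x\<bar>) = (\<Sum>\<^sub>\<infinity>x. \<bar>f x\<bar> - (if x \<in> F then \<bar>f x\<bar> else 0))"
      by (intro infsum_cong) (auto simp: fF_def)
    also have "\<dots> = N - (\<Sum>x\<in>F. \<bar>f x\<bar>)"
      unfolding N_def by (subst infsum_minus_real) (auto intro: abs_summable_real f fin(2)[OF F] simp: fin(1)[OF F])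
    finally have n1: "(\<Sum>\<^sub>\<infinity>x. \<bar>f x - fF F x\<bar>) = N - (\<Sum>x\<in>F. \<bar>f x\<bar>)" .
    have n2: "(\<Sum>\<^sub>\<infinity>x. \<bar>fF F x\<bar>) \<le> N"
      unfolding N_def by (intro infsum_mono abs_summable_real s f) (auto simp: fF_def)
    have n0: "0 \<le> N - (\<Sum>x\<in>F. \<bar>f x\<bar>)" unfolding n1[symmetric] by (intro infsum_nonneg) simp
    have "kform K (fF F) (fF F) = (\<Sum>x\<in>F. \<Sum>y\<in>F. f x * f y * K x y)"
    proof -
      have r: "(\<Sum>\<^sub>\<infinity>y. K x y * fF F y) = (\<Sum>y\<in>F. K x y * f y)" for x
        using fin(1)[OF F, of "\<lambda>y. K x y * f y"] by (simp add: fF_def if_distrib cong: if_cong)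
      show ?thesis unfolding kform_def r
        using fin(1)[OF F, of "\<lambda>x. (\<Sum>y\<in>F. K x y * f y) * f x"]
        by (simp add: fF_def if_distrib sum_distrib_right sum_distrib_left mult_ac cong: if_cong)
    qed
    then have "c * (\<Sum>x\<in>F. f x * f x) \<le> kform K (fF F) (fF F)" using co[OF F, of f] by (simp add: power2_eq_square)
    moreover have "kform K f f - kform K (fF F) (fF F) = kform K (\<lambda>x. f x - fF F x) f + kform K (fF F) (\<lambda>x. f x - fF F x)"
      using kform_diff_left[OF f(1) f(1) s] kform_diff_right[OF s f(1) s] by simp
    moreover have "\<bar>kform K (\<lambda>x. f x - fF F x) f\<bar> \<le> C * N * (N - (\<Sum>x\<in>F. \<bar>f x\<bar>))"
      using abs_kform_le[OF sd f(1)] unfolding n1 N_def[symmetric] by (simp add: mult_ac)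
    moreover have "\<bar>kform K (fF F) (\<lambda>x. f x - fF F x)\<bar> \<le> C * N * (N - (\<Sum>x\<in>F. \<bar>f x\<bar>))"
      using abs_kform_le[OF s sd] mult_right_mono[OF mult_left_mono[OF n2 C_nonneg] n0] unfolding n1 by linarith
    ultimately show ?thesis by linarith
  qed
  have t1: "((\<lambda>F. c * (\<Sum>x\<in>F. f x * f x)) \<longlongrightarrow> c * ip f f) (finite_subsets_at_top UNIV)"
    unfolding ip_def by (intro tendsto_intros infsum_tendsto l2_mult_summable f)
  have t2: "((\<lambda>F. kform K f f + 2 * C * N * (N - (\<Sum>x\<in>F. \<bar>f x\<bar>))) \<longlongrightarrow> kform K f f + 2 * C * N * (N - N)) (finite_subsets_at_top UNIV)"
    unfolding N_def by (intro tendsto_intros infsum_tendsto abs_summable_real f)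
  have "c * ip f f \<le> kform K f f + 2 * C * N * (N - N)"
    by (rule tendsto_le[OF _ t2 t1]) (auto intro!: eventually_finite_subsets_at_top_weakI key)
  then show ?thesis by simp
qed

end

section \<open>Lattice differences and the Dirichlet form\<close>

definition unit_steps :: "lat set" where
  "unit_steps = {(1,0,0), (-1,0,0), (0,1,0), (0,-1,0), (0,0,1), (0,0,-1)}"

lemma finite_unit_steps [simp]: "finite unit_steps" by (simp add: unit_steps_def)

lemma int_abs_sum_eq_1:
  fixes a b c :: int
  shows "\<bar>a\<bar> + \<bar>b\<bar> + \<bar>c\<bar> = 1 \<longleftrightarrow> (a, b, c) \<in> unit_steps"
  unfolding unit_steps_def insert_iff empty_iff prod.inject by (smt (verit))

lemma nbrs_eq: "nbrs x = (\<lambda>d. x + d) ` unit_steps"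
proof -
  have "y \<in> nbrs x \<longleftrightarrow> y - x \<in> unit_steps" for y
    using int_abs_sum_eq_1[of "fst y - fst x" "fst (snd y) - fst (snd x)" "snd (snd y) - snd (snd x)"]
    by (simp add: nbrs_def ldist_def abs_minus_commute minus_prod_def)
  then show ?thesis by (auto simp: image_iff) (metis add_diff_cancel_left' diff_add_cancel add.commute)+
qed

lemma sum_nbrs: "(\<Sum>y\<in>nbrs x. F y) = (\<Sum>d\<in>unit_steps. F (x + d))"
  unfolding nbrs_eq by (subst sum.reindex) (auto simp: inj_on_def)

text \<open>Summing over six fixed translations instead of over a neighbour set depending on
  \<open>x\<close> turns the Dirichlet form into a finite sum of l2 inner products of differences.
  Boundedness and continuity on l2 then follow from translation invariance of
  \<open>ip\<close>.\<close>

definition step_diff :: "lat \<Rightarrow> (lat \<Rightarrow> real) \<Rightarrow> lat \<Rightarrow> real" where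
  "step_diff d u x = u (x + d) - u x"

lemma bij_add_right: "bij (\<lambda>x. x + d)" for d :: "'a::group_add"
  by (rule bij_betw_byWitness[where f' = "\<lambda>x. x - d"]) simp_all

lemma l2_step_diff: "l2 u \<Longrightarrow> l2 (step_diff d u)"
  unfolding step_diff_def[abs_def] by (rule l2_diff[OF l2_comp_bij[OF _ bij_add_right]])

lemma l2_conv_step_diff: "l2_conv U u \<Longrightarrow> l2_conv (\<lambda>n. step_diff d (U n)) (step_diff d u)"
  unfolding step_diff_def[abs_def] by (rule l2_conv_diff[OF l2_conv_comp_bij[OF _ bij_add_right]])

lemma grad_prod_eq: "grad_prod u v x = 1/2 * (\<Sum>d\<in>unit_steps. step_diff d u x * step_diff d v x)"
  by (simp add: grad_prod_def sum_nbrs step_diff_def)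

lemma grad_sq_eq: "grad_sq u = grad_prod u u"
  by (simp add: fun_eq_iff grad_sq_def grad_prod_def power2_eq_square)

lemma Dir_eq: "Dir u = Dir_form u u" by (simp add: Dir_def Dir_form_def grad_sq_eq)

lemma has_sum_sum_real:
  fixes f :: "'i \<Rightarrow> 'a \<Rightarrow> real"
  assumes "finite I" "\<And>i. i \<in> I \<Longrightarrow> (f i has_sum s i) A"
  shows "((\<lambda>x. \<Sum>i\<in>I. f i x) has_sum (\<Sum>i\<in>I. s i)) A"
  using assms
proof (induction I rule: finite_induct)
  case (insert i I)
  have "((\<lambda>x. f i x + (\<Sum>i\<in>I. f i x)) has_sum (s i + (\<Sum>i\<in>I. s i))) A"
    by (rule has_sum_add[OF insert.prems insert.IH]) (simp_all add: insert.prems)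
  then show ?case using insert.hyps by simp
qed simp

lemma summable_on_sum_real:
  fixes f :: "'i \<Rightarrow> 'a \<Rightarrow> real"
  assumes "finite I" "\<And>i. i \<in> I \<Longrightarrow> f i summable_on A"
  shows "(\<lambda>x. \<Sum>i\<in>I. f i x) summable_on A"
  by (rule has_sum_imp_summable[OF has_sum_sum_real[OF assms(1) has_sum_infsum[OF assms(2)]]])

lemma infsum_sum_real:
  fixes f :: "'i \<Rightarrow> 'a \<Rightarrow> real"
  assumes "finite I" "\<And>i. i \<in> I \<Longrightarrow> f i summable_on A"
  shows "(\<Sum>\<^sub>\<infinity>x\<in>A. \<Sum>i\<in>I. f i x) = (\<Sum>i\<in>I. \<Sum>\<^sub>\<infinity>x\<in>A. f i x)"
  by (rule infsumI[OF has_sum_sum_real[OF assms(1) has_sum_infsum[OF assms(2)]]])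

lemma grad_prod_summable: "l2 u \<Longrightarrow> l2 v \<Longrightarrow> grad_prod u v summable_on UNIV"
  unfolding grad_prod_eq[abs_def]
  by (intro summable_on_cmult_right summable_on_sum_real l2_mult_summable l2_step_diff) auto

lemma Dir_form_eq: "l2 u \<Longrightarrow> l2 v \<Longrightarrow> Dir_form u v = 1/2 * (\<Sum>d\<in>unit_steps. ip (step_diff d u) (step_diff d v))"
  unfolding Dir_form_def grad_prod_eq ip_def infsum_cmult_right'
  by (subst infsum_sum_real) (auto intro: l2_mult_summable l2_step_diff)

lemma Dir_form_tendsto:
  assumes "l2_conv U u" "l2_conv V v" shows "(\<lambda>n. Dir_form (U n) (V n)) \<longlonglongrightarrow> Dir_form u v"
proof -
  have "(\<lambda>n. 1/2 * (\<Sum>d\<in>unit_steps. ip (step_diff d (U n)) (step_diff d (V n)))) \<longlonglongrightarrow> 1/2 * (\<Sum>d\<in>unit_steps. ip (step_diff d u) (step_diff d v))"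
    by (rule tendsto_mult[OF tendsto_const tendsto_sum[OF ip_tendsto[OF assms[THEN l2_conv_step_diff]]]])
  then show ?thesis unfolding Dir_form_eq[OF assms[THEN l2_convD(1)]] Dir_form_eq[OF assms[THEN l2_convD(2)]] .
qed

lemma Dir_form_commute: "Dir_form u v = Dir_form v u"
  by (simp add: Dir_form_def grad_prod_def mult.commute)

lemma Dir_form_add_right:
  assumes "l2 u" "l2 v" "l2 w" shows "Dir_form u (\<lambda>x. v x + w x) = Dir_form u v + Dir_form u w"
proof -
  have "step_diff d (\<lambda>x. v x + w x) = (\<lambda>x. step_diff d v x + step_diff d w x)" for d by (auto simp: step_diff_def)
  then have "ip (step_diff d u) (step_diff d (\<lambda>x. v x + w x)) = ip (step_diff d u) (step_diff d v) + ip (step_diff d u) (step_diff d w)" for d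
    by (simp only: ip_add_right[OF assms(2,3,1)[THEN l2_step_diff]])
  then show ?thesis
    unfolding Dir_form_eq[OF assms(1,2)] Dir_form_eq[OF assms(1,3)] Dir_form_eq[OF assms(1) l2_add[OF assms(2,3)]]
    by (simp add: sum.distrib)
qed

lemma Dir_form_scale_right: "Dir_form u (\<lambda>x. c * v x) = c * Dir_form u v"
proof -
  have e: "(u y - u x) * (c * v y - c * v x) = c * ((u y - u x) * (v y - v x))" for x y
    by (simp add: algebra_simps)
  have "grad_prod u (\<lambda>x. c * v x) x = c * grad_prod u v x" for x
    unfolding grad_prod_def e sum_distrib_left[symmetric] by simp
  then show ?thesis by (simp add: Dir_form_def infsum_cmult_right')
qed

lemma Dir_form_add_left:
  assumes "l2 u" "l2 v" "l2 w" shows "Dir_form (\<lambda>x. v x + w x) u = Dir_form v u + Dir_form w u"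
  using Dir_form_add_right[OF assms] by (simp add: Dir_form_commute)

lemma Dir_form_scale_left: "Dir_form (\<lambda>x. c * v x) u = c * Dir_form v u"
  using Dir_form_scale_right[of u c v] by (simp add: Dir_form_commute)

lemma Dir_form_self_nonneg: "0 \<le> Dir_form u u"
  unfolding Dir_form_def grad_prod_def by (rule infsum_nonneg) (simp add: sum_nonneg)

text \<open>Positive and negative part are both nondecreasing functions of \<open>u\<close>, so their increments
  have the same sign.\<close>
lemma Dir_form_pos_neg_nonneg: "0 \<le> Dir_form (upos u) (uneg u)"
proof -
  have "0 \<le> (upos u y - upos u x) * (uneg u y - uneg u x)" for x y
    unfolding upos_def uneg_def
    by (cases "u x \<le> u y") (auto intro!: mult_nonneg_nonneg mult_nonpos_nonpos)
  then show ?thesis unfolding Dir_form_def grad_prod_def by (intro infsum_nonneg) (simp add: sum_nonneg)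
qed

section \<open>Finitely supported approximation and membership in \<open>H1\<close>\<close>

lemma l2_finite_approx:
  fixes u :: "'a::countable \<Rightarrow> real"
  assumes "l2 u" obtains \<phi> where "\<And>n. finite {x. \<phi> n x \<noteq> 0}" "l2_conv \<phi> u"
proof -
  define F where "F n = {x::'a. to_nat x < n}" for n :: nat
  have finF: "finite (F n)" for n
    by (rule finite_imageD[of to_nat]) (auto simp: F_def inj_on_def intro: finite_subset[of _ "{..<n}"])
  define \<phi> where "\<phi> n x = (if x \<in> F n then u x else 0)" for n x
  \<comment> \<open>The initial segments of an enumeration eventually contain any given finite set,
    so the limit over finite subsets that defines \<open>infsum\<close> may be taken along this
    sequence.\<close>
  have lim: "filterlim F (finite_subsets_at_top UNIV) sequentially"
    unfolding filterlim_finite_subsets_at_top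
  proof (intro allI impI)
    fix X :: "'a set" assume "finite X \<and> X \<subseteq> UNIV"
    then obtain N where N: "\<And>x. x \<in> X \<Longrightarrow> to_nat x < N"
      using finite_nat_set_iff_bounded[of "to_nat ` X"] by auto
    show "\<forall>\<^sub>F n in sequentially. finite (F n) \<and> X \<subseteq> F n \<and> F n \<subseteq> UNIV"
    proof (rule eventually_sequentiallyI[of N], intro conjI subset_UNIV finF subsetI)
      fix n x assume "N \<le> n" "x \<in> X"
      then show "x \<in> F n" using N[of x] by (simp add: F_def)
    qed
  qed
  have l: "l2 (\<phi> n)" for n by (rule l2_dominated[OF assms]) (simp add: \<phi>_def)
  have e: "ip (\<lambda>x. \<phi> n x - u x) (\<lambda>x. \<phi> n x - u x) = ip u u - (\<Sum>x\<in>F n. u x * u x)" for n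
  proof -
    have "(\<lambda>x. (\<phi> n x - u x) * (\<phi> n x - u x)) = (\<lambda>x. u x * u x - (if x \<in> F n then u x * u x else 0))"
      by (auto simp: \<phi>_def)
    moreover have "((\<lambda>x. if x \<in> F n then u x * u x else 0) has_sum (\<Sum>x\<in>F n. u x * u x)) UNIV"
      by (rule has_sum_finite_neutralI[OF finF]) (auto intro: sum.cong)
    ultimately show ?thesis unfolding ip_def
      by (simp add: infsum_minus_real l2_mult_summable assms has_sum_imp_summable infsumI)
  qed
  have "(\<lambda>n. \<Sum>x\<in>F n. u x * u x) \<longlonglongrightarrow> ip u u"
    unfolding ip_def by (rule filterlim_compose[OF infsum_tendsto lim]) (intro l2_mult_summable assms)
  then have "(\<lambda>n. ip u u - (\<Sum>x\<in>F n. u x * u x)) \<longlonglongrightarrow> ip u u - ip u u" by (intro tendsto_intros)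
  then have c: "l2_conv \<phi> u" unfolding l2_conv_def e using l assms by simp
  have "finite {x. \<phi> n x \<noteq> 0}" for n by (rule finite_subset[OF _ finF[of n]]) (auto simp: \<phi>_def)
  then show ?thesis using c by (rule that)
qed

lemma h1_summable:
  assumes "l2 u" shows "(\<lambda>x. grad_sq u x + (u x)^2) summable_on UNIV"
  unfolding grad_sq_eq
  by (intro summable_on_add grad_prod_summable assms) (use assms in \<open>simp add: l2_def\<close>)

text \<open>The gradient is bounded on l2, so truncations that converge in l2 converge in the
  \<open>H1\<close> norm as well. Membership in \<open>Hsp\<close> thereby reduces to weighted
  summability.\<close>

lemma l2_imp_H1:
  assumes "l2 u" shows "u \<in> H1"
proof -
  obtain \<phi> where \<phi>: "\<And>n. finite {x. \<phi> n x \<noteq> 0}" "l2_conv \<phi> u" using l2_finite_approx[OF assms] by metis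
  have l: "l2 (\<lambda>x. \<phi> n x - u x)" for n by (intro l2_diff l2_convD[OF \<phi>(2)])
  have c: "l2_conv (\<lambda>n x. \<phi> n x - u x) (\<lambda>_. 0)" using l2_conv_diff[OF \<phi>(2) l2_conv_const[OF assms]] by simp
  have "h1norm_sq (\<lambda>x. \<phi> n x - u x) = Dir_form (\<lambda>x. \<phi> n x - u x) (\<lambda>x. \<phi> n x - u x) + ip (\<lambda>x. \<phi> n x - u x) (\<lambda>x. \<phi> n x - u x)" for n
    unfolding h1norm_sq_def Dir_form_def ip_def grad_sq_eq power2_eq_square
    by (intro infsum_add grad_prod_summable l2_mult_summable l)
  moreover have "(\<lambda>n. Dir_form (\<lambda>x. \<phi> n x - u x) (\<lambda>x. \<phi> n x - u x) + ip (\<lambda>x. \<phi> n x - u x) (\<lambda>x. \<phi> n x - u x))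
      \<longlonglongrightarrow> Dir_form (\<lambda>_. 0) (\<lambda>_. 0) + ip (\<lambda>_::lat. 0) (\<lambda>_. 0)"
    by (rule tendsto_add[OF Dir_form_tendsto[OF c c] ip_tendsto[OF c c]])
  ultimately have "(\<lambda>n. h1norm_sq (\<lambda>x. \<phi> n x - u x)) \<longlonglongrightarrow> 0"
    by (simp add: Dir_form_def grad_prod_def ip_def)
  then show ?thesis unfolding H1_def mem_Collect_eq by (intro conjI exI[of _ \<phi>] allI \<phi>(1) h1_summable assms l)
qed

section \<open>Calculus of the power nonlinearity\<close>

lemma odd_powr_has_derivative:
  fixes q r :: real assumes "q > 0"
  shows "((\<lambda>r. \<bar>r\<bar> powr q * r) has_real_derivative (q + 1) * \<bar>r\<bar> powr q) (at r)"
proof (cases r "0::real" rule: linorder_cases)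
  case greater
  have "((\<lambda>r. r powr (q + 1)) has_real_derivative (q + 1) * \<bar>r\<bar> powr q) (at r)"
    using greater by (auto intro!: derivative_eq_intros)
  then show ?thesis
    by (rule has_field_derivative_transform_within_open[OF _ open_greaterThan[of 0]])
       (use greater in \<open>auto simp: powr_add\<close>)
next
  case less
  have "((\<lambda>r. - ((- r) powr (q + 1))) has_real_derivative (q + 1) * \<bar>r\<bar> powr q) (at r)"
    using less by (auto intro!: derivative_eq_intros)
  then show ?thesis
    by (rule has_field_derivative_transform_within_open[OF _ open_lessThan[of 0]])
       (use less in \<open>auto simp: powr_add\<close>)
next
  case equal
  \<comment> \<open>At the origin the difference quotient is \<open>\<bar>h\<bar> powr q\<close>,
    and \<open>q > 0\<close> sends it to 0.\<close>
  have "((\<lambda>h::real. \<bar>h\<bar> powr q) \<longlongrightarrow> 0) (at 0)"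
    by (rule tendsto_zero_powrI[OF _ tendsto_const _ assms]) (auto intro!: tendsto_eq_intros)
  then have "((\<lambda>h::real. (\<bar>h\<bar> powr q * h) / h) \<longlongrightarrow> 0) (at 0)"
    by (rule Lim_transform_eventually) (auto simp: eventually_at_filter)
  then show ?thesis using equal assms by (simp add: DERIV_def)
qed

text \<open>Valid at \<open>r = 0\<close> for every \<open>p\<close> because
  \<open>0 powr x = 0\<close>. The factorisation exhibits |u|^p as a product of two l2
  functions.\<close>

lemma abs_powr_eq: "\<bar>r\<bar> powr p = \<bar>r\<bar> powr (p - 2) * r * r" for r p :: real
proof -
  have "\<bar>r\<bar> powr (p - 2) * (r * r) = \<bar>r\<bar> powr (p - 2) * (\<bar>r\<bar> powr 2)"
    by (cases "r = 0") (simp_all add: powr_numeral power2_eq_square)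
  also have "\<dots> = \<bar>r\<bar> powr p" by (simp only: powr_add[symmetric]) simp
  finally show ?thesis by (simp add: mult.assoc)
qed

lemma abs_powr_has_derivative:
  fixes p r :: real assumes "p > 2"
  shows "((\<lambda>r. \<bar>r\<bar> powr p) has_real_derivative p * (\<bar>r\<bar> powr (p - 2) * r)) (at r)"
proof -
  have "((\<lambda>r. (\<bar>r\<bar> powr (p - 2) * r) * r) has_real_derivative p * (\<bar>r\<bar> powr (p - 2) * r)) (at r)"
    by (rule DERIV_cong[OF DERIV_mult[OF odd_powr_has_derivative DERIV_ident]]) (use assms in \<open>auto simp: algebra_simps\<close>)
  then show ?thesis unfolding abs_powr_eq[symmetric] .
qed

lemma odd_powr_lipschitz:
  fixes q M :: real assumes "q > 0" "M \<ge> 0"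
  shows "\<exists>L. \<forall>r r'. \<bar>r\<bar> \<le> M \<longrightarrow> \<bar>r'\<bar> \<le> M \<longrightarrow> \<bar>\<bar>r\<bar> powr q * r - \<bar>r'\<bar> powr q * r'\<bar> \<le> L * \<bar>r - r'\<bar>"
proof (intro exI[of _ "(q + 1) * M powr q"] allI impI)
  fix r r' assume "\<bar>r\<bar> \<le> M" "\<bar>r'\<bar> \<le> M"
  then have "norm (\<bar>r\<bar> powr q * r - \<bar>r'\<bar> powr q * r') \<le> (q + 1) * M powr q * norm (r - r')"
    by (intro field_differentiable_bound[of "{-M..M}" _ "\<lambda>z. (q + 1) * \<bar>z\<bar> powr q"])
       (use assms in \<open>auto intro!: has_field_derivative_at_within odd_powr_has_derivative mult_left_mono powr_mono2 simp: abs_mult\<close>)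
  then show "\<bar>\<bar>r\<bar> powr q * r - \<bar>r'\<bar> powr q * r'\<bar> \<le> (q + 1) * M powr q * \<bar>r - r'\<bar>" by simp
qed

text \<open>The intermediate point lies between \<open>v\<close> and \<open>z\<close>; the second
  conclusion records this without reference to their order, in the form in which convergence of both
  endpoints to a common limit passes to the intermediate point.\<close>

lemma abs_powr_mean_value:
  fixes p v z :: real assumes "p > 2"
  obtains \<xi> where "\<bar>v\<bar> powr p - \<bar>z\<bar> powr p = p * (\<bar>\<xi>\<bar> powr (p - 2) * \<xi>) * (v - z)"
    "\<And>w. \<bar>\<xi> - w\<bar> \<le> \<bar>v - w\<bar> + \<bar>z - w\<bar>"
proof -
  have d: "((\<lambda>r. \<bar>r\<bar> powr p) has_real_derivative p * (\<bar>r\<bar> powr (p - 2) * r)) (at r)" for r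
    by (rule abs_powr_has_derivative[OF assms])
  show ?thesis
  proof (cases v z rule: linorder_cases)
    case less
    from MVT2[OF less, of "\<lambda>r. \<bar>r\<bar> powr p", OF d] obtain \<xi> where
      "v < \<xi>" "\<xi> < z" "\<bar>z\<bar> powr p - \<bar>v\<bar> powr p = (z - v) * (p * (\<bar>\<xi>\<bar> powr (p - 2) * \<xi>))" by blast
    then show ?thesis by (intro that[of \<xi>]) (auto simp: algebra_simps)
  next
    case greater
    from MVT2[OF greater, of "\<lambda>r. \<bar>r\<bar> powr p", OF d] obtain \<xi> where
      "z < \<xi>" "\<xi> < v" "\<bar>v\<bar> powr p - \<bar>z\<bar> powr p = (v - z) * (p * (\<bar>\<xi>\<bar> powr (p - 2) * \<xi>))" by blast
    then show ?thesis by (intro that[of \<xi>]) (auto simp: algebra_simps)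
  qed (auto intro: that[of v])
qed

section \<open>The fibering map\<close>

lemma powr_Bernoulli:
  fixes y r :: real
  assumes "y \<ge> 0" "r \<ge> 1" shows "1 + r * (y - 1) \<le> y powr r"
proof (cases "y = 0")
  case True then show ?thesis using assms by simp
next
  case False
  then have "y > 0" using assms by simp
  define g where "g z = z powr r - 1 - r * (z - 1)" for z :: real
  have d: "(g has_real_derivative r * z powr (r - 1) - r) (at z)" if "z > 0" for z
    unfolding g_def using that by (auto intro!: derivative_eq_intros)
  have g1: "g 1 = 0" by (simp add: g_def)
  have "g y \<ge> 0"
  proof (cases "y \<ge> 1")
    case True
    have "g 1 \<le> g y"
    proof (rule DERIV_nonneg_imp_nondecreasing[OF True])
      fix z assume "1 \<le> z" "z \<le> y"
      then have "z powr (r - 1) \<ge> 1" using assms by (simp add: ge_one_powr_ge_zero)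
      then have "r * z powr (r - 1) - r \<ge> 0" using assms mult_left_mono[of 1 "z powr (r - 1)" r] by simp
      then show "\<exists>D. (g has_real_derivative D) (at z) \<and> 0 \<le> D" using d[of z] \<open>1 \<le> z\<close> by fastforce
    qed
    then show ?thesis using g1 by simp
  next
    case False
    have "g y \<ge> g 1"
    proof (rule DERIV_nonpos_imp_nonincreasing[of y 1])
      show "y \<le> 1" using False by simp
      fix z assume z: "y \<le> z" "z \<le> 1"
      then have "z powr (r - 1) \<le> 1" using assms \<open>y > 0\<close> by (simp add: powr_le1)
      then have "r * z powr (r - 1) - r \<le> 0" using assms mult_left_mono[of "z powr (r - 1)" 1 r] by simp
      then show "\<exists>D. (g has_real_derivative D) (at z) \<and> D \<le> 0" using d[of z] z \<open>y > 0\<close> by fastforce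
    qed
    then show ?thesis using g1 by simp
  qed
  then show ?thesis by (simp add: g_def)
qed

text \<open>As a function of \<open>s powr p\<close>, the monomial \<open>s ^ k\<close> is concave
  when \<open>k \<le> p\<close>, and the right side is its tangent at \<open>s = 1\<close>. It is
  obtained from Bernoulli's inequality with base \<open>s ^ k\<close> and exponent
  \<open>p / k\<close>.\<close>

lemma power_le_powr:
  fixes s p :: real
  assumes "s \<ge> 0" "0 < k" "real k \<le> p" shows "s ^ k \<le> 1 + (k / p) * (s powr p - 1)"
proof -
  have p: "p > 0" using assms by linarith
  have "1 + (p / k) * (s ^ k - 1) \<le> (s ^ k) powr (p / k)"
    by (rule powr_Bernoulli) (use assms in \<open>auto simp: field_simps\<close>)
  also have "(s ^ k) powr (p / k) = s powr p"
    using assms by (cases "s = 0") (auto simp: powr_powr simp flip: powr_realpow)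
  finally have "(k / p) * ((p / k) * (s ^ k - 1)) \<le> (k / p) * (s powr p - 1)"
    using assms p by (intro mult_left_mono) auto
  then show ?thesis using assms p by simp
qed

text \<open>The energy of s u^+ + t u^- with its coefficients as bare numbers: \<open>V1\<close>,
  \<open>V2\<close> are the potential terms of the two parts, \<open>D1\<close>, \<open>D2\<close>,
  \<open>E\<close> their Dirichlet form, \<open>B11\<close>, \<open>B12\<close>, \<open>B22\<close>
  the nonlocal form of their p-th powers. Disjoint supports leave no mixed potential term. Keeping
  the coefficients free later allows \<open>V1\<close>, \<open>V2\<close> to be replaced by limits
  that belong to no function.\<close>

definition fiber :: "real \<Rightarrow> real \<Rightarrow> real \<Rightarrow> real \<Rightarrow> real \<Rightarrow> real \<Rightarrow> real \<Rightarrow> real \<Rightarrow> real \<Rightarrow> real \<Rightarrow> real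
    \<Rightarrow> real \<Rightarrow> real \<Rightarrow> real" where
  "fiber a b p V1 V2 D1 D2 E B11 B12 B22 s t =
     1/2 * (a * (s^2 * D1 + t^2 * D2 + 2 * s * t * E) + s^2 * V1 + t^2 * V2)
     + b/4 * (s^2 * D1 + t^2 * D2 + 2 * s * t * E)^2
     - 1/(2*p) * ((s powr p)^2 * B11 + 2 * s powr p * t powr p * B12 + (t powr p)^2 * B22)"

text \<open>The partial derivative of \<open>fiber\<close> in its first variable. The other partial
  derivative is the same expression with the indices 1 and 2 and the two variables
  exchanged.\<close>

definition fiber_slope :: "real \<Rightarrow> real \<Rightarrow> real \<Rightarrow> real \<Rightarrow> real \<Rightarrow> real \<Rightarrow> real \<Rightarrow> real \<Rightarrow> real
    \<Rightarrow> real \<Rightarrow> real \<Rightarrow> real" where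
  "fiber_slope a b p V1 D1 D2 E B11 B12 s t =
     a * (s * D1 + t * E) + s * V1 + b * (s^2 * D1 + t^2 * D2 + 2 * s * t * E) * (s * D1 + t * E)
     - s powr (p - 1) * (s powr p * B11 + t powr p * B12)"

lemma fiber_swap:
  "fiber a b p V1 V2 D1 D2 E B11 B12 B22 s t = fiber a b p V2 V1 D2 D1 E B22 B12 B11 t s"
  unfolding fiber_def by (simp add: algebra_simps)

lemma fiber_has_derivative:
  assumes "s > 0" "p > 0"
  shows "((\<lambda>s. fiber a b p V1 V2 D1 D2 E B11 B12 B22 s t)
           has_real_derivative fiber_slope a b p V1 D1 D2 E B11 B12 s t) (at s)"
  unfolding fiber_def fiber_slope_def
  using assms
  apply (auto intro!: derivative_eq_intros)
  apply (simp add: field_simps power2_eq_square)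
  done

text \<open>In the coordinates \<open>s powr p\<close>, \<open>t powr p\<close> the fibering map is concave: all monomials of degree
  at most four become concave because \<open>p > 4\<close>, and the nonlocal term becomes a quadratic form. This is the
  tangent plane inequality at \<open>(1, 1)\<close>, with the quadratic form as remainder.\<close>
lemma fiber_tangent_bound:
  fixes a b p :: real
  assumes "p > 4" "a \<ge> 0" "b \<ge> 0" "V1 \<ge> 0" "V2 \<ge> 0" "D1 \<ge> 0" "D2 \<ge> 0" "E \<ge> 0" "s \<ge> 0" "t \<ge> 0"
  defines "x \<equiv> s powr p - 1" and "y \<equiv> t powr p - 1"
  shows "fiber a b p V1 V2 D1 D2 E B11 B12 B22 s t \<le> fiber a b p V1 V2 D1 D2 E B11 B12 B22 1 1
     + x / p * fiber_slope a b p V1 D1 D2 E B11 B12 1 1 + y / p * fiber_slope a b p V2 D2 D1 E B22 B12 1 1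
     - 1/(2*p) * (B11 * x^2 + 2 * B12 * x * y + B22 * y^2)"
proof -
  have s2: "s^2 \<le> 1 + 2 * (x/p)" and t2: "t^2 \<le> 1 + 2 * (y/p)"
    and s4: "s^4 \<le> 1 + 4 * (x/p)" and t4: "t^4 \<le> 1 + 4 * (y/p)"
    using power_le_powr[of s 2 p] power_le_powr[of t 2 p] power_le_powr[of s 4 p] power_le_powr[of t 4 p] assms
    by (auto simp: x_def y_def)
  define X Y where "X = x/p" and "Y = y/p"
  note m = s2[folded X_def] t2[folded Y_def] s4[folded X_def] t4[folded Y_def]
  \<comment> \<open>Mixed monomials are reduced to pure powers by the arithmetic-geometric mean
    inequality. In each case s^i t^j is bounded by 1 + i X + j Y, its tangent plane at (1,
    1).\<close>
  have q1: "s * t \<le> 1 + X + Y" using m sum_squares_bound[of s t] by (simp add: power2_eq_square)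
  have q2: "s^2 * t^2 \<le> 1 + 2 * X + 2 * Y" using m sum_squares_bound[of "s^2" "t^2"] by simp
  have q3: "s^3 * t \<le> 1 + 3 * X + Y"
  proof -
    have "s^3 * t = s^2 * (s * t)" by (simp add: power2_eq_square power3_eq_cube)
    also have "\<dots> \<le> s^2 * ((s^2 + t^2)/2)" using sum_squares_bound[of s t] by (intro mult_left_mono) auto
    also have "\<dots> = s^4/2 + s^2 * t^2 / 2" by (simp add: power2_eq_square power4_eq_xxxx algebra_simps)
    finally show ?thesis using m sum_squares_bound[of "s^2" "t^2"] by simp
  qed
  have q4: "s * t^3 \<le> 1 + X + 3 * Y"
  proof -
    have "s * t^3 = t^2 * (s * t)" by (simp add: power2_eq_square power3_eq_cube)
    also have "\<dots> \<le> t^2 * ((s^2 + t^2)/2)" using sum_squares_bound[of s t] by (intro mult_left_mono) auto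
    also have "\<dots> = t^4/2 + s^2 * t^2 / 2" by (simp add: power2_eq_square power4_eq_xxxx algebra_simps)
    finally show ?thesis using m sum_squares_bound[of "s^2" "t^2"] by simp
  qed
  have quad: "s^2 * D1 + t^2 * D2 + 2 * s * t * E \<le> (1 + 2 * X) * D1 + (1 + 2 * Y) * D2 + (1 + X + Y) * (2 * E)"
    using mult_right_mono[OF m(1), of D1] mult_right_mono[OF m(2), of D2] mult_right_mono[OF q1, of "2 * E"] assms
    by (simp add: mult_ac)
  have quart: "(s^2 * D1 + t^2 * D2 + 2 * s * t * E)^2 \<le>
     (1 + 4 * X) * D1^2 + (1 + 4 * Y) * D2^2 + (1 + 2 * X + 2 * Y) * (4 * E^2 + 2 * D1 * D2)
     + (1 + 3 * X + Y) * (4 * D1 * E) + (1 + X + 3 * Y) * (4 * D2 * E)"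
  proof -
    \<comment> \<open>All coefficients of this expansion are nonnegative because \<open>D1\<close>,
      \<open>D2\<close> and \<open>E\<close> are, so each monomial may be replaced by its bound; the
      sign of the cross term \<open>E\<close> enters here.\<close>
    have "(s^2 * D1 + t^2 * D2 + 2 * s * t * E)^2 =
      s^4 * D1^2 + t^4 * D2^2 + (s^2 * t^2) * (4 * E^2 + 2 * D1 * D2) + (s^3 * t) * (4 * D1 * E) + (s * t^3) * (4 * D2 * E)"
      by algebra
    also have "\<dots> \<le> (1 + 4 * X) * D1^2 + (1 + 4 * Y) * D2^2 + (1 + 2 * X + 2 * Y) * (4 * E^2 + 2 * D1 * D2)
     + (1 + 3 * X + Y) * (4 * D1 * E) + (1 + X + 3 * Y) * (4 * D2 * E)"
      by (intro add_mono mult_right_mono m q2 q3 q4) (use assms in auto)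
    finally show ?thesis .
  qed
  have Xx: "x = p * X" "y = p * Y" using assms by (auto simp: X_def Y_def)
  have sx: "s powr p = 1 + p * X" "t powr p = 1 + p * Y" using Xx by (auto simp: x_def y_def)
  have e: "(b/4) * (s^2 * D1 + t^2 * D2 + 2 * s * t * E)^2 \<le> (b/4) * ((1 + 4 * X) * D1^2 + (1 + 4 * Y) * D2^2 + (1 + 2 * X + 2 * Y) * (4 * E^2 + 2 * D1 * D2)
     + (1 + 3 * X + Y) * (4 * D1 * E) + (1 + X + 3 * Y) * (4 * D2 * E))"
    by (rule mult_left_mono[OF quart]) (use assms in auto)
  have f: "1/2 * (a * (s^2 * D1 + t^2 * D2 + 2 * s * t * E) + s^2 * V1 + t^2 * V2) \<le>
     1/2 * (a * ((1 + 2 * X) * D1 + (1 + 2 * Y) * D2 + (1 + X + Y) * (2 * E)) + (1 + 2 * X) * V1 + (1 + 2 * Y) * V2)"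
    by (intro mult_left_mono add_mono mult_right_mono m quad) (use assms in auto)
  \<comment> \<open>The bounds are affine in \<open>X\<close> and \<open>Y\<close>, and the nonlocal
    term is exactly quadratic in them, so expansion about (1, 1) is an identity. The slopes appear
    because each monomial was replaced by its tangent plane.\<close>
  have eq: "1/2 * (a * ((1 + 2 * X) * D1 + (1 + 2 * Y) * D2 + (1 + X + Y) * (2 * E)) + (1 + 2 * X) * V1 + (1 + 2 * Y) * V2)
    + (b/4) * ((1 + 4 * X) * D1^2 + (1 + 4 * Y) * D2^2 + (1 + 2 * X + 2 * Y) * (4 * E^2 + 2 * D1 * D2)
     + (1 + 3 * X + Y) * (4 * D1 * E) + (1 + X + 3 * Y) * (4 * D2 * E))
    - 1/(2*p) * ((1 + p * X)^2 * B11 + 2 * (1 + p * X) * (1 + p * Y) * B12 + (1 + p * Y)^2 * B22)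
    = fiber a b p V1 V2 D1 D2 E B11 B12 B22 1 1
     + X * fiber_slope a b p V1 D1 D2 E B11 B12 1 1 + Y * fiber_slope a b p V2 D2 D1 E B22 B12 1 1
     - 1/(2*p) * (B11 * (p * X)^2 + 2 * B12 * (p * X) * (p * Y) + B22 * (p * Y)^2)"
    unfolding fiber_def fiber_slope_def using assms(1) by (simp add: field_simps power2_eq_square)
  have xp: "p * X / p = X" "p * Y / p = Y" using assms(1) by auto
  show ?thesis
    unfolding Xx fiber_def[of a b p V1 V2 D1 D2 E B11 B12 B22 s t] sx xp using e f eq by linarith
qed

text \<open>The superlevel set of \<open>(1, 1)\<close> is bounded, so a maximum exists; it is interior because near an axis
  the term \<open>s^2 * V1\<close> beats the nonlocal terms of order \<open>s powr p\<close>.\<close>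
lemma fiber_has_max:
  fixes a b p c :: real
  assumes p: "p > 4" and nn: "a \<ge> 0" "b \<ge> 0" "V1 > 0" "V2 > 0" "D1 \<ge> 0" "D2 \<ge> 0" "E \<ge> 0"
    and c: "c > 0" and B: "\<And>x y. c * (x^2 + y^2) \<le> B11 * x^2 + 2 * B12 * x * y + B22 * y^2"
  defines "F \<equiv> fiber a b p V1 V2 D1 D2 E B11 B12 B22"
  obtains s t where "s > 0" "t > 0" "\<And>s' t'. s' \<ge> 0 \<Longrightarrow> t' \<ge> 0 \<Longrightarrow> F s' t' \<le> F s t"
    "fiber_slope a b p V1 D1 D2 E B11 B12 s t = 0" "fiber_slope a b p V2 D2 D1 E B22 B12 t s = 0"
proof -
  define S1 S2 where "S1 = fiber_slope a b p V1 D1 D2 E B11 B12 1 1" and "S2 = fiber_slope a b p V2 D2 D1 E B22 B12 1 1"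
  \<comment> \<open>Chosen so that for \<open>r > K\<close>, with \<open>r\<close> the larger of
    \<open>\<bar>x\<bar>\<close> and \<open>\<bar>y\<bar>\<close>, the remainder of size
    \<open>c * r^2 / 2\<close> beats the linear part, which is at most
    \<open>r * (\<bar>S1\<bar> + \<bar>S2\<bar>)\<close>.\<close>
  define K where "K = 4 * (\<bar>S1\<bar> + \<bar>S2\<bar>) / c + 1"
  have K: "K \<ge> 1" using c by (simp add: K_def)
  have far: "F s t < F 1 1" if st: "s \<ge> 0" "t \<ge> 0" and far: "s powr p - 1 > K \<or> t powr p - 1 > K" for s t
  proof -
    define x y where "x = s powr p - 1" and "y = t powr p - 1"
    define r where "r = max \<bar>x\<bar> \<bar>y\<bar>"
    have r: "r > K" "\<bar>x\<bar> \<le> r" "\<bar>y\<bar> \<le> r" using far by (auto simp: r_def x_def y_def)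
    have "r^2 \<le> x^2 + y^2" unfolding r_def by (simp add: max_def)
    then have l: "c * r^2 \<le> B11 * x^2 + 2 * B12 * x * y + B22 * y^2"
      using B[of x y] mult_left_mono[of "r^2" "x^2 + y^2" c] c by linarith
    have u: "x * S1 + y * S2 \<le> r * (\<bar>S1\<bar> + \<bar>S2\<bar>)"
    proof -
      have "x * S1 \<le> r * \<bar>S1\<bar>" "y * S2 \<le> r * \<bar>S2\<bar>"
        using r mult_right_mono[of "\<bar>x\<bar>" r "\<bar>S1\<bar>"] mult_right_mono[of "\<bar>y\<bar>" r "\<bar>S2\<bar>"]
          abs_ge_self[of "x * S1"] abs_ge_self[of "y * S2"] by (auto simp: abs_mult)
      then show ?thesis by (simp add: algebra_simps)
    qed
    have v: "r * (\<bar>S1\<bar> + \<bar>S2\<bar>) < 1/2 * (c * r^2)"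
    proof -
      have "\<bar>S1\<bar> + \<bar>S2\<bar> = c * (K - 1) / 4" using c by (simp add: K_def)
      also have "\<dots> < c * r / 2"
        using mult_strict_left_mono[of "K - 1" "2 * r" c] r K c by (simp add: mult.commute)
      finally have "r * (\<bar>S1\<bar> + \<bar>S2\<bar>) < r * (c * r / 2)" using r K by (intro mult_strict_left_mono) auto
      then show ?thesis by (simp add: power2_eq_square mult_ac)
    qed
    have "x * S1 + y * S2 - 1/2 * (B11 * x^2 + 2 * B12 * x * y + B22 * y^2) < 0"
      using order.strict_trans2[OF order.strict_trans1[OF u v] mult_left_mono[OF l, of "1/2"]] by simp
    then have "(x * S1 + y * S2 - 1/2 * (B11 * x^2 + 2 * B12 * x * y + B22 * y^2)) / p < 0"
      using p by (simp add: divide_neg_pos)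
    moreover have "F s t \<le> F 1 1 + x / p * S1 + y / p * S2 - 1/(2*p) * (B11 * x^2 + 2 * B12 * x * y + B22 * y^2)"
      unfolding F_def S1_def S2_def x_def y_def by (rule fiber_tangent_bound) (use assms st in auto)
    moreover have "x / p * S1 + y / p * S2 - 1/(2*p) * (B11 * x^2 + 2 * B12 * x * y + B22 * y^2)
       = (x * S1 + y * S2 - 1/2 * (B11 * x^2 + 2 * B12 * x * y + B22 * y^2)) / p"
      by (simp add: diff_divide_distrib add_divide_distrib)
    ultimately show ?thesis by linarith
  qed
  \<comment> \<open>For \<open>r > M\<close> one has \<open>r powr p \<ge> r > K + 1\<close>, so
    outside the square of side \<open>M\<close> the value is already below that at (1, 1).\<close>
  define M where "M = 2 + K"
  have M: "r powr p - 1 > K" if "r > M" for r :: real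
  proof -
    have "r > 1" using that K by (simp add: M_def)
    then have "r powr 1 \<le> r powr p" using p by (intro powr_mono) auto
    then show ?thesis using that \<open>r > 1\<close> by (simp add: M_def)
  qed
  have cont: "continuous_on ({0..M} \<times> {0..M}) (\<lambda>z. F (fst z) (snd z))"
    unfolding F_def fiber_def using p by (auto intro!: continuous_intros continuous_on_powr')
  have "compact ({0..M} \<times> {0..M})" "{0..M} \<times> {0..M} \<noteq> {}"
    using K by (auto simp: M_def intro!: compact_Times)
  from continuous_attains_sup[OF this cont] obtain s t where
    st: "0 \<le> s" "s \<le> M" "0 \<le> t" "t \<le> M" and mx: "\<And>s' t'. s' \<in> {0..M} \<Longrightarrow> t' \<in> {0..M} \<Longrightarrow> F s' t' \<le> F s t"
    by fastforce
  have glob: "F s' t' \<le> F s t" if "s' \<ge> 0" "t' \<ge> 0" for s' t'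
  proof (cases "s' \<le> M \<and> t' \<le> M")
    case True then show ?thesis using mx that by auto
  next
    case False
    then have "F s' t' < F 1 1" using far[OF that] M by force
    moreover have "F 1 1 \<le> F s t" using mx[of 1 1] K by (auto simp: M_def)
    ultimately show ?thesis by linarith
  qed
  \<comment> \<open>Stated for arbitrary coefficients so that the second axis follows by
    \<open>fiber_swap\<close>.\<close>
  have axis: "\<exists>s>0. fiber a b p V1 V2 D1 D2 E B11 B12 B22 s t > fiber a b p V1 V2 D1 D2 E B11 B12 B22 0 t"
    if "V1 > 0" "D1 \<ge> 0" "D2 \<ge> 0" "t \<ge> 0" for V1 V2 D1 D2 B11 B22 t
  proof -
    \<comment> \<open>For \<open>s \<le> 1\<close> the nonlocal part depending on \<open>s\<close>
      is at most \<open>s powr p * (L - 1)\<close>, hence at most \<open>s^3 * L\<close>; the choice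
      \<open>s \<le> V1 / (4 * L)\<close> makes this at most half of the gain
      \<open>s^2 * V1 / 2\<close>.\<close>
    define L where "L = 1/(2*p) * (\<bar>B11\<bar> + 2 * t powr p * \<bar>B12\<bar>) + 1"
    have L: "L > 0" using p by (simp add: L_def add_nonneg_pos)
    define s where "s = min 1 (V1 / (4 * L))"
    have s: "0 < s" "s \<le> 1" "s * L \<le> V1 / 4" using L that by (auto simp: s_def min_def field_simps)
    have sp: "s powr p \<le> s^3"
    proof -
      have "s powr p \<le> s powr (real 3)" by (rule powr_mono') (use s p in auto)
      then show ?thesis using s by (simp add: powr_realpow)
    qed
    have sp1: "(s powr p)^2 \<le> s powr p" using s p by (simp add: power2_eq_square mult_left_le powr_le1)
    have "1/(2*p) * ((s powr p)^2 * B11 + 2 * s powr p * t powr p * B12)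
       \<le> 1/(2*p) * (s powr p * \<bar>B11\<bar> + s powr p * (2 * t powr p * \<bar>B12\<bar>))"
    proof (intro mult_left_mono add_mono)
      have "(s powr p)^2 * B11 \<le> (s powr p)^2 * \<bar>B11\<bar>" by (intro mult_left_mono) auto
      also have "\<dots> \<le> s powr p * \<bar>B11\<bar>" by (intro mult_right_mono sp1) auto
      finally show "(s powr p)^2 * B11 \<le> s powr p * \<bar>B11\<bar>" .
      have "(2 * s powr p * t powr p) * B12 \<le> (2 * s powr p * t powr p) * \<bar>B12\<bar>" by (intro mult_left_mono) auto
      then show "2 * s powr p * t powr p * B12 \<le> s powr p * (2 * t powr p * \<bar>B12\<bar>)" by (simp only: mult_ac)
    qed (use p in auto)
    also have "\<dots> = s powr p * (L - 1)" unfolding L_def by (simp add: algebra_simps)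
    also have "\<dots> \<le> s^3 * L"
      by (rule order_trans[OF mult_left_mono[of _ L] mult_right_mono[OF sp]]) (use L in auto)
    also have "\<dots> = s^2 * (s * L)" by (simp add: power2_eq_square power3_eq_cube)
    also have "\<dots> \<le> s^2 * (V1/4)" by (intro mult_left_mono s) auto
    also have "\<dots> < s^2 * V1 / 2" using s that by simp
    finally have nl: "1/(2*p) * ((s powr p)^2 * B11 + 2 * s powr p * t powr p * B12) < s^2 * V1 / 2" .
    have g: "s^2 * D1 + t^2 * D2 + 2 * s * t * E \<ge> t^2 * D2" using s that nn by simp
    have g2: "(s^2 * D1 + t^2 * D2 + 2 * s * t * E)^2 \<ge> (t^2 * D2)^2" using g that by (intro power_mono) auto
    have h1: "a * (t^2 * D2) \<le> a * (s^2 * D1 + t^2 * D2 + 2 * s * t * E)" using g nn by (intro mult_left_mono) auto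
    have h2: "b/4 * (t^2 * D2)^2 \<le> b/4 * (s^2 * D1 + t^2 * D2 + 2 * s * t * E)^2" using g2 nn by (intro mult_left_mono) auto
    have h3: "fiber a b p V1 V2 D1 D2 E B11 B12 B22 0 t = 1/2 * (a * (t^2 * D2)) + t^2 * V2 / 2 + b/4 * (t^2 * D2)^2 - 1/(2*p) * ((t powr p)^2 * B22)"
      by (simp add: fiber_def algebra_simps)
    have h4: "fiber a b p V1 V2 D1 D2 E B11 B12 B22 s t = 1/2 * (a * (s^2 * D1 + t^2 * D2 + 2 * s * t * E)) + s^2 * V1 / 2 + t^2 * V2 / 2
       + b/4 * (s^2 * D1 + t^2 * D2 + 2 * s * t * E)^2 - 1/(2*p) * ((s powr p)^2 * B11 + 2 * s powr p * t powr p * B12) - 1/(2*p) * ((t powr p)^2 * B22)"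
      by (simp add: fiber_def algebra_simps)
    have "fiber a b p V1 V2 D1 D2 E B11 B12 B22 0 t < fiber a b p V1 V2 D1 D2 E B11 B12 B22 s t"
      unfolding h3 h4 using mult_left_mono[OF h1, of "1/2"] h2 nl by argo
    then show ?thesis using s by blast
  qed
  have s0: "s > 0"
  proof (rule ccontr)
    assume "\<not> s > 0"
    then have "s = 0" using st by simp
    with axis[of V1 D1 D2 t V2 B11 B22] obtain s' where "s' > 0" "F s' t > F s t" using nn st by (auto simp: F_def)
    then show False using glob[of s' t] st by simp
  qed
  have t0: "t > 0"
  proof (rule ccontr)
    assume "\<not> t > 0"
    then have "t = 0" using st by simp
    with axis[of V2 D2 D1 s V1 B22 B11] obtain t' where "t' > 0" "F s t' > F s t" using nn st
      by (auto simp: F_def fiber_swap[of a b p V1])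
    then show False using glob[of s t'] st by simp
  qed
  have "fiber_slope a b p V1 D1 D2 E B11 B12 s t = 0"
    by (rule DERIV_local_max[OF fiber_has_derivative[OF s0, of p a b V1 V2 D1 D2 E B11 B12 B22 t] s0])
       (use p glob t0 in \<open>auto simp: F_def abs_less_iff\<close>)
  moreover have "fiber_slope a b p V2 D2 D1 E B22 B12 t s = 0"
    by (rule DERIV_local_max[OF fiber_has_derivative[OF t0, of p a b V2 V1 D2 D1 E B22 B12 B11 s] t0])
       (use p glob s0 in \<open>auto simp: F_def abs_less_iff fiber_swap[of a b p V1]\<close>)
  ultimately show ?thesis using that s0 t0 glob by blast
qed

section \<open>The energy functional on the Nehari fibers\<close>

lemma abs_powr_lipschitz:
  fixes p M :: real assumes "p > 2" "M \<ge> 0"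
  shows "\<exists>L. \<forall>r r'. \<bar>r\<bar> \<le> M \<longrightarrow> \<bar>r'\<bar> \<le> M \<longrightarrow> \<bar>\<bar>r\<bar> powr p - \<bar>r'\<bar> powr p\<bar> \<le> L * \<bar>r - r'\<bar>"
proof (intro exI[of _ "p * (M powr (p - 2) * M)"] allI impI)
  fix r r' assume *: "\<bar>r\<bar> \<le> M" "\<bar>r'\<bar> \<le> M"
  have "norm (\<bar>r\<bar> powr p - \<bar>r'\<bar> powr p) \<le> p * (M powr (p - 2) * M) * norm (r - r')"
  proof (rule field_differentiable_bound[of "{-M..M}" _ "\<lambda>z. p * (\<bar>z\<bar> powr (p - 2) * z)"])
    fix z assume z: "z \<in> {-M..M}"
    show "((\<lambda>r. \<bar>r\<bar> powr p) has_real_derivative p * (\<bar>z\<bar> powr (p - 2) * z)) (at z within {-M..M})"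
      by (rule has_field_derivative_at_within[OF abs_powr_has_derivative[OF assms(1)]])
    have "\<bar>z\<bar> powr (p - 2) * \<bar>z\<bar> \<le> M powr (p - 2) * M" using z assms by (intro mult_mono powr_mono2) auto
    then show "norm (p * (\<bar>z\<bar> powr (p - 2) * z)) \<le> p * (M powr (p - 2) * M)"
      using assms by (simp add: abs_mult)
  qed (use * in auto)
  then show "\<bar>\<bar>r\<bar> powr p - \<bar>r'\<bar> powr p\<bar> \<le> p * (M powr (p - 2) * M) * \<bar>r - r'\<bar>" by simp
qed

text \<open>Besides the data of the equation, the witnesses of the existential hypotheses and the
  two kernel constants are fixed as parameters; from here on the kernel is accessed through
  \<open>kernel_bound\<close>, \<open>kernel_coercive\<close> and its symmetry.\<close>

locale kirchhoff =
  fixes a b \<alpha> p :: real and h :: "lat \<Rightarrow> real" and h0 :: real and x0 :: lat and CR c0 :: real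
  assumes a_pos: "a > 0" and b_pos: "b > 0" and \<alpha>_pos: "0 < \<alpha>" and \<alpha>_less: "\<alpha> < 3" and p_gt: "p > 4"
    and h0_pos: "h0 > 0" and h_ge: "h x \<ge> h0"
    and growth: "\<exists>r. \<forall>x. real_of_int (ldist x x0) \<ge> r \<longrightarrow> h x \<ge> C"
    and kernel_bound: "\<bar>Ralpha \<alpha> x y\<bar> \<le> CR" and c0_pos: "c0 > 0"
    and kernel_coercive: "finite F \<Longrightarrow> c0 * (\<Sum>x\<in>F. (f x)^2) \<le> (\<Sum>x\<in>F. \<Sum>y\<in>F. f x * f y * Ralpha \<alpha> x y)"
begin

sublocale bounded_kernel "Ralpha \<alpha>" CR
  by unfold_locales (use kernel_bound Ralpha_commute \<alpha>_pos \<alpha>_less in auto)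

text \<open>Multiplication by \<open>sqrt h\<close> identifies the potential part of the H norm with
  the plain l2 norm, so all l2 lemmas transfer to H.\<close>

definition wt :: "(lat \<Rightarrow> real) \<Rightarrow> lat \<Rightarrow> real" where "wt u x = sqrt (h x) * u x"
definition inH :: "(lat \<Rightarrow> real) \<Rightarrow> bool" where "inH u \<longleftrightarrow> l2 (wt u)"
text \<open>Norm convergence in H. Only the potential part is measured: as
  \<open>h \<ge> h0\<close>, it controls the l2 norm, and this in turn controls the Dirichlet
  part.\<close>

definition hconv :: "(nat \<Rightarrow> lat \<Rightarrow> real) \<Rightarrow> (lat \<Rightarrow> real) \<Rightarrow> bool" where
  "hconv U u \<longleftrightarrow> l2_conv (\<lambda>n. wt (U n)) (wt u)"
definition V :: "(lat \<Rightarrow> real) \<Rightarrow> (lat \<Rightarrow> real) \<Rightarrow> real" where "V u v = ip (wt u) (wt v)"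
definition B :: "(lat \<Rightarrow> real) \<Rightarrow> (lat \<Rightarrow> real) \<Rightarrow> real" where "B = kform (Ralpha \<alpha>)"
definition P :: "(lat \<Rightarrow> real) \<Rightarrow> lat \<Rightarrow> real" where "P u x = \<bar>u x\<bar> powr p"
definition G :: "(lat \<Rightarrow> real) \<Rightarrow> lat \<Rightarrow> real" where "G u x = \<bar>u x\<bar> powr (p - 2) * u x"

abbreviation J where "J \<equiv> Jfun a b \<alpha> p h"
abbreviation J' where "J' \<equiv> dJ a b \<alpha> p h"
abbreviation M where "M \<equiv> Mset a b \<alpha> p h"

section \<open>The weighted space and its forms\<close>

lemma h_pos: "h x > 0" using h_ge[of x] h0_pos by linarith

lemma abs_le_wt: "\<bar>u x\<bar> \<le> \<bar>1 / sqrt h0 * wt u x\<bar>"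
proof -
  have "sqrt h0 * \<bar>u x\<bar> \<le> sqrt (h x) * \<bar>u x\<bar>" using h_ge by (intro mult_right_mono) auto
  then show ?thesis using h0_pos h_pos[of x] by (simp add: wt_def abs_mult field_simps)
qed

lemma inH_l2: "inH u \<Longrightarrow> l2 u"
  unfolding inH_def by (rule l2_dominated[OF l2_scale abs_le_wt])

lemma Hsp_eq: "Hsp h = {u. inH u}"
proof -
  have e: "(wt u x)^2 = h x * (u x)^2" for u x using h_pos[of x] by (simp add: wt_def power_mult_distrib)
  have "inH u \<longleftrightarrow> (\<lambda>x. h x * (u x)^2) summable_on UNIV" for u by (simp add: inH_def l2_def e)
  then show ?thesis unfolding Hsp_def using inH_l2 l2_imp_H1 by blast
qed

lemma wt_add: "wt (\<lambda>x. u x + v x) = (\<lambda>x. wt u x + wt v x)" by (simp add: fun_eq_iff wt_def algebra_simps)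
lemma wt_diff: "wt (\<lambda>x. u x - v x) = (\<lambda>x. wt u x - wt v x)" by (simp add: fun_eq_iff wt_def algebra_simps)
lemma wt_scale: "wt (\<lambda>x. c * u x) = (\<lambda>x. c * wt u x)" by (simp add: fun_eq_iff wt_def)
text \<open>A positive factor commutes with taking positive parts. Continuity of \<open>upos\<close>
  and \<open>uneg\<close> in H is thereby inherited from l2, where it follows from their being
  Lipschitz.\<close>

lemma wt_upos: "wt (upos u) = upos (wt u)"
  using h_pos by (auto simp: fun_eq_iff wt_def upos_def max_def mult_le_0_iff not_le less_imp_le zero_le_mult_iff less_le)
lemma wt_uneg: "wt (uneg u) = uneg (wt u)"
  using h_pos by (auto simp: fun_eq_iff wt_def uneg_def min_def mult_le_0_iff not_le less_imp_le zero_le_mult_iff less_le)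

lemma inH_add: "inH u \<Longrightarrow> inH v \<Longrightarrow> inH (\<lambda>x. u x + v x)" by (simp add: inH_def wt_add l2_add)
lemma inH_scale: "inH u \<Longrightarrow> inH (\<lambda>x. c * u x)" by (simp add: inH_def wt_scale l2_scale)

lemma l2_upos: "l2 u \<Longrightarrow> l2 (upos u)" by (erule l2_dominated) (simp add: upos_def)
lemma l2_uneg: "l2 u \<Longrightarrow> l2 (uneg u)" by (erule l2_dominated) (simp add: uneg_def)
lemma inH_upos: "inH u \<Longrightarrow> inH (upos u)" by (simp add: inH_def wt_upos l2_upos)
lemma inH_uneg: "inH u \<Longrightarrow> inH (uneg u)" by (simp add: inH_def wt_uneg l2_uneg)

lemma hconv_l2: assumes "hconv U u" shows "l2_conv U u"
proof -
  note c = l2_convD[OF assms[unfolded hconv_def]]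
  show ?thesis
  proof (rule l2_conv_dominated)
    show "l2 (U n)" for n using c(1) inH_l2 by (simp add: inH_def)
    show "l2 u" using c(2) inH_l2 by (simp add: inH_def)
    show "l2 (\<lambda>x. 1 / sqrt h0 * (wt (U n) x - wt u x))" for n by (rule l2_scale[OF l2_diff[OF c(1,2)]])
    show "\<bar>U n x - u x\<bar> \<le> \<bar>1 / sqrt h0 * (wt (U n) x - wt u x)\<bar>" for n x
      using abs_le_wt[of "\<lambda>x. U n x - u x" x] by (simp add: wt_diff)
    have "(\<lambda>n. 1 / sqrt h0 * (1 / sqrt h0 * ip (\<lambda>x. wt (U n) x - wt u x) (\<lambda>x. wt (U n) x - wt u x)))
        \<longlonglongrightarrow> 1 / sqrt h0 * (1 / sqrt h0 * 0)"
      by (intro tendsto_mult tendsto_const c(3))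
    then show "(\<lambda>n. ip (\<lambda>x. 1 / sqrt h0 * (wt (U n) x - wt u x)) (\<lambda>x. 1 / sqrt h0 * (wt (U n) x - wt u x))) \<longlonglongrightarrow> 0"
      unfolding ip_scale_left ip_scale_right by simp
  qed
qed

lemma hconv_inH: "hconv U u \<Longrightarrow> inH (U n)" "hconv U u \<Longrightarrow> inH u"
  using l2_convD unfolding hconv_def inH_def by auto

lemma hconv_add: "hconv U u \<Longrightarrow> hconv W w \<Longrightarrow> hconv (\<lambda>n x. U n x + W n x) (\<lambda>x. u x + w x)"
  unfolding hconv_def wt_add by (rule l2_conv_add)

lemma hconv_scale: "hconv U u \<Longrightarrow> c \<longlonglongrightarrow> c1 \<Longrightarrow> hconv (\<lambda>n x. c n * U n x) (\<lambda>x. c1 * u x)"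
  unfolding hconv_def wt_scale by (rule l2_conv_scale)

lemma hconv_const: "inH u \<Longrightarrow> hconv (\<lambda>_. u) u"
  unfolding hconv_def inH_def by (rule l2_conv_const)

lemma l2_conv_upos: "l2_conv U u \<Longrightarrow> l2_conv (\<lambda>n. upos (U n)) (upos u)"
  unfolding upos_def by (rule l2_conv_lipschitz[where g = "\<lambda>r. max r 0"]) (auto intro!: exI[of _ 1])

lemma l2_conv_uneg: "l2_conv U u \<Longrightarrow> l2_conv (\<lambda>n. uneg (U n)) (uneg u)"
  unfolding uneg_def by (rule l2_conv_lipschitz[where g = "\<lambda>r. min r 0"]) (auto intro!: exI[of _ 1])

lemma hconv_upos: "hconv U u \<Longrightarrow> hconv (\<lambda>n. upos (U n)) (upos u)"
  unfolding hconv_def wt_upos by (rule l2_conv_upos)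

lemma hconv_uneg: "hconv U u \<Longrightarrow> hconv (\<lambda>n. uneg (U n)) (uneg u)"
  unfolding hconv_def wt_uneg by (rule l2_conv_uneg)

lemma V_tendsto: "hconv U u \<Longrightarrow> hconv W w \<Longrightarrow> (\<lambda>n. V (U n) (W n)) \<longlonglongrightarrow> V u w"
  unfolding hconv_def V_def by (rule ip_tendsto)

lemma V_commute: "V u v = V v u" by (simp add: V_def ip_commute)
lemma V_add_right: "inH u \<Longrightarrow> inH v \<Longrightarrow> inH w \<Longrightarrow> V u (\<lambda>x. v x + w x) = V u v + V u w"
  by (simp add: V_def wt_add ip_add_right inH_def)
lemma V_scale_right: "V u (\<lambda>x. c * v x) = c * V u v"
  by (simp add: V_def wt_scale ip_scale_right)
lemma V_add_left: "inH u \<Longrightarrow> inH v \<Longrightarrow> inH w \<Longrightarrow> V (\<lambda>x. v x + w x) u = V v u + V w u"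
  using V_add_right[of u v w] by (simp add: V_commute)
lemma V_scale_left: "V (\<lambda>x. c * v x) u = c * V v u"
  using V_scale_right[of u c v] by (simp add: V_commute)
lemma V_self_nonneg: "0 \<le> V u u" by (simp add: V_def ip_self_nonneg)

lemma V_pos_neg: "V (upos u) (uneg u) = 0"
proof -
  have "(\<lambda>x. wt (upos u) x * wt (uneg u) x) = (\<lambda>_. 0)"
    by (auto simp: wt_def upos_def uneg_def max_def min_def)
  then show ?thesis by (simp add: V_def ip_def)
qed

lemma V_self_pos: assumes "inH u" "u \<noteq> (\<lambda>_. 0)" shows "V u u > 0"
proof (rule ccontr)
  assume "\<not> V u u > 0"
  then have "V u u = 0" using V_self_nonneg[of u] by linarith
  then have w: "wt u = (\<lambda>_. 0)" using ip_self_eq_0 assms(1) by (simp add: V_def inH_def)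
  have "u x = 0" for x using fun_cong[OF w, of x] h_pos[of x] by (simp add: wt_def)
  then show False using assms(2) by auto
qed

lemma ip_le_V: "inH u \<Longrightarrow> h0 * ip u u \<le> V u u"
proof -
  assume u: "inH u"
  have "ip u u \<le> ip (\<lambda>x. 1 / sqrt h0 * wt u x) (\<lambda>x. 1 / sqrt h0 * wt u x)"
    by (rule ip_self_mono[OF l2_scale abs_le_wt]) (use u in \<open>simp add: inH_def\<close>)
  also have "\<dots> = V u u / h0" using h0_pos unfolding ip_scale_left ip_scale_right V_def by (simp add: field_simps)
  finally show ?thesis using h0_pos by (simp add: field_simps)
qed

lemma l2_conv_P: "l2_conv U u \<Longrightarrow> l2_conv (\<lambda>n. P (U n)) (P u)"
  unfolding P_def[abs_def]
  by (rule l2_conv_lipschitz[where g = "\<lambda>r. \<bar>r\<bar> powr p"]) (use p_gt abs_powr_lipschitz[of p] in auto)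

lemma l2_conv_G: "l2_conv U u \<Longrightarrow> l2_conv (\<lambda>n. G (U n)) (G u)"
  unfolding G_def[abs_def]
  by (rule l2_conv_lipschitz[where g = "\<lambda>r. \<bar>r\<bar> powr (p - 2) * r"]) (use p_gt odd_powr_lipschitz[of "p - 2"] in auto)

lemma P_eq: "P u = (\<lambda>x. G u x * u x)" by (simp add: P_def G_def fun_eq_iff abs_powr_eq[of _ p])

lemma l1_conv_P: "l2_conv U u \<Longrightarrow> l1_conv (\<lambda>n. P (U n)) (P u)"
  unfolding P_eq by (rule l2_conv_mult[OF l2_conv_G])

lemma P_summable: "l2 u \<Longrightarrow> P u summable_on UNIV"
  using l1_conv_P[OF l2_conv_const] by (auto simp: l1_conv_def)

lemma l2_P: "l2 u \<Longrightarrow> l2 (P u)" using l2_convD(2)[OF l2_conv_P[OF l2_conv_const]] by blast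

lemma P_nonneg: "0 \<le> P u x" by (simp add: P_def)

lemma P_eq_0_iff: "P u = (\<lambda>_. 0) \<longleftrightarrow> u = (\<lambda>_. 0)" by (simp add: P_def fun_eq_iff)

section \<open>The energy and its derivative in terms of bilinear forms\<close>

lemma J_eq:
  assumes "inH u"
  shows "J u = 1/2 * (a * Dir_form u u + V u u) + b/4 * (Dir_form u u)^2 - 1/(2*p) * B (P u) (P u)"
proof -
  have e: "(\<lambda>x. h x * (u x)^2) = (\<lambda>x. wt u x * wt u x)"
    using h_pos by (simp add: fun_eq_iff wt_def power2_eq_square less_imp_le)
  have "Hnorm_sq a h u = (\<Sum>\<^sub>\<infinity>x. a * grad_prod u u x) + (\<Sum>\<^sub>\<infinity>x. h x * (u x)^2)"
    unfolding Hnorm_sq_def grad_sq_eq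
    by (intro infsum_add summable_on_cmult_right grad_prod_summable inH_l2 assms)
       (unfold e, intro l2_mult_summable assms[unfolded inH_def])
  then have "Hnorm_sq a h u = a * Dir_form u u + V u u"
    by (simp add: e V_def ip_def Dir_form_def infsum_cmult_right')
  then show ?thesis by (simp add: Jfun_def Dir_eq B_def kform_def conv_def P_def[abs_def])
qed

lemma J'_eq:
  assumes "inH u" "inH \<phi>"
  shows "J' u \<phi> = a * Dir_form u \<phi> + V u \<phi> + b * Dir_form u u * Dir_form u \<phi> - B (P u) (\<lambda>x. G u x * \<phi> x)"
proof -
  have e: "(\<lambda>x. h x * u x * \<phi> x) = (\<lambda>x. wt u x * wt \<phi> x)"
    using h_pos by (simp add: fun_eq_iff wt_def less_imp_le)
  have "(\<Sum>\<^sub>\<infinity>x. a * grad_prod u \<phi> x + h x * u x * \<phi> x) = (\<Sum>\<^sub>\<infinity>x. a * grad_prod u \<phi> x) + (\<Sum>\<^sub>\<infinity>x. h x * u x * \<phi> x)"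
    by (intro infsum_add summable_on_cmult_right grad_prod_summable inH_l2 assms)
       (unfold e, intro l2_mult_summable assms[unfolded inH_def])
  then have "(\<Sum>\<^sub>\<infinity>x. a * grad_prod u \<phi> x + h x * u x * \<phi> x) = a * Dir_form u \<phi> + V u \<phi>"
    by (simp add: e V_def ip_def Dir_form_def infsum_cmult_right')
  then show ?thesis by (simp add: dJ_def Dir_eq B_def kform_def conv_def P_def[abs_def] G_def mult.assoc)
qed

lemma J'_scale:
  assumes "inH u" "inH \<phi>" shows "J' u (\<lambda>x. c * \<phi> x) = c * J' u \<phi>"
proof -
  have "B (P u) (\<lambda>x. G u x * (c * \<phi> x)) = c * B (P u) (\<lambda>x. G u x * \<phi> x)"
    using kform_scale_right[of "P u" c "\<lambda>x. G u x * \<phi> x"] by (simp add: B_def mult.left_commute)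
  then show ?thesis using assms
    by (simp add: J'_eq inH_scale V_scale_right Dir_form_scale_right algebra_simps)
qed

section \<open>Fibers spanned by the positive and negative part\<close>

definition pn_comb :: "(lat \<Rightarrow> real) \<Rightarrow> real \<Rightarrow> real \<Rightarrow> lat \<Rightarrow> real" where
  "pn_comb u s t = (\<lambda>x. s * upos u x + t * uneg u x)"

lemma pn_comb_1 [simp]: "pn_comb u 1 1 = u" by (auto simp: pn_comb_def upos_def uneg_def fun_eq_iff)

lemma inH_pn_comb: "inH u \<Longrightarrow> inH (pn_comb u s t)"
  unfolding pn_comb_def by (intro inH_add inH_scale inH_upos inH_uneg)

lemma upos_pn_comb: "s \<ge> 0 \<Longrightarrow> t \<ge> 0 \<Longrightarrow> upos (pn_comb u s t) = (\<lambda>x. s * upos u x)"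
  by (auto simp: pn_comb_def upos_def uneg_def fun_eq_iff max_def min_def mult_le_0_iff intro: antisym mult_nonneg_nonpos)

lemma uneg_pn_comb: "s \<ge> 0 \<Longrightarrow> t \<ge> 0 \<Longrightarrow> uneg (pn_comb u s t) = (\<lambda>x. t * uneg u x)"
  by (auto simp: pn_comb_def upos_def uneg_def fun_eq_iff max_def min_def mult_le_0_iff zero_le_mult_iff intro: antisym)

text \<open>At each point at most one of the two parts is nonzero, so the p-th power of the
  combination splits exactly. This is why the nonlocal energy on a fiber is a quadratic form in
  \<open>(s powr p, t powr p)\<close>.\<close>

lemma P_pn_comb:
  assumes "s \<ge> 0" "t \<ge> 0"
  shows "P (pn_comb u s t) = (\<lambda>x. s powr p * P (upos u) x + t powr p * P (uneg u) x)"
proof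
  fix x
  have m: "\<bar>r * v\<bar> powr p = r powr p * \<bar>v\<bar> powr p" if "r \<ge> 0" for r v :: real
    using that by (simp add: abs_mult powr_mult)
  show "P (pn_comb u s t) x = s powr p * P (upos u) x + t powr p * P (uneg u) x"
  proof (cases "u x \<ge> 0")
    case True
    then have "upos u x = u x" "uneg u x = 0" by (auto simp: upos_def uneg_def)
    then show ?thesis using m[OF assms(1)] by (simp add: P_def pn_comb_def)
  next
    case False
    then have "upos u x = 0" "uneg u x = u x" by (auto simp: upos_def uneg_def)
    then show ?thesis using m[OF assms(2)] by (simp add: P_def pn_comb_def)
  qed
qed

lemma odd_powr_scale:
  assumes "s > 0"
  shows "\<bar>s * r\<bar> powr (p - 2) * (s * r) * r = s powr (p - 1) * \<bar>r\<bar> powr p"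
proof -
  have "s powr (p - 1) = s powr (p - 2) * s" using assms powr_add[of s "p - 2" 1] by simp
  then show ?thesis using assms unfolding abs_powr_eq[of r p] by (simp add: abs_mult powr_mult)
qed

lemma G_pn_comb_upos:
  assumes "s > 0"
  shows "G (pn_comb u s t) x * upos u x = s powr (p - 1) * P (upos u) x"
proof (cases "u x > 0")
  case True
  then have "pn_comb u s t x = s * u x" "upos u x = u x" by (auto simp: pn_comb_def upos_def uneg_def)
  then show ?thesis unfolding G_def P_def by (simp only: odd_powr_scale[OF assms])
qed (auto simp: P_def upos_def max_def)

lemma G_pn_comb_uneg:
  assumes "t > 0"
  shows "G (pn_comb u s t) x * uneg u x = t powr (p - 1) * P (uneg u) x"
proof (cases "u x < 0")
  case True
  then have "pn_comb u s t x = t * u x" "uneg u x = u x" by (auto simp: pn_comb_def upos_def uneg_def)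
  then show ?thesis unfolding G_def P_def by (simp only: odd_powr_scale[OF assms])
qed (auto simp: P_def uneg_def min_def)

abbreviation V1 where "V1 u \<equiv> V (upos u) (upos u)"
abbreviation V2 where "V2 u \<equiv> V (uneg u) (uneg u)"
abbreviation D1 where "D1 u \<equiv> Dir_form (upos u) (upos u)"
abbreviation D2 where "D2 u \<equiv> Dir_form (uneg u) (uneg u)"
abbreviation E where "E u \<equiv> Dir_form (upos u) (uneg u)"
abbreviation B11 where "B11 u \<equiv> B (P (upos u)) (P (upos u))"
abbreviation B12 where "B12 u \<equiv> B (P (upos u)) (P (uneg u))"
abbreviation B22 where "B22 u \<equiv> B (P (uneg u)) (P (uneg u))"

definition Fib where "Fib u s t = fiber a b p (V1 u) (V2 u) (D1 u) (D2 u) (E u) (B11 u) (B12 u) (B22 u) s t"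
definition S1 where "S1 u s t = fiber_slope a b p (V1 u) (D1 u) (D2 u) (E u) (B11 u) (B12 u) s t"
text \<open>\<open>fiber_slope\<close> differentiates in its first variable, hence the exchanged
  indices and the order \<open>t s\<close>.\<close>

definition S2 where "S2 u s t = fiber_slope a b p (V2 u) (D2 u) (D1 u) (E u) (B22 u) (B12 u) t s"

lemma B_commute: "f summable_on UNIV \<Longrightarrow> g summable_on UNIV \<Longrightarrow> B f g = B g f"
  unfolding B_def by (rule kform_commute)

lemma B_comb:
  assumes "f1 summable_on UNIV" "f2 summable_on UNIV"
  shows "B (\<lambda>x. c * f1 x + d * f2 x) (\<lambda>x. c * f1 x + d * f2 x) = c^2 * B f1 f1 + 2 * c * d * B f1 f2 + d^2 * B f2 f2"
proof -
  have s: "(\<lambda>x. c * f1 x) summable_on UNIV" "(\<lambda>x. d * f2 x) summable_on UNIV" for c d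
    by (intro summable_on_cmult_right assms)+
  show ?thesis
    using kform_commute[OF assms(2,1)]
    by (simp add: B_def kform_add_left kform_add_right s summable_on_add kform_scale_left kform_scale_right assms
        power2_eq_square algebra_simps)
qed

lemma Dir_form_pn_comb:
  assumes "inH u"
  shows "Dir_form (pn_comb u s t) (upos u) = s * D1 u + t * E u"
    "Dir_form (pn_comb u s t) (uneg u) = t * D2 u + s * E u"
    "Dir_form (pn_comb u s t) (pn_comb u s t) = s^2 * D1 u + t^2 * D2 u + 2 * s * t * E u"
proof -
  have l: "l2 (upos u)" "l2 (uneg u)" using assms by (auto intro: l2_upos l2_uneg inH_l2)
  note ls = l2_scale[OF l(1)] l2_scale[OF l(2)]
  have c: "Dir_form (uneg u) (upos u) = E u" by (rule Dir_form_commute)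
  show 1: "Dir_form (pn_comb u s t) (upos u) = s * D1 u + t * E u"
    unfolding pn_comb_def Dir_form_add_left[OF l(1) ls] Dir_form_scale_left c ..
  show 2: "Dir_form (pn_comb u s t) (uneg u) = t * D2 u + s * E u"
    unfolding pn_comb_def Dir_form_add_left[OF l(2) ls] Dir_form_scale_left by simp
  have "Dir_form (pn_comb u s t) (pn_comb u s t) = s * Dir_form (pn_comb u s t) (upos u) + t * Dir_form (pn_comb u s t) (uneg u)"
    using Dir_form_add_right[OF inH_l2[OF inH_pn_comb[OF assms]] ls, of s t s t]
    by (simp add: Dir_form_scale_right flip: pn_comb_def)
  then show "Dir_form (pn_comb u s t) (pn_comb u s t) = s^2 * D1 u + t^2 * D2 u + 2 * s * t * E u"
    unfolding 1 2 by (simp add: power2_eq_square algebra_simps)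
qed

lemma V_pn_comb:
  assumes "inH u"
  shows "V (pn_comb u s t) (upos u) = s * V1 u" "V (pn_comb u s t) (uneg u) = t * V2 u"
    "V (pn_comb u s t) (pn_comb u s t) = s^2 * V1 u + t^2 * V2 u"
proof -
  note l = inH_upos[OF assms] inH_uneg[OF assms]
  note ls = inH_scale[OF l(1)] inH_scale[OF l(2)]
  have c: "V (uneg u) (upos u) = 0" using V_pos_neg V_commute by metis
  show 1: "V (pn_comb u s t) (upos u) = s * V1 u"
    unfolding pn_comb_def V_add_left[OF l(1) ls] V_scale_left c by simp
  show 2: "V (pn_comb u s t) (uneg u) = t * V2 u"
    unfolding pn_comb_def V_add_left[OF l(2) ls] V_scale_left V_pos_neg by simp
  have "V (pn_comb u s t) (pn_comb u s t) = s * V (pn_comb u s t) (upos u) + t * V (pn_comb u s t) (uneg u)"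
    using V_add_right[OF inH_pn_comb[OF assms] ls, of s t s t] by (simp add: V_scale_right flip: pn_comb_def)
  then show "V (pn_comb u s t) (pn_comb u s t) = s^2 * V1 u + t^2 * V2 u"
    unfolding 1 2 by (simp add: power2_eq_square)
qed

lemma P_pn_summable: "inH u \<Longrightarrow> P (upos u) summable_on UNIV" "inH u \<Longrightarrow> P (uneg u) summable_on UNIV"
  by (auto intro: P_summable l2_upos l2_uneg inH_l2)

lemma J_pn_comb:
  assumes "inH u" "s \<ge> 0" "t \<ge> 0" shows "J (pn_comb u s t) = Fib u s t"
  unfolding J_eq[OF inH_pn_comb[OF assms(1)]] Dir_form_pn_comb[OF assms(1)] V_pn_comb[OF assms(1)]
    P_pn_comb[OF assms(2,3)] B_comb[OF P_pn_summable[OF assms(1)]] Fib_def fiber_def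
  by (simp add: algebra_simps)

text \<open>Testing the derivative with \<open>upos u\<close> and \<open>uneg u\<close> gives the
  two partial derivatives of the energy on the fiber. At \<open>s = t = 1\<close> the Nehari
  constraints thus say that (1, 1) is a critical point of the fiber.\<close>

lemma J'_pn_comb:
  assumes "inH u" "s > 0" "t > 0"
  shows "J' (pn_comb u s t) (upos u) = S1 u s t" "J' (pn_comb u s t) (uneg u) = S2 u s t"
proof -
  note ps = P_pn_summable[OF assms(1)]
  have pss: "(\<lambda>x. c * P (upos u) x) summable_on UNIV" "(\<lambda>x. c * P (uneg u) x) summable_on UNIV" for c
    by (intro summable_on_cmult_right ps)+
  have B1: "B (P (pn_comb u s t)) (\<lambda>x. G (pn_comb u s t) x * upos u x) = s powr (p - 1) * (s powr p * B11 u + t powr p * B12 u)"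
    unfolding G_pn_comb_upos[OF assms(2)] using assms kform_commute[OF ps(2,1)]
    by (simp add: P_pn_comb B_def kform_scale_right kform_add_left kform_scale_left ps pss)
  have B2: "B (P (pn_comb u s t)) (\<lambda>x. G (pn_comb u s t) x * uneg u x) = t powr (p - 1) * (t powr p * B22 u + s powr p * B12 u)"
    unfolding G_pn_comb_uneg[OF assms(3)] using assms
    by (simp add: P_pn_comb B_def kform_scale_right kform_add_left kform_scale_left ps pss)
  note H = inH_pn_comb[OF assms(1), of s t]
  show "J' (pn_comb u s t) (upos u) = S1 u s t"
    unfolding J'_eq[OF H inH_upos[OF assms(1)]] B1 Dir_form_pn_comb[OF assms(1)] V_pn_comb[OF assms(1)] S1_def fiber_slope_def
    by simp
  show "J' (pn_comb u s t) (uneg u) = S2 u s t"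
    unfolding J'_eq[OF H inH_uneg[OF assms(1)]] B2 Dir_form_pn_comb[OF assms(1)] V_pn_comb[OF assms(1)] S2_def fiber_slope_def
    by (simp add: algebra_simps)
qed

lemma mem_M_iff:
  "u \<in> M \<longleftrightarrow> inH u \<and> upos u \<noteq> (\<lambda>_. 0) \<and> uneg u \<noteq> (\<lambda>_. 0) \<and> S1 u 1 1 = 0 \<and> S2 u 1 1 = 0"
  using J'_pn_comb[of u 1 1] unfolding Mset_def Hsp_eq by auto

text \<open>Coercivity of the kernel, applied to \<open>x * P (upos u) + y * P (uneg u)\<close>: the
  supports are disjoint, so the l2 norm on the left has no mixed term, whatever the sign of
  \<open>B12 u\<close>.\<close>

lemma nonlocal_coercive:
  assumes "inH u"
  shows "c0 * (ip (P (upos u)) (P (upos u)) * x^2 + ip (P (uneg u)) (P (uneg u)) * y^2)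
     \<le> B11 u * x^2 + 2 * B12 u * x * y + B22 u * y^2"
proof -
  define f1 f2 where "f1 = P (upos u)" and "f2 = P (uneg u)"
  have s: "f1 summable_on UNIV" "f2 summable_on UNIV" using P_pn_summable[OF assms] by (auto simp: f1_def f2_def)
  have l: "l2 f1" "l2 f2" using assms by (auto simp: f1_def f2_def intro: l2_P l2_upos l2_uneg inH_l2)
  have "(\<lambda>x. f1 x * f2 x) = (\<lambda>_. 0)"
    by (auto simp: f1_def f2_def P_def upos_def uneg_def fun_eq_iff max_def min_def)
  then have z: "ip f1 f2 = 0" "ip f2 f1 = 0" unfolding ip_commute[of f2] by (simp_all add: ip_def)
  have "c0 * ip (\<lambda>z. x * f1 z + y * f2 z) (\<lambda>z. x * f1 z + y * f2 z) \<le> B (\<lambda>z. x * f1 z + y * f2 z) (\<lambda>z. x * f1 z + y * f2 z)"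
    unfolding B_def by (rule kform_coercive[OF _ summable_on_add[OF summable_on_cmult_right[OF s(1)] summable_on_cmult_right[OF s(2)]] l2_add[OF l2_scale[OF l(1)] l2_scale[OF l(2)]]]) (rule kernel_coercive)
  moreover have "ip (\<lambda>z. x * f1 z + y * f2 z) (\<lambda>z. x * f1 z + y * f2 z) = ip f1 f1 * x^2 + ip f2 f2 * y^2"
    by (simp add: ip_add_left ip_add_right l2_add l2_scale l ip_scale_left ip_scale_right z power2_eq_square)
  ultimately show ?thesis unfolding B_comb[OF s] f1_def[symmetric] f2_def[symmetric] by (simp add: mult_ac)
qed

lemma ip_P_pos: "inH u \<Longrightarrow> u \<noteq> (\<lambda>_. 0) \<Longrightarrow> ip (P u) (P u) > 0"
  using ip_self_eq_0[OF l2_P[OF inH_l2]] ip_self_nonneg[of "P u"] P_eq_0_iff[of u] by fastforce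

lemma Fib_tangent:
  assumes "inH u" "s \<ge> 0" "t \<ge> 0"
  defines "x \<equiv> s powr p - 1" and "y \<equiv> t powr p - 1"
  shows "Fib u s t \<le> J u + x / p * S1 u 1 1 + y / p * S2 u 1 1
     - c0/(2*p) * (ip (P (upos u)) (P (upos u)) * x^2 + ip (P (uneg u)) (P (uneg u)) * y^2)"
proof -
  have J1: "J u = Fib u 1 1" using J_pn_comb[OF assms(1), of 1 1] by simp
  have "1/(2*p) * (c0 * (ip (P (upos u)) (P (upos u)) * x^2 + ip (P (uneg u)) (P (uneg u)) * y^2))
     \<le> 1/(2*p) * (B11 u * x^2 + 2 * B12 u * x * y + B22 u * y^2)"
    using p_gt by (intro mult_left_mono nonlocal_coercive assms) auto
  moreover have "Fib u s t \<le> Fib u 1 1 + x / p * S1 u 1 1 + y / p * S2 u 1 1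
     - 1/(2*p) * (B11 u * x^2 + 2 * B12 u * x * y + B22 u * y^2)"
    unfolding Fib_def S1_def S2_def x_def y_def
    by (rule fiber_tangent_bound) (use a_pos b_pos p_gt assms V_self_nonneg Dir_form_self_nonneg Dir_form_pos_neg_nonneg in auto)
  ultimately show ?thesis unfolding J1 by simp
qed

text \<open>On \<open>M\<close> both slopes vanish, so the tangent bound has no linear part left and
  its quadratic remainder only lowers the value.\<close>

lemma M_fiber_max:
  assumes "u \<in> M" "s \<ge> 0" "t \<ge> 0" shows "Fib u s t \<le> J u"
proof -
  have u: "inH u" "S1 u 1 1 = 0" "S2 u 1 1 = 0" using assms mem_M_iff by auto
  have "0 \<le> c0/(2*p) * (ip (P (upos u)) (P (upos u)) * (s powr p - 1)^2 + ip (P (uneg u)) (P (uneg u)) * (t powr p - 1)^2)"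
    using c0_pos p_gt by (intro mult_nonneg_nonneg add_nonneg_nonneg ip_self_nonneg) auto
  then show ?thesis using Fib_tangent[OF u(1) assms(2,3)] u by simp
qed

lemma projection:
  assumes "inH u" "upos u \<noteq> (\<lambda>_. 0)" "uneg u \<noteq> (\<lambda>_. 0)"
  obtains s t where "s > 0" "t > 0" "pn_comb u s t \<in> M" "\<And>s' t'. s' \<ge> 0 \<Longrightarrow> t' \<ge> 0 \<Longrightarrow> Fib u s' t' \<le> Fib u s t"
proof -
  define I1 I2 where "I1 = ip (P (upos u)) (P (upos u))" and "I2 = ip (P (uneg u)) (P (uneg u))"
  have I: "I1 > 0" "I2 > 0" unfolding I1_def I2_def by (intro ip_P_pos inH_upos inH_uneg assms)+
  have co: "c0 * min I1 I2 * (x^2 + y^2) \<le> B11 u * x^2 + 2 * B12 u * x * y + B22 u * y^2" for x y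
  proof -
    have "min I1 I2 * (x^2 + y^2) \<le> I1 * x^2 + I2 * y^2"
      unfolding distrib_left by (intro add_mono mult_right_mono) auto
    then have "c0 * (min I1 I2 * (x^2 + y^2)) \<le> c0 * (I1 * x^2 + I2 * y^2)" using c0_pos by (intro mult_left_mono) auto
    then show ?thesis using nonlocal_coercive[OF assms(1), of x y] by (simp add: I1_def I2_def mult.assoc)
  qed
  have pos: "V1 u > 0" "V2 u > 0" by (intro V_self_pos inH_upos inH_uneg assms)+
  obtain s t where st: "s > 0" "t > 0" and mx: "\<And>s' t'. s' \<ge> 0 \<Longrightarrow> t' \<ge> 0 \<Longrightarrow> Fib u s' t' \<le> Fib u s t"
    and S: "S1 u s t = 0" "S2 u s t = 0"
    unfolding Fib_def S1_def S2_def
    by (rule fiber_has_max[OF p_gt _ _ pos, of a b "D1 u" "D2 u" "E u" "c0 * min I1 I2" "B11 u" "B12 u" "B22 u"])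
       (use a_pos b_pos c0_pos I co Dir_form_self_nonneg Dir_form_pos_neg_nonneg in auto)
  have "pn_comb u s t \<in> M"
    unfolding Mset_def Hsp_eq mem_Collect_eq
  proof (intro conjI inH_pn_comb assms(1))
    \<comment> \<open>Since the parts of the projected point are multiples of those of
      \<open>u\<close>, its two constraints are \<open>s\<close> and \<open>t\<close> times the
      slopes of the fiber, which vanish at the maximum.\<close>
    have e: "upos (pn_comb u s t) = (\<lambda>x. s * upos u x)" "uneg (pn_comb u s t) = (\<lambda>x. t * uneg u x)"
      using st upos_pn_comb uneg_pn_comb by auto
    show "upos (pn_comb u s t) \<noteq> (\<lambda>_. 0)" "uneg (pn_comb u s t) \<noteq> (\<lambda>_. 0)"
      unfolding e using st assms by (auto simp: fun_eq_iff)
    show "J' (pn_comb u s t) (upos (pn_comb u s t)) = 0" "J' (pn_comb u s t) (uneg (pn_comb u s t)) = 0"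
      unfolding e J'_scale[OF inH_pn_comb[OF assms(1)] inH_upos[OF assms(1)]] J'_scale[OF inH_pn_comb[OF assms(1)] inH_uneg[OF assms(1)]]
        J'_pn_comb[OF assms(1) st] S by simp_all
  qed
  then show ?thesis using that st mx by blast
qed

end

section \<open>Minimisation\<close>

text \<open>Finite partial sums pass to the limit. The bound \<open>K n\<close> varies with
  \<open>n\<close> so that the lemma yields lower semicontinuity along convergent norms, not only
  preservation of a uniform bound.\<close>

lemma ip_Fatou:
  assumes U: "\<And>n. l2 (U n)" and pw: "\<And>x. (\<lambda>n. U n x) \<longlonglongrightarrow> u x"
    and le: "\<And>n. ip (U n) (U n) \<le> K n" and K: "K \<longlonglongrightarrow> L"
  shows "l2 u" "ip u u \<le> L"
proof -
  have b: "(\<Sum>x\<in>F. u x * u x) \<le> L" if "finite F" for F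
  proof (rule LIMSEQ_le[OF _ K])
    show "(\<lambda>n. \<Sum>x\<in>F. U n x * U n x) \<longlonglongrightarrow> (\<Sum>x\<in>F. u x * u x)"
      by (rule tendsto_sum[OF tendsto_mult[OF pw pw]])
    have "(\<Sum>x\<in>F. U n x * U n x) \<le> ip (U n) (U n)" for n
      unfolding ip_def by (rule finite_sum_le_infsum[OF l2_mult_summable[OF U U] that]) auto
    then show "\<exists>N. \<forall>n\<ge>N. (\<Sum>x\<in>F. U n x * U n x) \<le> K n" using le order_trans by blast
  qed
  have s: "(\<lambda>x. u x * u x) summable_on UNIV"
    by (rule nonneg_bdd_above_summable_on) (auto intro!: bdd_aboveI[of _ L] b)
  then show "l2 u" by (simp add: l2_def power2_eq_square)
  show "ip u u \<le> L" unfolding ip_def by (rule infsum_le_finite_sums[OF s]) (rule b)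
qed

text \<open>A product of compact intervals is compact by Tychonoff, and countability of the index
  type makes the product topology metrizable, so compactness is sequential.\<close>

lemma pointwise_convergent_subseq:
  fixes U :: "nat \<Rightarrow> 'a::countable \<Rightarrow> real"
  assumes "\<And>n x. \<bar>U n x\<bar> \<le> R"
  obtains r u where "strict_mono r" "\<And>x. (\<lambda>n. U (r n) x) \<longlonglongrightarrow> u x"
proof -
  have "compactin (product_topology (\<lambda>_. euclidean) UNIV) (PiE UNIV (\<lambda>_::'a. {-R..R}))"
    by (subst compactin_PiE) auto
  then have "compact (PiE UNIV (\<lambda>_::'a. {-R..R}))" by (simp add: euclidean_product_topology)
  then have "seq_compact (PiE UNIV (\<lambda>_::'a. {-R..R}))" by (simp add: compact_eq_seq_compact_metric)
  moreover have "\<forall>n. U n \<in> PiE UNIV (\<lambda>_::'a. {-R..R})"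
    using assms by (auto simp: abs_le_iff minus_le_iff)
  ultimately obtain u r where r: "strict_mono r" "(U \<circ> r) \<longlonglongrightarrow> u" by (rule seq_compactE) blast
  have "(\<lambda>n. U (r n) x) \<longlonglongrightarrow> u x" for x
  proof -
    have "continuous_on UNIV (\<lambda>f::'a \<Rightarrow> real. f x)" by (rule continuous_on_product_coordinates)
    then have "isCont (\<lambda>f::'a \<Rightarrow> real. f x) u"
      using continuous_on_eq_continuous_at[OF open_UNIV] by blast
    then show ?thesis using isCont_tendsto_compose[OF _ r(2)] by (auto simp: o_def)
  qed
  then show ?thesis using r(1) that by blast
qed

lemma finite_ldist_ball: "finite {x. real_of_int (ldist x x0) < r}"
proof -
  obtain a b c where x0: "x0 = (a, b, c)" by (cases x0) auto
  define R where "R = \<lceil>r\<rceil>"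
  have "{x. real_of_int (ldist x x0) < r} \<subseteq> {a - R..a + R} \<times> {b - R..b + R} \<times> {c - R..c + R}"
  proof
    fix x assume "x \<in> {x. real_of_int (ldist x x0) < r}"
    then have "real_of_int (ldist x x0) \<le> real_of_int R" unfolding R_def using le_of_int_ceiling[of r] by simp linarith
    then have "ldist x x0 \<le> R" by simp
    then show "x \<in> {a - R..a + R} \<times> {b - R..b + R} \<times> {c - R..c + R}"
      by (cases x) (auto simp: ldist_def x0)
  qed
  then show ?thesis by (rule finite_subset) auto
qed

lemma tendsto_0_eventually_le:
  fixes g :: "nat \<Rightarrow> real"
  assumes "\<And>n. 0 \<le> g n" "\<And>e. e > 0 \<Longrightarrow> \<exists>k. (\<forall>n. g n \<le> k n + e) \<and> k \<longlonglongrightarrow> 0"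
  shows "g \<longlonglongrightarrow> 0"
proof (rule tendstoI)
  fix e :: real assume "e > 0"
  then obtain k where k: "\<And>n. g n \<le> k n + e/2" "k \<longlonglongrightarrow> 0" using assms(2)[of "e/2"] by auto
  have "\<forall>\<^sub>F n in sequentially. k n < e/2" using order_tendstoD(2)[OF k(2), of "e/2"] \<open>e > 0\<close> by simp
  then show "\<forall>\<^sub>F n in sequentially. dist (g n) 0 < e"
  proof eventually_elim
    case (elim n)
    then show ?case using k(1)[of n] assms(1)[of n] by simp
  qed
qed

section \<open>Variation of the energy at a minimiser\<close>

context kirchhoff
begin

text \<open>Differentiability in a strong form, with moving base points \<open>Z n\<close> and
  moving directions \<open>\<Psi> n\<close>, as needed for points that have been projected back to
  \<open>M\<close>. Differences of quadratic forms factor exactly, so no remainder has to be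
  estimated; only the p-th powers require the mean value theorem.\<close>

lemma J_difference_quotient:
  assumes Z: "hconv Z w" and \<Psi>: "hconv \<Psi> \<phi>" and \<epsilon>: "\<And>n. \<epsilon> n > 0" "\<epsilon> \<longlonglongrightarrow> 0"
  shows "(\<lambda>n. (J (\<lambda>x. Z n x + \<epsilon> n * \<Psi> n x) - J (Z n)) / \<epsilon> n) \<longlonglongrightarrow> J' w \<phi>"
proof -
  define W where "W n = (\<lambda>x. Z n x + \<epsilon> n * \<Psi> n x)" for n
  have W: "hconv W w" unfolding W_def[abs_def] using hconv_add[OF Z hconv_scale[OF \<Psi> \<epsilon>(2)]] by simp
  note H = hconv_inH(1)[OF Z] hconv_inH(1)[OF W] hconv_inH(1)[OF \<Psi>]
  note L = inH_l2[OF H(1)] inH_l2[OF H(2)] inH_l2[OF H(3)]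
  have "\<exists>\<xi>. \<bar>W n x\<bar> powr p - \<bar>Z n x\<bar> powr p = p * (\<bar>\<xi>\<bar> powr (p - 2) * \<xi>) * (W n x - Z n x)
      \<and> \<bar>\<xi> - w x\<bar> \<le> \<bar>W n x - w x\<bar> + \<bar>Z n x - w x\<bar>" for n x
    using abs_powr_mean_value[of p "W n x" "Z n x"] p_gt by (metis (no_types, lifting) less_trans numeral_less_iff semiring_norm(76) semiring_norm(78))
  \<comment> \<open>An intermediate point is chosen separately at every lattice site. The second
    property squeezes the resulting functions to \<open>w\<close> in l2.\<close>
  then obtain \<Xi> where \<Xi>: "\<And>n x. \<bar>W n x\<bar> powr p - \<bar>Z n x\<bar> powr p = p * (\<bar>\<Xi> n x\<bar> powr (p - 2) * \<Xi> n x) * (W n x - Z n x)"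
      "\<And>n x. \<bar>\<Xi> n x - w x\<bar> \<le> \<bar>W n x - w x\<bar> + \<bar>Z n x - w x\<bar>"
    by metis
  have cw: "l2_conv \<Xi> w"
  proof -
    have ab: "l2_conv (\<lambda>n x. \<bar>U n x - w x\<bar>) (\<lambda>_. 0)" if "hconv U w" for U
    proof -
      have "l2_conv (\<lambda>n x. U n x - w x) (\<lambda>_. 0)"
        using l2_conv_diff[OF hconv_l2[OF that] l2_conv_const[OF l2_convD(2)[OF hconv_l2[OF that]]]] by simp
      then have "l2_conv (\<lambda>n x. abs (U n x - w x)) (\<lambda>_. abs 0)"
        by (rule l2_conv_lipschitz) (auto intro!: exI[of _ 1] abs_triangle_ineq3)
      then show ?thesis by simp
    qed
    define T where "T n x = \<bar>W n x - w x\<bar> + \<bar>Z n x - w x\<bar>" for n x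
    have T: "l2_conv T (\<lambda>_. 0)" unfolding T_def[abs_def] using l2_conv_add[OF ab[OF W] ab[OF Z]] by simp
    have T0: "T n x \<ge> 0" for n x by (simp add: T_def)
    have lw: "l2 w" "l2 (\<lambda>x. \<bar>w x\<bar>)" using l2_convD(2)[OF hconv_l2[OF W]] by (auto simp: l2_def)
    show ?thesis
    proof (rule l2_conv_dominated[OF _ lw(1) l2_convD(1)[OF T]])
      show "l2 (\<Xi> n)" for n
      proof (rule l2_dominated[OF l2_add[OF lw(2) l2_convD(1)[OF T, of n]]])
        show "\<bar>\<Xi> n x\<bar> \<le> \<bar>\<bar>w x\<bar> + T n x\<bar>" for x using \<Xi>(2)[of n x] T0[of n x] unfolding T_def by linarith
      qed
      show "(\<lambda>n. ip (T n) (T n)) \<longlonglongrightarrow> 0" using l2_convD(3)[OF T] by simp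
      show "\<bar>\<Xi> n x - w x\<bar> \<le> \<bar>T n x\<bar>" for n x using \<Xi>(2)[of n x] T0[of n x] unfolding T_def by linarith
    qed
  qed
  define N where "N n = (\<lambda>x. G (\<Xi> n) x * \<Psi> n x)" for n
  have N: "l1_conv N (\<lambda>x. G w x * \<phi> x)"
    unfolding N_def[abs_def] by (rule l2_conv_mult[OF l2_conv_G[OF cw] hconv_l2[OF \<Psi>]])
  note Ps = P_summable[OF L(1)] P_summable[OF L(2)]
  have PW: "P (W n) x - P (Z n) x = (\<epsilon> n * p) * N n x" for n x
    using \<Xi>(1)[of n x] by (simp add: P_def N_def G_def W_def mult_ac)
  have Bd: "B (P (W n)) (P (W n)) - B (P (Z n)) (P (Z n)) = \<epsilon> n * p * (B (P (W n)) (N n) + B (P (Z n)) (N n))" for n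
  proof -
    have 1: "B (P (W n)) (P (W n)) - B (P (W n)) (P (Z n)) = \<epsilon> n * p * B (P (W n)) (N n)"
      using kform_diff_right[OF Ps(2) Ps(2) Ps(1), of n n n] kform_scale_right[of "P (W n)" "\<epsilon> n * p" "N n"] by (simp add: B_def PW)
    have 2: "B (P (Z n)) (P (W n)) - B (P (Z n)) (P (Z n)) = \<epsilon> n * p * B (P (Z n)) (N n)"
      using kform_diff_right[OF Ps(1) Ps(2) Ps(1), of n n n] kform_scale_right[of "P (Z n)" "\<epsilon> n * p" "N n"] by (simp add: B_def PW)
    show ?thesis using 1 2 B_commute[OF Ps(2)[of n] Ps(1)[of n]] by (simp add: distrib_left)
  qed
  have Dd: "Dir_form (W n) (W n) = Dir_form (Z n) (Z n) + \<epsilon> n * (Dir_form (W n) (\<Psi> n) + Dir_form (Z n) (\<Psi> n))" for n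
    using Dir_form_add_right[OF L(2) L(1) l2_scale[OF L(3)], of n n "\<epsilon> n" n] Dir_form_add_right[OF L(1) L(1) l2_scale[OF L(3)], of n n "\<epsilon> n" n]
    by (simp add: Dir_form_scale_right Dir_form_commute[of "W n" "Z n"] distrib_left flip: W_def)
  have Vd: "V (W n) (W n) = V (Z n) (Z n) + \<epsilon> n * (V (W n) (\<Psi> n) + V (Z n) (\<Psi> n))" for n
    using V_add_right[OF H(2) H(1) inH_scale[OF H(3)], of n n "\<epsilon> n" n] V_add_right[OF H(1) H(1) inH_scale[OF H(3)], of n n "\<epsilon> n" n]
    by (simp add: V_scale_right V_commute[of "W n" "Z n"] distrib_left flip: W_def)
  \<comment> \<open>An exact formula in which \<open>\<epsilon> n\<close> has cancelled, so the
    limit is just continuity of the forms. The factor \<open>p\<close> from the mean value theorem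
    cancels against \<open>1/(2*p)\<close>.\<close>
  have Q: "(J (W n) - J (Z n)) / \<epsilon> n = 1/2 * (a * (Dir_form (W n) (\<Psi> n) + Dir_form (Z n) (\<Psi> n)) + (V (W n) (\<Psi> n) + V (Z n) (\<Psi> n)))
      + b/4 * ((Dir_form (W n) (W n) + Dir_form (Z n) (Z n)) * (Dir_form (W n) (\<Psi> n) + Dir_form (Z n) (\<Psi> n)))
      - 1/2 * (B (P (W n)) (N n) + B (P (Z n)) (N n))" for n
  proof -
    define e d1 d2 q v v2 n1 k1 k2 where "e = \<epsilon> n" and "d1 = Dir_form (W n) (W n)" and "d2 = Dir_form (Z n) (Z n)"
      and "q = Dir_form (W n) (\<Psi> n) + Dir_form (Z n) (\<Psi> n)" and "v = V (Z n) (Z n)" and "v2 = V (W n) (\<Psi> n) + V (Z n) (\<Psi> n)"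
      and "n1 = B (P (W n)) (N n) + B (P (Z n)) (N n)" and "k1 = B (P (W n)) (P (W n))" and "k2 = B (P (Z n)) (P (Z n))"
    have k: "k1 = k2 + e * p * n1" using Bd[of n] by (simp add: k1_def k2_def e_def n1_def)
    have d: "d1 = d2 + e * q" using Dd[of n] by (simp add: d1_def d2_def e_def q_def)
    have "e > 0" "p > 0" using \<epsilon>(1)[of n] p_gt by (auto simp: e_def)
    have 1: "1/(2*p) * k1 - 1/(2*p) * k2 = e * (1/2 * n1)" using \<open>p > 0\<close> unfolding k by (simp add: field_simps)
    have 2: "b/4 * d1^2 - b/4 * d2^2 = e * (b/4 * ((d1 + d2) * q))" unfolding d by (simp add: power2_eq_square algebra_simps)
    have "J (W n) - J (Z n) = 1/2 * (a * d1 + (v + e * v2)) + b/4 * d1^2 - 1/(2*p) * k1 - (1/2 * (a * d2 + v) + b/4 * d2^2 - 1/(2*p) * k2)"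
      unfolding J_eq[OF H(1)] J_eq[OF H(2)] Vd d1_def d2_def e_def v_def v2_def k1_def k2_def by simp
    also have "\<dots> = 1/2 * (a * (e * q) + e * v2) + (b/4 * d1^2 - b/4 * d2^2) - (1/(2*p) * k1 - 1/(2*p) * k2)"
      by (simp add: d algebra_simps)
    also have "\<dots> = e * (1/2 * (a * q + v2) + b/4 * ((d1 + d2) * q) - 1/2 * n1)"
      unfolding 1 2 by (simp add: algebra_simps)
    finally show ?thesis using \<open>e > 0\<close> by (simp add: e_def d1_def d2_def q_def v2_def n1_def)
  qed
  note hl = hconv_l2[OF W] hconv_l2[OF Z] hconv_l2[OF \<Psi>]
  have "(\<lambda>n. (J (W n) - J (Z n)) / \<epsilon> n) \<longlonglongrightarrow> 1/2 * (a * (Dir_form w \<phi> + Dir_form w \<phi>) + (V w \<phi> + V w \<phi>))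
      + b/4 * ((Dir_form w w + Dir_form w w) * (Dir_form w \<phi> + Dir_form w \<phi>))
      - 1/2 * (B (P w) (\<lambda>x. G w x * \<phi> x) + B (P w) (\<lambda>x. G w x * \<phi> x))"
    unfolding Q B_def
    by (intro tendsto_add tendsto_diff tendsto_mult tendsto_const Dir_form_tendsto V_tendsto kform_tendsto hl W Z \<Psi> N l1_conv_P)
  also have "1/2 * (a * (Dir_form w \<phi> + Dir_form w \<phi>) + (V w \<phi> + V w \<phi>))
      + b/4 * ((Dir_form w w + Dir_form w w) * (Dir_form w \<phi> + Dir_form w \<phi>))
      - 1/2 * (B (P w) (\<lambda>x. G w x * \<phi> x) + B (P w) (\<lambda>x. G w x * \<phi> x)) = J' w \<phi>"
    unfolding J'_eq[OF hconv_inH(2)[OF W] hconv_inH(2)[OF \<Psi>]] by (simp add: algebra_simps)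
  finally show ?thesis unfolding W_def .
qed

text \<open>Plain l2 convergence suffices for all these coefficients; the potential terms are absent
  because they need \<open>hconv\<close>.\<close>

lemma coefficients_tendsto:
  assumes "l2_conv U u"
  shows "(\<lambda>n. D1 (U n)) \<longlonglongrightarrow> D1 u" "(\<lambda>n. D2 (U n)) \<longlonglongrightarrow> D2 u" "(\<lambda>n. E (U n)) \<longlonglongrightarrow> E u"
    "(\<lambda>n. B11 (U n)) \<longlonglongrightarrow> B11 u" "(\<lambda>n. B12 (U n)) \<longlonglongrightarrow> B12 u" "(\<lambda>n. B22 (U n)) \<longlonglongrightarrow> B22 u"
    "(\<lambda>n. ip (P (upos (U n))) (P (upos (U n)))) \<longlonglongrightarrow> ip (P (upos u)) (P (upos u))"
    "(\<lambda>n. ip (P (uneg (U n))) (P (uneg (U n)))) \<longlonglongrightarrow> ip (P (uneg u)) (P (uneg u))"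
proof -
  note c = l2_conv_upos[OF assms] l2_conv_uneg[OF assms]
  show "(\<lambda>n. D1 (U n)) \<longlonglongrightarrow> D1 u" "(\<lambda>n. D2 (U n)) \<longlonglongrightarrow> D2 u" "(\<lambda>n. E (U n)) \<longlonglongrightarrow> E u"
    by (rule Dir_form_tendsto[OF c(1) c(1)] Dir_form_tendsto[OF c(2) c(2)] Dir_form_tendsto[OF c(1) c(2)])+
  show "(\<lambda>n. B11 (U n)) \<longlonglongrightarrow> B11 u" "(\<lambda>n. B12 (U n)) \<longlonglongrightarrow> B12 u" "(\<lambda>n. B22 (U n)) \<longlonglongrightarrow> B22 u"
    unfolding B_def
    by (rule kform_tendsto[OF l1_conv_P[OF c(1)] l1_conv_P[OF c(1)]] kform_tendsto[OF l1_conv_P[OF c(2)] l1_conv_P[OF c(2)]]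
        kform_tendsto[OF l1_conv_P[OF c(1)] l1_conv_P[OF c(2)]])+
  show "(\<lambda>n. ip (P (upos (U n))) (P (upos (U n)))) \<longlonglongrightarrow> ip (P (upos u)) (P (upos u))"
    "(\<lambda>n. ip (P (uneg (U n))) (P (uneg (U n)))) \<longlonglongrightarrow> ip (P (uneg u)) (P (uneg u))"
    by (rule ip_tendsto[OF l2_conv_P[OF c(1)] l2_conv_P[OF c(1)]] ip_tendsto[OF l2_conv_P[OF c(2)] l2_conv_P[OF c(2)]])+
qed

lemma slopes_tendsto:
  assumes "hconv U u"
  shows "(\<lambda>n. S1 (U n) 1 1) \<longlonglongrightarrow> S1 u 1 1" "(\<lambda>n. S2 (U n) 1 1) \<longlonglongrightarrow> S2 u 1 1"
  unfolding S1_def S2_def fiber_slope_def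
  by (intro tendsto_intros coefficients_tendsto[OF hconv_l2[OF assms]] V_tendsto[OF hconv_upos[OF assms] hconv_upos[OF assms]]
      V_tendsto[OF hconv_uneg[OF assms] hconv_uneg[OF assms]])+

text \<open>The increments of positive and negative part add up to \<open>d\<close> and are each
  bounded by \<open>\<bar>d x\<bar>\<close>, so with \<open>s\<close> and \<open>t\<close> near 1
  the combination moves by nearly \<open>d\<close>. This stands in for differentiating the
  truncations.\<close>

lemma pn_comb_increment:
  "\<bar>(pn_comb (\<lambda>x. w x + d x) s t x - pn_comb w s t x) - d x\<bar> \<le> (\<bar>s - 1\<bar> + \<bar>t - 1\<bar>) * \<bar>d x\<bar>"
proof -
  define A C where "A = max (w x + d x) 0 - max (w x) 0" and "C = min (w x + d x) 0 - min (w x) 0"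
  have AC: "A + C = d x" "\<bar>A\<bar> \<le> \<bar>d x\<bar>" "\<bar>C\<bar> \<le> \<bar>d x\<bar>" by (auto simp: A_def C_def max_def min_def)
  have "(pn_comb (\<lambda>x. w x + d x) s t x - pn_comb w s t x) - d x = (s - 1) * A + (t - 1) * C"
    unfolding AC(1)[symmetric] by (simp add: pn_comb_def upos_def uneg_def A_def C_def algebra_simps)
  also have "\<bar>\<dots>\<bar> \<le> \<bar>s - 1\<bar> * \<bar>A\<bar> + \<bar>t - 1\<bar> * \<bar>C\<bar>" using abs_triangle_ineq[of "(s - 1) * A" "(t - 1) * C"] by (simp add: abs_mult)
  also have "\<dots> \<le> \<bar>s - 1\<bar> * \<bar>d x\<bar> + \<bar>t - 1\<bar> * \<bar>d x\<bar>" by (intro add_mono mult_left_mono AC) auto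
  finally show ?thesis by (simp add: distrib_right)
qed

text \<open>The maximisers on the fibers of perturbations of a Nehari point converge to \<open>(1, 1)\<close>, since the
  tangent plane bound is quadratically strict.\<close>
lemma fiber_max_tendsto_1:
  assumes U: "hconv U w" and w: "w \<in> M" and nz: "\<And>n. upos (U n) \<noteq> (\<lambda>_. 0)" "\<And>n. uneg (U n) \<noteq> (\<lambda>_. 0)"
    and st: "\<And>n. s n > 0" "\<And>n. t n > 0" and mx: "\<And>n. Fib (U n) 1 1 \<le> Fib (U n) (s n) (t n)"
  shows "s \<longlonglongrightarrow> 1" "t \<longlonglongrightarrow> 1"
proof -
  have w': "inH w" "upos w \<noteq> (\<lambda>_. 0)" "uneg w \<noteq> (\<lambda>_. 0)" "S1 w 1 1 = 0" "S2 w 1 1 = 0" using w mem_M_iff by auto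
  note UH = hconv_inH(1)[OF U]
  define I1 I2 where "I1 u = ip (P (upos u)) (P (upos u))" and "I2 u = ip (P (uneg u)) (P (uneg u))" for u
  define x y where "x n = s n powr p - 1" and "y n = t n powr p - 1" for n
  define r where "r n = max \<bar>x n\<bar> \<bar>y n\<bar>" for n
  define m where "m n = min (I1 (U n)) (I2 (U n))" for n
  define S where "S n = \<bar>S1 (U n) 1 1\<bar> + \<bar>S2 (U n) 1 1\<bar>" for n
  have Ipos: "I1 (U n) > 0" "I2 (U n) > 0" "I1 w > 0" "I2 w > 0" for n
    unfolding I1_def I2_def using nz w' UH by (auto intro!: ip_P_pos inH_upos inH_uneg)
  have mpos: "m n > 0" for n using Ipos by (simp add: m_def)
  have r0: "r n \<ge> 0" for n by (simp add: r_def le_max_iff_disj)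
  \<comment> \<open>Comparing (1, 1) with the maximum through \<open>Fib_tangent\<close> gives
    \<open>c0 * m n * (r n)^2 \<le> 2 * r n * S n\<close>. The slopes in \<open>S n\<close> tend to
    those of \<open>w\<close>, which vanish, while \<open>m n\<close> has a positive limit.\<close>
  have bound: "r n \<le> 2 * S n / (c0 * m n)" for n
  proof (cases "r n = 0")
    case True
    then show ?thesis using mpos[of n] c0_pos by (simp add: S_def)
  next
    case False
    then have rp: "r n > 0" using r0[of n] by simp
    have "J (U n) = Fib (U n) 1 1" using J_pn_comb[OF UH, of 1 1 n] by simp
    then have "J (U n) \<le> Fib (U n) (s n) (t n)" using mx[of n] by simp
    also have "\<dots> \<le> J (U n) + x n / p * S1 (U n) 1 1 + y n / p * S2 (U n) 1 1
       - c0/(2*p) * (I1 (U n) * (x n)^2 + I2 (U n) * (y n)^2)"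
      unfolding x_def y_def I1_def I2_def by (rule Fib_tangent[OF UH]) (use st less_imp_le in auto)
    finally have "c0/(2*p) * (I1 (U n) * (x n)^2 + I2 (U n) * (y n)^2) \<le> x n / p * S1 (U n) 1 1 + y n / p * S2 (U n) 1 1" by simp
    then have "(2*p) * (c0/(2*p) * (I1 (U n) * (x n)^2 + I2 (U n) * (y n)^2)) \<le> (2*p) * (x n / p * S1 (U n) 1 1 + y n / p * S2 (U n) 1 1)"
      using p_gt by (intro mult_left_mono) auto
    then have 1: "c0 * (I1 (U n) * (x n)^2 + I2 (U n) * (y n)^2) \<le> 2 * (x n * S1 (U n) 1 1 + y n * S2 (U n) 1 1)"
      using p_gt by (simp add: distrib_left)
    have 2: "x n * S1 (U n) 1 1 + y n * S2 (U n) 1 1 \<le> r n * S n"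
    proof -
      have "x n * S1 (U n) 1 1 \<le> \<bar>x n\<bar> * \<bar>S1 (U n) 1 1\<bar>" "y n * S2 (U n) 1 1 \<le> \<bar>y n\<bar> * \<bar>S2 (U n) 1 1\<bar>"
        by (metis abs_ge_self abs_mult)+
      moreover have "\<bar>x n\<bar> * \<bar>S1 (U n) 1 1\<bar> \<le> r n * \<bar>S1 (U n) 1 1\<bar>" "\<bar>y n\<bar> * \<bar>S2 (U n) 1 1\<bar> \<le> r n * \<bar>S2 (U n) 1 1\<bar>"
        by (intro mult_right_mono; simp add: r_def)+
      ultimately show ?thesis unfolding S_def distrib_left by linarith
    qed
    have 3: "m n * (r n)^2 \<le> I1 (U n) * (x n)^2 + I2 (U n) * (y n)^2"
    proof -
      have "(r n)^2 \<le> (x n)^2 + (y n)^2" unfolding r_def by (simp add: max_def)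
      then have "m n * (r n)^2 \<le> m n * ((x n)^2 + (y n)^2)" using mpos[of n] by (intro mult_left_mono) auto
      also have "\<dots> \<le> I1 (U n) * (x n)^2 + I2 (U n) * (y n)^2"
        unfolding distrib_left by (intro add_mono mult_right_mono) (auto simp: m_def)
      finally show ?thesis .
    qed
    have "c0 * (m n * (r n)^2) \<le> c0 * (I1 (U n) * (x n)^2 + I2 (U n) * (y n)^2)" using c0_pos 3 by (intro mult_left_mono) auto
    also have "\<dots> \<le> 2 * (r n * S n)" by (rule order_trans[OF 1 mult_left_mono[OF 2]]) simp
    finally have "r n * (r n * (c0 * m n)) \<le> r n * (2 * S n)" by (simp add: power2_eq_square mult_ac)
    then have "r n * (c0 * m n) \<le> 2 * S n" using rp by simp
    then show ?thesis using mpos[of n] c0_pos by (simp add: pos_le_divide_eq)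
  qed
  have "(\<lambda>n. 2 * S n / (c0 * m n)) \<longlonglongrightarrow> 2 * (\<bar>S1 w 1 1\<bar> + \<bar>S2 w 1 1\<bar>) / (c0 * min (I1 w) (I2 w))"
    unfolding S_def m_def I1_def I2_def
  proof (intro tendsto_intros slopes_tendsto[OF U] coefficients_tendsto[OF hconv_l2[OF U]])
    show "c0 * min (ip (P (upos w)) (P (upos w))) (ip (P (uneg w)) (P (uneg w))) \<noteq> 0"
      using Ipos(3,4) c0_pos by (auto simp: I1_def I2_def min_def)
  qed
  then have "(\<lambda>n. 2 * S n / (c0 * m n)) \<longlonglongrightarrow> 0" using w' by simp
  then have r: "r \<longlonglongrightarrow> 0" by (rule tendsto_0_le_seq[OF r0 bound])
  have one: "q \<longlonglongrightarrow> 1" if q: "\<And>n. q n > 0" and qr: "\<And>n. \<bar>q n powr p - 1\<bar> \<le> r n" for q :: "nat \<Rightarrow> real"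
  proof -
    have "(\<lambda>n. \<bar>q n powr p - 1\<bar>) \<longlonglongrightarrow> 0" by (rule tendsto_0_le_seq[OF _ qr r]) auto
    then have "(\<lambda>n. q n powr p) \<longlonglongrightarrow> 1" by (simp add: LIM_zero_cancel tendsto_rabs_zero_iff)
    then have "(\<lambda>n. (q n powr p) powr (1/p)) \<longlonglongrightarrow> 1 powr (1/p)" by (intro tendsto_powr tendsto_const) auto
    moreover have "(q n powr p) powr (1/p) = q n" for n using q[of n] p_gt by (simp add: powr_powr)
    ultimately show ?thesis by simp
  qed
  show "s \<longlonglongrightarrow> 1" by (rule one[OF st(1)]) (simp add: r_def x_def)
  show "t \<longlonglongrightarrow> 1" by (rule one[OF st(2)]) (simp add: r_def y_def)
qed

text \<open>Perturb the minimiser \<open>w\<close> by \<open>\<epsilon> \<phi>\<close> and project back onto \<open>M\<close>. The projected point and the point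
  of the fiber of \<open>w\<close> with the same parameters \<open>(s, t)\<close> differ by \<open>\<epsilon> (\<phi> + o(1))\<close>, and the latter has
  energy at most \<open>J w\<close>.\<close>
lemma minimizer_deriv_nonneg:
  assumes w: "w \<in> M" and min: "\<And>v. v \<in> M \<Longrightarrow> J w \<le> J v" and \<phi>: "inH \<phi>"
  shows "0 \<le> J' w \<phi>"
proof -
  have w': "inH w" "upos w \<noteq> (\<lambda>_. 0)" "uneg w \<noteq> (\<lambda>_. 0)" using w mem_M_iff by auto
  obtain x1 where "upos w x1 \<noteq> 0" using w'(2) by (meson ext)
  then have x1: "w x1 > 0" by (simp add: upos_def max_def split: if_splits)
  obtain x2 where "uneg w x2 \<noteq> 0" using w'(3) by (meson ext)
  then have x2: "w x2 < 0" by (simp add: uneg_def min_def split: if_splits)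
  \<comment> \<open>Small enough that adding \<open>\<epsilon> n * \<phi>\<close> cannot change the
    sign of \<open>w\<close> at \<open>x1\<close> or \<open>x2\<close>, so every perturbation keeps
    both parts nonzero and can be projected.\<close>
  define \<delta> where "\<delta> = min (w x1) (- w x2) / (\<bar>\<phi> x1\<bar> + \<bar>\<phi> x2\<bar> + 1)"
  have q: "\<bar>\<phi> x1\<bar> + \<bar>\<phi> x2\<bar> + 1 > 0" by linarith
  have \<delta>: "\<delta> > 0" unfolding \<delta>_def using x1 x2 q by (intro divide_pos_pos) auto
  have \<delta>q: "\<delta> * (\<bar>\<phi> x1\<bar> + \<bar>\<phi> x2\<bar> + 1) = min (w x1) (- w x2)" using q by (simp add: \<delta>_def)
  define \<epsilon> where "\<epsilon> n = \<delta> / real (Suc n)" for n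
  have \<epsilon>: "\<epsilon> n > 0" "\<epsilon> n \<le> \<delta>" for n using \<delta> by (auto simp: \<epsilon>_def divide_le_eq mult_le_cancel_left1 intro: divide_pos_pos)
  have \<epsilon>0: "\<epsilon> \<longlonglongrightarrow> 0" unfolding \<epsilon>_def[abs_def] using LIMSEQ_Suc[OF lim_const_over_n[of \<delta>]] by simp
  define U where "U n = (\<lambda>x. w x + \<epsilon> n * \<phi> x)" for n
  have small: "\<epsilon> n * \<bar>\<phi> x1\<bar> < min (w x1) (- w x2)" "\<epsilon> n * \<bar>\<phi> x2\<bar> < min (w x1) (- w x2)" for n
  proof -
    have "\<epsilon> n * \<bar>\<phi> x1\<bar> \<le> \<delta> * \<bar>\<phi> x1\<bar>" "\<epsilon> n * \<bar>\<phi> x2\<bar> \<le> \<delta> * \<bar>\<phi> x2\<bar>" using \<epsilon>(2) by (auto intro: mult_right_mono)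
    moreover have "\<delta> * \<bar>\<phi> x1\<bar> < \<delta> * (\<bar>\<phi> x1\<bar> + \<bar>\<phi> x2\<bar> + 1)" "\<delta> * \<bar>\<phi> x2\<bar> < \<delta> * (\<bar>\<phi> x1\<bar> + \<bar>\<phi> x2\<bar> + 1)"
      using \<delta> by (auto intro!: mult_strict_left_mono)
    ultimately show "\<epsilon> n * \<bar>\<phi> x1\<bar> < min (w x1) (- w x2)" "\<epsilon> n * \<bar>\<phi> x2\<bar> < min (w x1) (- w x2)" unfolding \<delta>q by linarith+
  qed
  have sgn: "U n x1 > 0" "U n x2 < 0" for n
  proof -
    have "\<bar>\<epsilon> n * \<phi> x1\<bar> < w x1" "\<bar>\<epsilon> n * \<phi> x2\<bar> < - w x2" using small[of n] \<epsilon>(1)[of n] by (auto simp: abs_mult)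
    then show "U n x1 > 0" "U n x2 < 0" unfolding U_def by linarith+
  qed
  have "upos (U n) x1 \<noteq> 0" "uneg (U n) x2 \<noteq> 0" for n
    using sgn[of n] by (simp_all add: upos_def uneg_def max_def min_def)
  then have nz: "upos (U n) \<noteq> (\<lambda>_. 0)" "uneg (U n) \<noteq> (\<lambda>_. 0)" for n
    by metis+
  have U: "hconv U w" unfolding U_def[abs_def] using hconv_add[OF hconv_const[OF w'(1)] hconv_scale[OF hconv_const[OF \<phi>] \<epsilon>0]] by simp
  note UH = hconv_inH(1)[OF U]
  have "\<exists>s t. s > 0 \<and> t > 0 \<and> pn_comb (U n) s t \<in> M \<and> Fib (U n) 1 1 \<le> Fib (U n) s t" for n
    using projection[OF UH nz, of n] by (metis zero_le_one)
  then obtain s t where st: "\<And>n. s n > 0" "\<And>n. t n > 0" "\<And>n. pn_comb (U n) (s n) (t n) \<in> M"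
      "\<And>n. Fib (U n) 1 1 \<le> Fib (U n) (s n) (t n)" by metis
  have lim: "s \<longlonglongrightarrow> 1" "t \<longlonglongrightarrow> 1" using fiber_max_tendsto_1[OF U w nz st(1,2,4)] by auto
  define Z where "Z n = pn_comb w (s n) (t n)" for n
  define \<Psi> where "\<Psi> n = (\<lambda>x. (1 / \<epsilon> n) * (pn_comb (U n) (s n) (t n) x - Z n x))" for n
  have Z: "hconv Z w"
    using hconv_add[OF hconv_scale[OF hconv_const[OF inH_upos[OF w'(1)]] lim(1)] hconv_scale[OF hconv_const[OF inH_uneg[OF w'(1)]] lim(2)]]
    unfolding pn_comb_def[symmetric] by (simp add: Z_def[abs_def])
  have \<Psi>H: "inH (\<Psi> n)" for n
    using inH_scale[OF inH_add[OF inH_pn_comb[OF UH] inH_scale[OF inH_pn_comb[OF w'(1)]]], of "1 / \<epsilon> n" n "s n" "t n" "-1" "s n" "t n"]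
    by (simp add: \<Psi>_def Z_def)
  have \<Psi>: "hconv \<Psi> \<phi>"
    unfolding hconv_def
  proof (rule l2_conv_dominated)
    define k where "k n = \<bar>s n - 1\<bar> + \<bar>t n - 1\<bar>" for n
    show "l2 (wt (\<Psi> n))" for n using \<Psi>H by (simp add: inH_def)
    show lp: "l2 (wt \<phi>)" using \<phi> by (simp add: inH_def)
    show "l2 (\<lambda>x. k n * wt \<phi> x)" for n by (rule l2_scale[OF lp])
    have "(\<lambda>n. k n * (k n * ip (wt \<phi>) (wt \<phi>))) \<longlonglongrightarrow> (\<bar>1 - 1\<bar> + \<bar>1 - 1\<bar>) * ((\<bar>1 - 1\<bar> + \<bar>1 - 1\<bar>) * ip (wt \<phi>) (wt \<phi>))"
      unfolding k_def by (intro tendsto_intros lim)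
    then show "(\<lambda>n. ip (\<lambda>x. k n * wt \<phi> x) (\<lambda>x. k n * wt \<phi> x)) \<longlonglongrightarrow> 0"
      unfolding ip_scale_left ip_scale_right by simp
    fix n x
    \<comment> \<open>\<open>pn_comb_increment\<close> is used with increment
      \<open>\<epsilon> n * \<phi>\<close>. The factor \<open>\<epsilon> n\<close> cancels and
      leaves the error \<open>k n * \<bar>\<phi> x\<bar>\<close>, where \<open>k n\<close> tends to
      0.\<close>
    have "\<epsilon> n * (\<Psi> n x - \<phi> x) = (pn_comb (\<lambda>x. w x + \<epsilon> n * \<phi> x) (s n) (t n) x - pn_comb w (s n) (t n) x) - \<epsilon> n * \<phi> x"
      using \<epsilon>(1)[of n] by (simp add: \<Psi>_def Z_def U_def right_diff_distrib)
    then have "\<bar>\<epsilon> n * (\<Psi> n x - \<phi> x)\<bar> \<le> k n * \<bar>\<epsilon> n * \<phi> x\<bar>"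
      using pn_comb_increment[of w "\<lambda>x. \<epsilon> n * \<phi> x" "s n" "t n" x] by (simp add: k_def)
    then have "\<epsilon> n * \<bar>\<Psi> n x - \<phi> x\<bar> \<le> \<epsilon> n * (k n * \<bar>\<phi> x\<bar>)" using \<epsilon>(1)[of n] by (simp add: abs_mult mult_ac)
    then have "\<bar>\<Psi> n x - \<phi> x\<bar> \<le> k n * \<bar>\<phi> x\<bar>" using \<epsilon>(1)[of n] by simp
    then have "sqrt (h x) * \<bar>\<Psi> n x - \<phi> x\<bar> \<le> sqrt (h x) * (k n * \<bar>\<phi> x\<bar>)" using h_pos[of x] by (intro mult_left_mono) auto
    moreover have "k n \<ge> 0" by (simp add: k_def)
    moreover have "wt (\<Psi> n) x - wt \<phi> x = sqrt (h x) * (\<Psi> n x - \<phi> x)" by (simp add: wt_def right_diff_distrib)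
    ultimately show "\<bar>wt (\<Psi> n) x - wt \<phi> x\<bar> \<le> \<bar>k n * wt \<phi> x\<bar>"
      using h_pos[of x] by (simp add: wt_def[of \<phi>] abs_mult mult_ac)
  qed
  have "(\<lambda>n. (J (\<lambda>x. Z n x + \<epsilon> n * \<Psi> n x) - J (Z n)) / \<epsilon> n) \<longlonglongrightarrow> J' w \<phi>"
    by (rule J_difference_quotient[OF Z \<Psi> \<epsilon>(1) \<epsilon>0])
  moreover have "(J (\<lambda>x. Z n x + \<epsilon> n * \<Psi> n x) - J (Z n)) / \<epsilon> n \<ge> 0" for n
  proof -
    have "(\<lambda>x. Z n x + \<epsilon> n * \<Psi> n x) = pn_comb (U n) (s n) (t n)"
      using \<epsilon>(1)[of n] by (simp add: \<Psi>_def)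
    then have "J w \<le> J (\<lambda>x. Z n x + \<epsilon> n * \<Psi> n x)" using min st(3) by simp
    moreover have "J (Z n) \<le> J w"
      using M_fiber_max[OF w, of "s n" "t n"] J_pn_comb[OF w'(1), of "s n" "t n"] st(1,2)[of n] by (simp add: Z_def)
    ultimately show ?thesis using \<epsilon>(1)[of n] by simp
  qed
  ultimately show ?thesis by (intro LIMSEQ_le_const[where X = "\<lambda>n. (J (\<lambda>x. Z n x + \<epsilon> n * \<Psi> n x) - J (Z n)) / \<epsilon> n"]) auto
qed

lemma minimizer_critical:
  assumes "w \<in> M" "\<And>v. v \<in> M \<Longrightarrow> J w \<le> J v" "inH \<phi>" shows "J' w \<phi> = 0"
proof -
  have "inH w" using assms(1) mem_M_iff by auto
  then have "J' w (\<lambda>x. (-1) * \<phi> x) = - J' w \<phi>" using J'_scale[of w \<phi> "-1"] assms(3) by simp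
  moreover have "0 \<le> J' w \<phi>" by (rule minimizer_deriv_nonneg[OF assms(1) _ assms(3)]) (rule assms(2))
  moreover have "0 \<le> J' w (\<lambda>x. (-1) * \<phi> x)"
    by (rule minimizer_deriv_nonneg[OF assms(1) _ inH_scale[OF assms(3)]]) (rule assms(2))
  ultimately show ?thesis by linarith
qed

section \<open>Compactness and existence of a minimiser\<close>

lemma compact_embedding:
  fixes U :: "nat \<Rightarrow> lat \<Rightarrow> real"
  assumes U: "\<And>n. inH (U n)" and K: "\<And>n. V (U n) (U n) \<le> K"
  obtains r u where "strict_mono r" "inH u" "l2_conv (\<lambda>n. U (r n)) u"
proof -
  have b: "\<bar>U n x\<bar> \<le> sqrt (K / h0)" for n x
  proof -
    have "h0 * (U n x)^2 \<le> h0 * ip (U n) (U n)" using h0_pos square_le_ip_self[OF inH_l2[OF U]] by (intro mult_left_mono) auto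
    also have "\<dots> \<le> K" using ip_le_V[OF U] K order_trans by blast
    finally have "(U n x)^2 \<le> K / h0" using h0_pos by (simp add: field_simps)
    then show ?thesis using real_le_rsqrt[of "\<bar>U n x\<bar>"] by simp
  qed
  obtain r u where r: "strict_mono r" and pw: "\<And>x. (\<lambda>n. U (r n) x) \<longlonglongrightarrow> u x"
    using pointwise_convergent_subseq[of U, OF b] by metis
  define W where "W n = U (r n)" for n
  have W: "inH (W n)" "V (W n) (W n) \<le> K" for n using U K by (auto simp: W_def)
  have Wpw: "(\<lambda>n. W n x) \<longlonglongrightarrow> u x" for x using pw by (simp add: W_def)
  have wpw: "(\<lambda>n. wt (W n) x) \<longlonglongrightarrow> wt u x" for x
    unfolding wt_def by (intro tendsto_mult tendsto_const Wpw)
  have wl: "l2 (wt (W n))" "ip (wt (W n)) (wt (W n)) \<le> K" for n using W by (simp_all add: inH_def V_def)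
  have "l2 (wt u)" "ip (wt u) (wt u) \<le> K"
    by (rule ip_Fatou[OF wl(1) wpw wl(2) tendsto_const])+
  then have u: "inH u" "V u u \<le> K" by (auto simp: inH_def V_def)
  have K0: "K \<ge> 0" using V_self_nonneg[of u] u(2) by linarith
  define d where "d n = (\<lambda>x. W n x + (-1) * u x)" for n
  have dH: "inH (d n)" for n unfolding d_def by (intro inH_add inH_scale W u)
  \<comment> \<open>Parallelogram law: adding the nonnegative value at \<open>W n + u\<close> gives
    at most \<open>2 * K + 2 * K\<close>.\<close>
  have dV: "V (d n) (d n) \<le> 4 * K" for n
  proof -
    have s: "inH (\<lambda>x. (-1) * u x)" by (intro inH_scale u)
    have cm: "V u (W n) = V (W n) u" by (rule V_commute)
    have "V (d n) (d n) = V (W n) (W n) - 2 * V (W n) u + V u u"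
      unfolding d_def V_add_left[OF inH_add[OF W(1) s] W(1) s] V_add_right[OF W(1) W(1) s] V_add_right[OF s W(1) s]
        V_scale_left V_scale_right cm by simp
    moreover have "0 \<le> V (\<lambda>x. W n x + u x) (\<lambda>x. W n x + u x)" by (rule V_self_nonneg)
    moreover have "V (\<lambda>x. W n x + u x) (\<lambda>x. W n x + u x) = V (W n) (W n) + 2 * V (W n) u + V u u"
      unfolding V_add_left[OF inH_add[OF W(1) u(1)] W(1) u(1)] V_add_right[OF W(1) W(1) u(1)] V_add_right[OF u(1) W(1) u(1)]
        cm by simp
    ultimately show ?thesis using W(2)[of n] u(2) by linarith
  qed
  have "(\<lambda>n. ip (d n) (d n)) \<longlonglongrightarrow> 0"
  proof (rule tendsto_0_eventually_le)
    show "0 \<le> ip (d n) (d n)" for n by (rule ip_self_nonneg)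
    fix e :: real assume e: "e > 0"
    \<comment> \<open>Outside a finite set \<open>h \<ge> C\<close>, so the tail of
      \<open>ip (d n) (d n)\<close> is at most \<open>4 * K / C\<close>, which is below
      \<open>e\<close>; the added 1 keeps \<open>C\<close> positive when \<open>K = 0\<close>. On
      the finite set pointwise convergence suffices.\<close>
    define C where "C = (4 * K + 1) / e"
    have C: "C > 0" using e K0 by (simp add: C_def)
    obtain R where R: "\<And>x. real_of_int (ldist x x0) \<ge> R \<Longrightarrow> h x \<ge> C" using growth[of C] by blast
    define F where "F = {x. real_of_int (ldist x x0) < R}"
    have F: "finite F" unfolding F_def by (rule finite_ldist_ball)
    have "ip (d n) (d n) \<le> (\<Sum>x\<in>F. d n x * d n x) + e" for n
    proof -
      have hs: "((\<lambda>x. if x \<in> F then d n x * d n x else 0) has_sum (\<Sum>x\<in>F. d n x * d n x)) UNIV"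
        by (rule has_sum_finite_neutralI[OF F]) (auto intro: sum.cong)
      have ws: "(\<lambda>x. 1/C * (wt (d n) x * wt (d n) x)) summable_on UNIV"
        using dH by (intro summable_on_cmult_right l2_mult_summable) (auto simp: inH_def)
      have "ip (d n) (d n) \<le> (\<Sum>\<^sub>\<infinity>x. (if x \<in> F then d n x * d n x else 0) + 1/C * (wt (d n) x * wt (d n) x))"
        unfolding ip_def
      proof (rule infsum_mono)
        show "(\<lambda>x. d n x * d n x) summable_on UNIV" by (intro l2_mult_summable inH_l2 dH)
        show "(\<lambda>x. (if x \<in> F then d n x * d n x else 0) + 1/C * (wt (d n) x * wt (d n) x)) summable_on UNIV"
          by (rule summable_on_add[OF has_sum_imp_summable[OF hs] ws])
        fix x
        have w: "wt (d n) x * wt (d n) x = h x * (d n x * d n x)" using h_pos[of x] by (simp add: wt_def)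
        show "d n x * d n x \<le> (if x \<in> F then d n x * d n x else 0) + 1/C * (wt (d n) x * wt (d n) x)"
        proof (cases "x \<in> F")
          case True
          then show ?thesis using C by simp
        next
          case False
          then have "C \<le> h x" using R by (simp add: F_def)
          then have "C * (d n x * d n x) \<le> h x * (d n x * d n x)" by (intro mult_right_mono) auto
          then show ?thesis using False C unfolding w by (simp add: field_simps)
        qed
      qed
      also have "\<dots> = (\<Sum>x\<in>F. d n x * d n x) + 1/C * V (d n) (d n)"
        by (subst infsum_add[OF has_sum_imp_summable[OF hs] ws]) (simp only: infsumI[OF hs] infsum_cmult_right' V_def ip_def)
      also have "1/C * V (d n) (d n) \<le> e"
      proof -
        have "V (d n) (d n) \<le> C * e" using dV[of n] e by (simp add: C_def)
        then show ?thesis using C by (simp add: field_simps)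
      qed
      finally show ?thesis by simp
    qed
    moreover have "(\<lambda>n. \<Sum>x\<in>F. d n x * d n x) \<longlonglongrightarrow> (\<Sum>x\<in>F. (u x + (-1) * u x) * (u x + (-1) * u x))"
      unfolding d_def by (intro tendsto_intros Wpw)
    ultimately show "\<exists>k. (\<forall>n. ip (d n) (d n) \<le> k n + e) \<and> k \<longlonglongrightarrow> 0"
      by (intro exI[of _ "\<lambda>n. \<Sum>x\<in>F. d n x * d n x"]) simp
  qed
  then have "l2_conv W u" unfolding l2_conv_def using inH_l2[OF W(1)] inH_l2[OF u(1)] by (simp add: d_def)
  then show ?thesis using that[OF r u(1)] by (simp add: W_def[abs_def])
qed

text \<open>The nonlocal term is of order \<open>p > 2\<close> in \<open>Q\<close>, so \<open>Q\<close> cannot tend to zero.\<close>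
lemma nonzero_limit:
  assumes Q: "l2_conv Q q" and U: "l2_conv U u" and QH: "\<And>n. inH (Q n)" and nz: "\<And>n. Q n \<noteq> (\<lambda>_. 0)"
    and le: "\<And>n. V (Q n) (Q n) \<le> B (P (Q n)) (P (U n))"
  shows "q \<noteq> (\<lambda>_. 0)"
proof
  assume q0: "q = (\<lambda>_. 0)"
  define i where "i n = ip (Q n) (Q n)" for n
  define N where "N n = ip (G (U n)) (U n)" for n
  have i: "i \<longlonglongrightarrow> 0" using ip_tendsto[OF Q Q] unfolding i_def[abs_def] q0 by (simp add: ip_def)
  have ipos: "i n > 0" for n
  proof -
    have "i n \<noteq> 0" using ip_self_eq_0[OF inH_l2[OF QH]] nz unfolding i_def by blast
    then show ?thesis using ip_self_nonneg[of "Q n"] unfolding i_def by linarith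
  qed
  \<comment> \<open>The sup norm of \<open>Q n\<close> is at most \<open>sqrt (i n)\<close>, so the
    l1 norm of its p-th power is at most \<open>sqrt (i n) powr (p - 2) * i n\<close>. Dividing by
    \<open>i n > 0\<close> leaves a right side that would tend to 0.\<close>
  have bound: "h0 \<le> CR * sqrt (i n) powr (p - 2) * N n" for n
  proof -
    note l = inH_l2[OF QH, of n] l2_convD(1)[OF U, of n]
    have PQ: "(\<Sum>\<^sub>\<infinity>x. \<bar>P (Q n) x\<bar>) \<le> sqrt (i n) powr (p - 2) * i n"
    proof -
      have "(\<Sum>\<^sub>\<infinity>x. \<bar>P (Q n) x\<bar>) \<le> (\<Sum>\<^sub>\<infinity>x. sqrt (i n) powr (p - 2) * (Q n x * Q n x))"
      proof (intro infsum_mono abs_summable_real P_summable l summable_on_cmult_right l2_mult_summable)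
        fix x
        have "\<bar>Q n x\<bar> \<le> sqrt (i n)" using square_le_ip_self[OF l(1), of x] real_le_rsqrt[of "\<bar>Q n x\<bar>"] by (simp add: i_def)
        then have "\<bar>Q n x\<bar> powr (p - 2) \<le> sqrt (i n) powr (p - 2)" using p_gt by (intro powr_mono2) auto
        then have "\<bar>Q n x\<bar> powr (p - 2) * (Q n x * Q n x) \<le> sqrt (i n) powr (p - 2) * (Q n x * Q n x)"
          by (intro mult_right_mono) auto
        then show "\<bar>P (Q n) x\<bar> \<le> sqrt (i n) powr (p - 2) * (Q n x * Q n x)"
          using abs_powr_eq[of "Q n x" p] by (simp add: P_def mult.assoc)
      qed
      then show ?thesis by (simp add: infsum_cmult_right' i_def ip_def)
    qed
    have PU: "(\<Sum>\<^sub>\<infinity>x. \<bar>P (U n) x\<bar>) = N n"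
      using P_nonneg by (simp add: N_def ip_def P_eq[symmetric])
    have N0: "N n \<ge> 0" unfolding PU[symmetric] by (intro infsum_nonneg) simp
    have "h0 * i n \<le> V (Q n) (Q n)" unfolding i_def by (rule ip_le_V[OF QH])
    also have "\<dots> \<le> CR * (\<Sum>\<^sub>\<infinity>x. \<bar>P (Q n) x\<bar>) * (\<Sum>\<^sub>\<infinity>x. \<bar>P (U n) x\<bar>)"
      using le[of n] abs_kform_le[OF P_summable[OF l(1)] P_summable[OF l(2)]] unfolding B_def by linarith
    also have "\<dots> \<le> CR * (sqrt (i n) powr (p - 2) * i n) * N n"
      unfolding PU by (intro mult_right_mono mult_left_mono PQ N0 C_nonneg)
    finally have "h0 * i n \<le> (CR * sqrt (i n) powr (p - 2) * N n) * i n" by (simp add: mult_ac)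
    then show ?thesis using ipos[of n] by simp
  qed
  have "(\<lambda>n. sqrt (i n) powr (p - 2)) \<longlonglongrightarrow> 0"
    by (rule tendsto_zero_powrI[of _ _ _ "p - 2"]) (use tendsto_real_sqrt[OF i] ipos[THEN less_imp_le] p_gt in auto)
  then have "(\<lambda>n. CR * sqrt (i n) powr (p - 2) * N n) \<longlonglongrightarrow> CR * 0 * ip (G u) u"
    unfolding N_def by (intro tendsto_mult tendsto_const ip_tendsto[OF l2_conv_G[OF U] U])
  then have "h0 \<le> CR * 0 * ip (G u) u" by (rule LIMSEQ_le_const) (use bound in auto)
  then show False using h0_pos by simp
qed

text \<open>The first two bounds drop the nonnegative Dirichlet terms from the two constraints. The
  third is J minus 1/(2p) times the derivative tested with \<open>u\<close> itself: the nonlocal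
  term disappears, and \<open>p > 4\<close> makes the coefficients 1/2 - 1/(2p) and 1/4 - 1/(2p) of
  the remaining terms positive.\<close>

lemma M_part_bounds:
  assumes "u \<in> M"
  shows "V1 u \<le> B (P (upos u)) (P u)" "V2 u \<le> B (P (uneg u)) (P u)" "(1/2 - 1/(2*p)) * V u u \<le> J u"
proof -
  have u: "inH u" "S1 u 1 1 = 0" "S2 u 1 1 = 0" using assms mem_M_iff by auto
  define Q where "Q = D1 u + D2 u + 2 * E u"
  have nn: "D1 u \<ge> 0" "D2 u \<ge> 0" "E u \<ge> 0" by (rule Dir_form_self_nonneg Dir_form_pos_neg_nonneg)+
  then have Q0: "Q \<ge> 0" by (simp add: Q_def)
  note s = P_pn_summable[OF u(1)]
  have Pu: "P u = (\<lambda>x. P (upos u) x + P (uneg u) x)" using P_pn_comb[of 1 1 u] by simp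
  have B1: "B (P (upos u)) (P u) = B11 u + B12 u" unfolding Pu B_def by (rule kform_add_right[OF s(1) s])
  have B2: "B (P (uneg u)) (P u) = B22 u + B12 u"
    unfolding Pu using kform_add_right[OF s(2) s] B_commute[OF s(2) s(1)] by (simp add: B_def)
  have e1: "a * (D1 u + E u) + V1 u + b * Q * (D1 u + E u) = B11 u + B12 u"
    using u(2) by (simp add: S1_def fiber_slope_def Q_def)
  have e2: "a * (D2 u + E u) + V2 u + b * Q * (D2 u + E u) = B22 u + B12 u"
    using u(3) by (simp add: S2_def fiber_slope_def Q_def algebra_simps)
  have "a * (D1 u + E u) \<ge> 0" "b * Q * (D1 u + E u) \<ge> 0" "a * (D2 u + E u) \<ge> 0" "b * Q * (D2 u + E u) \<ge> 0"
    using a_pos b_pos Q0 nn by (auto intro!: mult_nonneg_nonneg)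
  then show "V1 u \<le> B (P (upos u)) (P u)" "V2 u \<le> B (P (uneg u)) (P u)" using e1 e2 B1 B2 by linarith+
  have e3: "B11 u + 2 * B12 u + B22 u = a * Q + (V1 u + V2 u) + b * Q^2"
    using e1 e2 by (simp add: Q_def power2_eq_square algebra_simps)
  have VV: "V u u = V1 u + V2 u" using V_pn_comb(3)[OF u(1), of 1 1] by simp
  have "J u = Fib u 1 1" using J_pn_comb[OF u(1), of 1 1] by simp
  also have "\<dots> = 1/2 * (a * Q + (V1 u + V2 u)) + b/4 * Q^2 - 1/(2*p) * (B11 u + 2 * B12 u + B22 u)"
    by (simp add: Fib_def fiber_def Q_def)
  also have "\<dots> = (1/2 - 1/(2*p)) * (a * Q) + (1/2 - 1/(2*p)) * V u u + (1/4 - 1/(2*p)) * (b * Q^2)"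
    unfolding e3 VV by (simp add: algebra_simps)
  finally have Ju: "J u = \<dots>" .
  have "1/2 - 1/(2*p) \<ge> 0" "1/4 - 1/(2*p) \<ge> 0" using p_gt by (auto simp: field_simps)
  then have "(1/2 - 1/(2*p)) * (a * Q) \<ge> 0" "(1/4 - 1/(2*p)) * (b * Q^2) \<ge> 0"
    using a_pos b_pos Q0 by (auto intro!: mult_nonneg_nonneg simp del: diff_ge_0_iff_ge)
  then show "(1/2 - 1/(2*p)) * V u u \<le> J u" unfolding Ju by linarith
qed

lemma J_nonneg_on_M: "u \<in> M \<Longrightarrow> 0 \<le> J u"
proof -
  assume "u \<in> M"
  moreover have "0 \<le> (1/2 - 1/(2*p)) * V u u" using p_gt V_self_nonneg by (intro mult_nonneg_nonneg) (auto simp: field_simps)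
  ultimately show ?thesis using M_part_bounds(3) by fastforce
qed

lemma M_nonempty: "M \<noteq> {}"
proof -
  define u :: "lat \<Rightarrow> real" where "u x = (if x = (0,0,0) then 1 else if x = (1,0,0) then -1 else 0)" for x
  have "finite {x. (wt u x)^2 \<noteq> 0}"
    by (rule finite_subset[of _ "{(0,0,0), (1,0,0)}"]) (auto simp: wt_def u_def)
  then have "(\<lambda>x. (wt u x)^2) summable_on UNIV" by (intro finite_nonzero_values_imp_summable_on) simp
  then have "inH u" by (simp add: inH_def l2_def)
  moreover have "upos u (0,0,0) \<noteq> 0" "uneg u (1,0,0) \<noteq> 0" by (auto simp: upos_def uneg_def u_def)
  then have "upos u \<noteq> (\<lambda>_. 0)" "uneg u \<noteq> (\<lambda>_. 0)" by metis+
  ultimately show ?thesis using projection by blast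
qed

lemma minimizer_exists: "\<exists>w\<in>M. \<forall>v\<in>M. J w \<le> J v"
proof -
  define m where "m = (INF v\<in>M. J v)"
  have bdd: "bdd_below (J ` M)" by (rule bdd_belowI[of _ 0]) (use J_nonneg_on_M in auto)
  have m_le: "m \<le> J v" if "v \<in> M" for v unfolding m_def by (rule cINF_lower[OF bdd that])
  have "\<exists>v\<in>M. J v < m + 1 / real (Suc n)" for n
    using cINF_less_iff[OF M_nonempty bdd, of "m + 1 / real (Suc n)"] by (simp add: m_def)
  then obtain U where U: "\<And>n. U n \<in> M" "\<And>n. J (U n) < m + 1 / real (Suc n)" by metis
  have JU: "(\<lambda>n. J (U n)) \<longlonglongrightarrow> m"
  proof (rule tendsto_sandwich[OF _ _ tendsto_const])
    have "(\<lambda>n. m + 1 / real (Suc n)) \<longlonglongrightarrow> m + 0"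
      by (rule tendsto_add[OF tendsto_const LIMSEQ_Suc[OF lim_const_over_n[of 1]]])
    then show "(\<lambda>n. m + 1 / real (Suc n)) \<longlonglongrightarrow> m" by simp
  qed (use U(1) U(2)[THEN less_imp_le] m_le in \<open>auto intro!: always_eventually simp del: of_nat_Suc\<close>)
  have UH: "inH (U n)" for n using U(1) mem_M_iff by blast
  define k where "k = 1/2 - 1/(2*p)"
  have k: "k > 0" using p_gt by (simp add: k_def field_simps)
  define K where "K = (m + 1) / k"
  have UV: "V (U n) (U n) \<le> K" for n
  proof -
    have "k * V (U n) (U n) \<le> J (U n)" unfolding k_def by (rule M_part_bounds(3)[OF U(1)])
    also have "\<dots> \<le> m + 1" using U(2)[of n] by (smt (verit) divide_le_eq_1 of_nat_Suc of_nat_0_le_iff)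
    finally show ?thesis using k by (simp add: K_def pos_le_divide_eq mult.commute)
  qed
  obtain r u where r: "strict_mono r" and u: "inH u" and c: "l2_conv (\<lambda>n. U (r n)) u"
    using compact_embedding[of U, OF UH UV] by metis
  \<comment> \<open>The potential terms of the two parts are only bounded along the sequence. A
    further subsequence makes both converge, to limits that may exceed the values at
    \<open>u\<close>.\<close>
  have V12: "V1 (U n) \<in> {0..K}" "V2 (U n) \<in> {0..K}" for n
    using V_pn_comb(3)[OF UH[of n], of 1 1] UV[of n] V_self_nonneg[of "upos (U n)"] V_self_nonneg[of "uneg (U n)"] by auto
  have "seq_compact ({0..K} \<times> {0..K})" by (intro compact_imp_seq_compact compact_Times) auto
  moreover have "\<forall>n. (V1 (U (r n)), V2 (U (r n))) \<in> {0..K} \<times> {0..K}" using V12 by auto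
  ultimately obtain v r2 where r2: "strict_mono r2" "((\<lambda>n. (V1 (U (r n)), V2 (U (r n)))) \<circ> r2) \<longlonglongrightarrow> v"
    by (rule seq_compactE) blast
  define W where "W n = U (r (r2 n))" for n
  have WM: "W n \<in> M" "inH (W n)" for n using U(1) UH by (auto simp: W_def)
  have W: "l2_conv W u" using l2_conv_subseq[OF c r2(1)] by (simp add: W_def[abs_def] o_def)
  have v: "(\<lambda>n. V1 (W n)) \<longlonglongrightarrow> fst v" "(\<lambda>n. V2 (W n)) \<longlonglongrightarrow> snd v"
    using tendsto_fst[OF r2(2)] tendsto_snd[OF r2(2)] by (simp_all add: W_def o_def)
  have JW: "(\<lambda>n. J (W n)) \<longlonglongrightarrow> m"
    using LIMSEQ_subseq_LIMSEQ[OF JU strict_mono_o[OF r r2(1)]] by (simp add: W_def o_def)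
  have lsc: "V q q \<le> L" if "l2_conv Q q" "\<And>n. inH (Q n)" "(\<lambda>n. V (Q n) (Q n)) \<longlonglongrightarrow> L" for Q q L
  proof -
    have "ip (wt q) (wt q) \<le> L"
    proof (rule ip_Fatou(2)[of "\<lambda>n. wt (Q n)"])
      show "l2 (wt (Q n))" for n using that(2) by (simp add: inH_def)
      show "(\<lambda>n. wt (Q n) x) \<longlonglongrightarrow> wt q x" for x
        unfolding wt_def by (intro tendsto_mult tendsto_const l2_conv_pointwise[OF that(1)])
      show "ip (wt (Q n)) (wt (Q n)) \<le> V (Q n) (Q n)" for n by (simp add: V_def)
    qed (rule that(3))
    then show ?thesis by (simp add: V_def)
  qed
  have V1u: "V1 u \<le> fst v" by (rule lsc[OF l2_conv_upos[OF W] inH_upos[OF WM(2)] v(1)])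
  have V2u: "V2 u \<le> snd v" by (rule lsc[OF l2_conv_uneg[OF W] inH_uneg[OF WM(2)] v(2)])
  have "upos u \<noteq> (\<lambda>_. 0)"
    by (rule nonzero_limit[OF l2_conv_upos[OF W] W inH_upos[OF WM(2)]]) (use WM mem_M_iff M_part_bounds in auto)
  moreover have "uneg u \<noteq> (\<lambda>_. 0)"
    by (rule nonzero_limit[OF l2_conv_uneg[OF W] W inH_uneg[OF WM(2)]]) (use WM mem_M_iff M_part_bounds in auto)
  ultimately obtain s t where st: "s > 0" "t > 0" "pn_comb u s t \<in> M" using projection[OF u] by metis
  \<comment> \<open>The parameters of the projection of \<open>u\<close> stay fixed while n varies.
    \<open>M_fiber_max\<close> bounds each \<open>Fib (W n) s t\<close> by \<open>J (W n)\<close>,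
    and \<open>fiber\<close> is nondecreasing in its potential coefficients, so lower semicontinuity
    is enough to reach \<open>Fib u s t\<close>.\<close>
  have "(\<lambda>n. Fib (W n) s t) \<longlonglongrightarrow> fiber a b p (fst v) (snd v) (D1 u) (D2 u) (E u) (B11 u) (B12 u) (B22 u) s t"
    unfolding Fib_def fiber_def by (intro tendsto_intros coefficients_tendsto[OF W] v)
  then have "fiber a b p (fst v) (snd v) (D1 u) (D2 u) (E u) (B11 u) (B12 u) (B22 u) s t \<le> m"
    by (rule LIMSEQ_le[OF _ JW]) (use M_fiber_max[OF WM(1)] st in auto)
  moreover have "Fib u s t \<le> fiber a b p (fst v) (snd v) (D1 u) (D2 u) (E u) (B11 u) (B12 u) (B22 u) s t"
    unfolding Fib_def fiber_def
    by (intro diff_right_mono add_right_mono mult_left_mono add_mono order_refl V1u V2u) auto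
  moreover have "J (pn_comb u s t) = Fib u s t" using J_pn_comb[OF u] st by simp
  ultimately have "J (pn_comb u s t) \<le> m" by linarith
  then show ?thesis using st(3) m_le order_trans by blast
qed

end

theorem theorem1p2:
  fixes a b \<alpha> p :: real and h :: "lat \<Rightarrow> real"
  assumes "a > 0" and "b > 0" and "0 < \<alpha>" and "\<alpha> < 3" and "p > 4"
    and "\<exists>h0>0. \<forall>x. h x \<ge> h0"
    and "\<exists>x0. \<forall>C. \<exists>r. \<forall>x. real_of_int (ldist x x0) \<ge> r \<longrightarrow> h x \<ge> C"
  shows "\<exists>u \<in> Mset a b \<alpha> p h.
           (\<forall>\<phi> \<in> Hsp h. dJ a b \<alpha> p h u \<phi> = 0) \<and>
           Jfun a b \<alpha> p h u = (INF v \<in> Mset a b \<alpha> p h. Jfun a b \<alpha> p h v) \<and>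
           (\<forall>v \<in> Mset a b \<alpha> p h. Jfun a b \<alpha> p h u \<le> Jfun a b \<alpha> p h v)"
proof -
  obtain h0 where h0: "h0 > 0" "\<And>x. h x \<ge> h0" using assms(6) by blast
  obtain x0 where x0: "\<And>C. \<exists>r. \<forall>x. real_of_int (ldist x x0) \<ge> r \<longrightarrow> h x \<ge> C" using assms(7) by blast
  obtain CR where CR: "\<And>x y. \<bar>Ralpha \<alpha> x y\<bar> \<le> CR" using Ralpha_bounded[OF assms(3,4)] by blast
  obtain c0 where c0: "c0 > 0"
    "\<And>F f. finite F \<Longrightarrow> c0 * (\<Sum>x\<in>F. (f x)^2) \<le> (\<Sum>x\<in>F. \<Sum>y\<in>F. f x * f y * Ralpha \<alpha> x y)"
    by (rule Ralpha_coercive[OF assms(3,4)], rule that, assumption, blast)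
  interpret kirchhoff a b \<alpha> p h h0 x0 CR c0
    by (rule kirchhoff.intro) (rule assms(1-5) h0 x0 CR c0 | assumption)+
  obtain u where u: "u \<in> M" "\<And>v. v \<in> M \<Longrightarrow> J u \<le> J v" using minimizer_exists by blast
  have "J u = (INF v \<in> M. J v)"
    by (rule cInf_eq_minimum[symmetric]) (use u in auto)
  moreover have "J' u \<phi> = 0" if "\<phi> \<in> Hsp h" for \<phi>
    by (rule minimizer_critical[OF u(1)]) (use u(2) that in \<open>simp_all add: Hsp_eq\<close>)
  ultimately show ?thesis using u by blast
qed

end
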